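(* For every integer $d > 0$ there exists $M = M(d) > 1$ such that $b_\Omega \in \mathcal{G}_M(\Omega)$ for every $\Omega \in \mathbb{X}_d$.
   Context: $\mathbb{X}_d$ is the set of convex domains in $\mathbb{C}^d$ which do not contain a complex affine line. $b_\Omega$ denotes the Bergman metric of $\Omega$: with $\kappa_\Omega$ the Bergman kernel, it is the Kähler metric given by the Hermitian form $\sum_{i,j} v_i \left(\frac{\partial^2}{\partial z_i \partial \overline{z}_j}\log \kappa_\Omega(z,z)\right)\overline{w}_j$ (whose real part is the associated Riemannian metric). $k_\Omega(z;v)$ denotes the infinitesimal Kobayashi metric and $K_\Omega$ the Kobayashi distance. A Kähler metric $g$ on $\Omega$ (with respect to the standard complex structure) is regarded as a Riemannian metric $g_z(\cdot,\cdot)$ on $\Omega$. For a $C^1$ function $f : \Omega \to \mathbb{C}$ and $X \in \mathbb{C}^d$, $X(f)(z) = \frac{d}{dt}\big|_{t=0} f(z+tX)$ with $t$ real; vectors of $\mathbb{C}^d$ are treated as constant vector fields. For $M > 1$, $\mathcal{G}_M(\Omega)$ is the set of Kähler metrics $g$ on $\Omega$ (with respect to the standard complex structure) such that: (1) $g$ is a $C^2$ metric; (2) for all $z \in \Omega$, $v \in \mathbb{C}^d$: $\frac{1}{M}\sqrt{g_z(v,v)} \leq k_\Omega(z;v) \leq M \sqrt{g_z(v,v)}$; (3) for all $z\in\Omega$ and $X,v,w \in \mathbb{C}^d$: $|X(g_z(v,w))| \leq M k_\Omega(z;X)k_\Omega(z;v)k_\Omega(z;w)$; (4) for all $z\in\Omega$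 and $X,Y,v,w \in \mathbb{C}^d$: $|Y(X(g_z(v,w)))| \leq M k_\Omega(z;Y)k_\Omega(z;X)k_\Omega(z;v)k_\Omega(z;w)$; (5) for all $X,Y,v,w \in \mathbb{C}^d$ and $z_1,z_2 \in \Omega$: $$|Y(X(g_{z_1}(v,w))) - Y(X(g_{z_2}(v,w)))| \leq M \max_{z \in \{z_1,z_2\}} \big( k_\Omega(z;Y)k_\Omega(z;X)k_\Omega(z;v)k_\Omega(z;w) \big) K_\Omega(z_1,z_2).$$ *)

theory Defs
  imports "HOL-Complex_Analysis.Complex_Analysis"
begin

text \<open>
  Complex Euclidean space of dimension \<open>CARD('n)\<close> is \<open>complex ^ 'n\<close>: \<open>*s\<close> is complex scalar
  multiplication, \<open>*\<^sub>R\<close> real scalar multiplication, and \<open>lborel\<close> the standard Lebesgue measure.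
\<close>

definition convex_domains_no_line :: "(complex ^ 'n) set set" where
  "convex_domains_no_line =
    {\<Omega>. open \<Omega> \<and> \<Omega> \<noteq> {} \<and> convex \<Omega> \<and>
         \<not> (\<exists>a b. b \<noteq> 0 \<and> {a + \<zeta> *s b | \<zeta>. \<zeta> \<in> UNIV} \<subseteq> \<Omega>)}"


subsection \<open>Derivatives along constant vector fields\<close>

definition dir_deriv ::
  "'a::real_normed_vector \<Rightarrow> ('a \<Rightarrow> 'b::real_normed_vector) \<Rightarrow> 'a \<Rightarrow> 'b" where
  "dir_deriv X f z = vector_derivative (\<lambda>t::real. f (z + t *\<^sub>R X)) (at 0)"

text \<open>Class \<open>C\<^sup>k\<close> on an open set, in the real sense.\<close>

fun Ck_on :: "nat \<Rightarrow> 'a::real_normed_vector set \<Rightarrow> ('a \<Rightarrow> 'b::real_normed_vector) \<Rightarrow> bool" where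
  "Ck_on 0 S f \<longleftrightarrow> continuous_on S f"
| "Ck_on (Suc k) S f \<longleftrightarrow>
     (\<forall>z\<in>S. f differentiable (at z)) \<and> (\<forall>X. Ck_on k S (dir_deriv X f))"

text \<open>The Wirtinger operators \<open>\<partial>/\<partial>z\<^sub>j = (\<partial>/\<partial>x\<^sub>j - \<i> \<partial>/\<partial>y\<^sub>j) / 2\<close> and
  \<open>\<partial>/\<partial>z\<^sub>j\<close>-bar \<open>= (\<partial>/\<partial>x\<^sub>j + \<i> \<partial>/\<partial>y\<^sub>j) / 2\<close>.\<close>

definition wirtinger :: "'n \<Rightarrow> (complex ^ 'n \<Rightarrow> complex) \<Rightarrow> complex ^ 'n \<Rightarrow> complex" where
  "wirtinger j f z = (dir_deriv (axis j 1) f z - \<i> * dir_deriv (axis j \<i>) f z) / 2"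

definition wirtinger_bar :: "'n \<Rightarrow> (complex ^ 'n \<Rightarrow> complex) \<Rightarrow> complex ^ 'n \<Rightarrow> complex" where
  "wirtinger_bar j f z = (dir_deriv (axis j 1) f z + \<i> * dir_deriv (axis j \<i>) f z) / 2"


subsection \<open>The Bergman kernel and the Bergman metric\<close>

definition holomorphic_several :: "(complex ^ 'n \<Rightarrow> complex) \<Rightarrow> (complex ^ 'n) set \<Rightarrow> bool" where
  "holomorphic_several f \<Omega> \<longleftrightarrow>
    (\<forall>z\<in>\<Omega>. \<exists>f'. (f has_derivative f') (at z) \<and> (\<forall>c v. f' (c *s v) = c * f' v))"

text \<open>Elements are extended by zero off \<open>\<Omega>\<close>, so that functions agreeing on \<open>\<Omega>\<close> are equal.\<close>

definition bergman_space :: "(complex ^ 'n) set \<Rightarrow> (complex ^ 'n \<Rightarrow> complex) set" where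
  "bergman_space \<Omega> =
    {f. holomorphic_several f \<Omega> \<and> set_integrable lborel \<Omega> (\<lambda>z. (cmod (f z))\<^sup>2) \<and>
        (\<forall>z. z \<notin> \<Omega> \<longrightarrow> f z = 0)}"

text \<open>For \<open>w \<in> \<Omega>\<close> the function \<open>\<lambda>z. bergman_kernel \<Omega> z w\<close> is the element of the Bergman space
  that represents evaluation at \<open>w\<close>; the description determines it uniquely.\<close>

definition bergman_kernel :: "(complex ^ 'n) set \<Rightarrow> complex ^ 'n \<Rightarrow> complex ^ 'n \<Rightarrow> complex" where
  "bergman_kernel \<Omega> z w =
    (THE h. h \<in> bergman_space \<Omega> \<and>
       (\<forall>f\<in>bergman_space \<Omega>. f w = set_lebesgue_integral lborel \<Omega> (\<lambda>\<zeta>. f \<zeta> * cnj (h \<zeta>)))) z"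

text \<open>The kernel is real and nonnegative on the diagonal, hence the real part below.\<close>

definition bergman_form ::
  "(complex ^ 'n) set \<Rightarrow> complex ^ 'n \<Rightarrow> complex ^ 'n \<Rightarrow> complex ^ 'n \<Rightarrow> complex" where
  "bergman_form \<Omega> z v w =
    (\<Sum>i\<in>UNIV. \<Sum>j\<in>UNIV.
       v $ i *
       wirtinger i (wirtinger_bar j (\<lambda>\<zeta>. of_real (ln (Re (bergman_kernel \<Omega> \<zeta> \<zeta>))))) z *
       cnj (w $ j))"

definition bergman_metric ::
  "(complex ^ 'n) set \<Rightarrow> complex ^ 'n \<Rightarrow> complex ^ 'n \<Rightarrow> complex ^ 'n \<Rightarrow> real" where
  "bergman_metric \<Omega> z v w = Re (bergman_form \<Omega> z v w)"


subsection \<open>The Kobayashi metric and the Kobayashi distance\<close>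

definition analytic_discs :: "(complex ^ 'n) set \<Rightarrow> (complex \<Rightarrow> complex ^ 'n) set" where
  "analytic_discs \<Omega> =
    {f. (\<forall>i. (\<lambda>\<zeta>. f \<zeta> $ i) holomorphic_on ball 0 1) \<and> f ` ball 0 1 \<subseteq> \<Omega>}"

text \<open>The infimum of \<open>\<bar>\<xi>\<bar>\<close> over all discs \<open>f\<close> with \<open>f(0) = z\<close> and \<open>df\<^sub>0(\<xi>) = v\<close>.\<close>

definition kobayashi_metric :: "(complex ^ 'n) set \<Rightarrow> complex ^ 'n \<Rightarrow> complex ^ 'n \<Rightarrow> real" where
  "kobayashi_metric \<Omega> z v =
    Inf {cmod \<xi> | \<xi> f. f \<in> analytic_discs \<Omega> \<and> f 0 = z \<and>
                       \<xi> *s (\<chi> i. deriv (\<lambda>\<zeta>. f \<zeta> $ i) 0) = v}"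

text \<open>Normalised as the distance of the metric \<open>\<bar>d\<zeta>\<bar> / (1 - \<bar>\<zeta>\<bar>\<^sup>2)\<close>, which is the infinitesimal
  Kobayashi metric of the disc.\<close>

definition poincare_dist :: "complex \<Rightarrow> complex \<Rightarrow> real" where
  "poincare_dist a b = artanh (cmod ((a - b) / (1 - cnj b * a)))"

text \<open>\<open>disc_chain \<Omega> p q L\<close>: there is a chain of analytic discs from \<open>p\<close> to \<open>q\<close> of total length \<open>L\<close>.\<close>

inductive disc_chain :: "(complex ^ 'n) set \<Rightarrow> complex ^ 'n \<Rightarrow> complex ^ 'n \<Rightarrow> real \<Rightarrow> bool"
  for \<Omega> where
  empty: "p \<in> \<Omega> \<Longrightarrow> disc_chain \<Omega> p p 0"
| step: "disc_chain \<Omega> p (f a) L \<Longrightarrow> f \<in> analytic_discs \<Omega> \<Longrightarrow> a \<in> ball 0 1 \<Longrightarrow> b \<in> ball 0 1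
    \<Longrightarrow> disc_chain \<Omega> p (f b) (L + poincare_dist a b)"

definition kobayashi_dist :: "(complex ^ 'n) set \<Rightarrow> complex ^ 'n \<Rightarrow> complex ^ 'n \<Rightarrow> real" where
  "kobayashi_dist \<Omega> p q = Inf {L. disc_chain \<Omega> p q L}"


subsection \<open>Kaehler metrics comparable to the Kobayashi metric\<close>

text \<open>A Kaehler metric for the standard complex structure, as a Riemannian metric, of class at
  least \<open>C\<^sup>1\<close>: it is invariant under multiplication by \<open>\<i>\<close> and its fundamental form
  \<open>\<omega>(v,w) = g(\<i>v,w)\<close> is closed. The last clause is \<open>d\<omega>(X,Y,Z) = 0\<close> for constant (hence
  commuting) vector fields.\<close>

definition kahler_metric ::
  "(complex ^ 'n) set \<Rightarrow> (complex ^ 'n \<Rightarrow> complex ^ 'n \<Rightarrow> complex ^ 'n \<Rightarrow> real) \<Rightarrow> bool" where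
  "kahler_metric \<Omega> g \<longleftrightarrow>
    (\<forall>z\<in>\<Omega>. bilinear (g z) \<and>
           (\<forall>v w. g z v w = g z w v) \<and>
           (\<forall>v. v \<noteq> 0 \<longrightarrow> g z v v > 0) \<and>
           (\<forall>v w. g z (\<i> *s v) (\<i> *s w) = g z v w)) \<and>
    (\<forall>v w. Ck_on 1 \<Omega> (\<lambda>z. g z v w)) \<and>
    (\<forall>z\<in>\<Omega>. \<forall>X Y Z. dir_deriv X (\<lambda>z. g z (\<i> *s Y) Z) z
                  + dir_deriv Y (\<lambda>z. g z (\<i> *s Z) X) z
                  + dir_deriv Z (\<lambda>z. g z (\<i> *s X) Y) z = 0)"

definition kobayashi_bounded_metrics ::
  "real \<Rightarrow> (complex ^ 'n) set \<Rightarrow> (complex ^ 'n \<Rightarrow> complex ^ 'n \<Rightarrow> complex ^ 'n \<Rightarrow> real) set" where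
  "kobayashi_bounded_metrics M \<Omega> =
    {g. let k = kobayashi_metric \<Omega> in
      kahler_metric \<Omega> g \<and>
      (\<forall>v w. Ck_on 2 \<Omega> (\<lambda>z. g z v w)) \<and>
      (\<forall>z\<in>\<Omega>. \<forall>v. 1 / M * sqrt (g z v v) \<le> k z v \<and> k z v \<le> M * sqrt (g z v v)) \<and>
      (\<forall>z\<in>\<Omega>. \<forall>X v w. \<bar>dir_deriv X (\<lambda>z. g z v w) z\<bar> \<le> M * k z X * k z v * k z w) \<and>
      (\<forall>z\<in>\<Omega>. \<forall>X Y v w. \<bar>dir_deriv Y (dir_deriv X (\<lambda>z. g z v w)) z\<bar>
                          \<le> M * k z Y * k z X * k z v * k z w) \<and>
      (\<forall>X Y v w. \<forall>z1\<in>\<Omega>. \<forall>z2\<in>\<Omega>.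
         \<bar>dir_deriv Y (dir_deriv X (\<lambda>z. g z v w)) z1 - dir_deriv Y (dir_deriv X (\<lambda>z. g z v w)) z2\<bar>
         \<le> M * max (k z1 Y * k z1 X * k z1 v * k z1 w) (k z2 Y * k z2 X * k z2 v * k z2 w)
             * kobayashi_dist \<Omega> z1 z2)}"

end

theory Submission
  imports Defs
begin

text \<open>
  Around a point \<open>z0\<close> of \<open>\<Omega>\<close> choose \<open>d\<close> supporting functionals of \<open>\<Omega> - z0\<close> with \<open>|det|\<close> maximal (as in
  Auerbach's lemma). In the linear coordinates \<open>w\<close> they define, \<open>\<Omega>\<close> contains the unit ball of the
  \<open>l\<^sup>1\<close> norm and is contained in the product of the half planes \<open>Re w\<^sub>j < 1\<close>. Hence the Kobayashi
  metric at \<open>z0\<close> is comparable, with constants depending on \<open>d\<close> only, to the \<open>l\<^sup>1\<close> norm \<open>N\<close> of the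
  coordinates (discs in the ball; Schwarz lemma in the half planes), and the Kobayashi distance from
  \<open>z0\<close> dominates \<open>N\<close> near \<open>z0\<close>.

  The Bergman kernel is bounded above by the mean value inequality on the \<open>l\<^sup>1\<close> ball and below by an
  explicit square integrable function on the product of half planes; the Jacobian of the coordinate
  change cancels in the quotient. So \<open>K(z,w) / K(z0,z0)\<close> is bounded, and close to \<open>1\<close>, on a
  neighbourhood of uniform size, and \<open>log K(z,z)\<close> is the restriction to the antidiagonal of a
  holomorphic function \<open>\<Phi>\<close> of \<open>2d\<close> variables which is bounded up to an additive constant. All upper
  estimates are Cauchy estimates for \<open>\<Phi>\<close> in the norm \<open>N\<close>; the lower bound for the metric comes from
  Bessel's inequality applied to a second explicit function, one that vanishes at \<open>z0\<close>.
\<close>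

subsection \<open>Holomorphic functions of several variables\<close>

text \<open>The obstacle is uniformity: the domains may be unbounded and have arbitrary convex
  boundary, yet one constant must serve them all. No compactness of the family of pointed convex
  domains is invoked. Every constant is an explicit function of the index type, and the pointwise
  estimates are made at the base point of a frame, each point of the domain receiving a frame of its
  own. Five derivatives of \<open>\<Phi>\<close> occur: two form the metric, two more its
  second-order bounds, and the fifth the Lipschitz bound. A bound on the size of the real function
  log K(z,z) says nothing about its derivatives; passing to \<open>2d\<close> complex variables
  repairs this, at the price of a fixed fraction of the radius per derivative. The radius itself is
  limited by the logarithm, since the kernel has to stay away from zero. The kernel is a definite
  description, so its existence and reproducing property come before any estimate; they are derived
  from an extremal problem.\<close>

lemma norm_vector_smult: "norm (c *s (x::complex^'n)) = cmod c * norm x"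
  by (simp add: norm_vec_def L2_set_def norm_mult power_mult_distrib real_sqrt_mult
      flip: sum_distrib_left)

lemma scaleR_eq_smult: "t *\<^sub>R (x::complex^'n) = of_real t *s x"
  by (simp add: vec_eq_iff scaleR_conv_of_real[where 'a=complex])

lemma bounded_linear_smult_left: "bounded_linear (\<lambda>c. c *s (x::complex^'n))"
  by (rule bounded_linear_intro[of _ "norm x"])
     (auto simp: vector_sadd_rdistrib scaleR_eq_smult vector_smult_assoc norm_vector_smult
       scaleR_conv_of_real[where 'a=complex])

lemma bounded_linear_smult_right: "bounded_linear (\<lambda>x. c *s (x::complex^'n))"
  by (rule bounded_linear_intro[of _ "cmod c"])
     (auto simp: vector_add_ldistrib scaleR_eq_smult vector_smult_assoc norm_vector_smult mult.commute)

lemma dir_deriv_eqI: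
  assumes "(f has_derivative f') (at z)"
  shows "dir_deriv X f z = f' X"
proof -
  interpret f': bounded_linear f' using assms by (rule has_derivative_bounded_linear)
  have "((\<lambda>t::real. f (z + t *\<^sub>R X)) has_derivative (\<lambda>t. f' (t *\<^sub>R X))) (at 0)"
    by (rule has_derivative_compose[of "\<lambda>t::real. z + t *\<^sub>R X" "\<lambda>t. t *\<^sub>R X" 0 UNIV f f'])
       (auto intro!: derivative_eq_intros assms)
  then have "((\<lambda>t::real. f (z + t *\<^sub>R X)) has_vector_derivative f' X) (at 0)"
    by (simp add: has_vector_derivative_def f'.scaleR)
  then show ?thesis by (simp add: dir_deriv_def vector_derivative_at)
qed

text \<open>Replaces the existential derivative in \<open>holomorphic_several\<close> by
  \<open>dir_deriv\<close> itself, so that later statements about derivatives all concern one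
  function that is complex linear in its direction.\<close>

lemma holomorphic_several_derivative:
  assumes "holomorphic_several f U" "z \<in> U"
  shows "(f has_derivative (\<lambda>X. dir_deriv X f z)) (at z)"
    and "dir_deriv (c *s X) f z = c * dir_deriv X f z"
proof -
  obtain f' where f': "(f has_derivative f') (at z)" "\<And>c v. f' (c *s v) = c * f' v"
    using assms by (auto simp: holomorphic_several_def)
  have "f' = (\<lambda>X. dir_deriv X f z)"
    using dir_deriv_eqI[OF f'(1)] by auto
  with f' show "(f has_derivative (\<lambda>X. dir_deriv X f z)) (at z)"
    and "dir_deriv (c *s X) f z = c * dir_deriv X f z" by auto
qed

lemma dir_deriv_linear:
  assumes "holomorphic_several f U" "z \<in> U"
  shows "dir_deriv (X + Y) f z = dir_deriv X f z + dir_deriv Y f z"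
    and "dir_deriv (X - Y) f z = dir_deriv X f z - dir_deriv Y f z"
    and "dir_deriv 0 f z = 0"
    and "dir_deriv (sum g I) f z = (\<Sum>i\<in>I. dir_deriv (g i) f z)"
proof -
  interpret bounded_linear "\<lambda>X. dir_deriv X f z"
    by (rule has_derivative_bounded_linear[OF holomorphic_several_derivative(1)[OF assms]])
  show "dir_deriv (X + Y) f z = dir_deriv X f z + dir_deriv Y f z"
    "dir_deriv (X - Y) f z = dir_deriv X f z - dir_deriv Y f z" "dir_deriv 0 f z = 0"
    "dir_deriv (sum g I) f z = (\<Sum>i\<in>I. dir_deriv (g i) f z)"
    by (rule add diff zero sum)+
qed

lemma holomorphic_several_intro:
  assumes "\<And>z. z \<in> U \<Longrightarrow> (f has_derivative D z) (at z)"
    and "\<And>z c v. z \<in> U \<Longrightarrow> D z (c *s v) = c * D z v"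
  shows "holomorphic_several f U"
  using assms unfolding holomorphic_several_def by blast

lemma holomorphic_several_subset:
  "holomorphic_several f U \<Longrightarrow> V \<subseteq> U \<Longrightarrow> holomorphic_several f V"
  by (auto simp: holomorphic_several_def)

lemma holomorphic_several_cong:
  assumes "holomorphic_several f U" "open U" "\<And>z. z \<in> U \<Longrightarrow> f z = g z"
  shows "holomorphic_several g U"
  unfolding holomorphic_several_def
proof
  fix z assume z: "z \<in> U"
  then obtain f' where "(f has_derivative f') (at z)" "\<forall>c v. f' (c *s v) = c * f' v"
    using assms(1) by (auto simp: holomorphic_several_def)
  then show "\<exists>f'. (g has_derivative f') (at z) \<and> (\<forall>c v. f' (c *s v) = c * f' v)"
    using has_derivative_transform_within_open[of f _ z UNIV U g] assms(2,3) z by blast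
qed

lemma dir_deriv_cong:
  assumes "open U" "z \<in> U" "\<And>z. z \<in> U \<Longrightarrow> f z = g z"
  shows "dir_deriv X f z = dir_deriv X g z"
proof -
  have "((\<lambda>t::real. z + t *\<^sub>R X) \<longlongrightarrow> z + 0 *\<^sub>R X) (at 0)"
    by (intro tendsto_intros)
  then have "((\<lambda>t::real. z + t *\<^sub>R X) \<longlongrightarrow> z) (at 0)" by simp
  then have "\<forall>\<^sub>F t in at 0. z + t *\<^sub>R X \<in> U"
    using assms(1,2) by (rule topological_tendstoD)
  then have "\<forall>\<^sub>F t in nhds 0. f (z + t *\<^sub>R X) = g (z + t *\<^sub>R X)"
    using assms by (auto simp: eventually_at_filter elim: eventually_mono)
  then show ?thesis unfolding dir_deriv_def
    by (intro vector_derivative_cong_eq) (auto simp: assms(2,3))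
qed

lemma holomorphic_several_continuous:
  assumes "holomorphic_several f U"
  shows "continuous_on U f"
  using assms
  by (meson continuous_at_imp_continuous_on has_derivative_continuous holomorphic_several_derivative(1))

lemma holomorphic_several_const: "holomorphic_several (\<lambda>_. c) U"
  by (rule holomorphic_several_intro[where D="\<lambda>_ _. 0"]) auto

lemma holomorphic_several_add:
  assumes "holomorphic_several f U" "holomorphic_several g U"
  shows "holomorphic_several (\<lambda>z. f z + g z) U"
  by (rule holomorphic_several_intro[where D="\<lambda>z X. dir_deriv X f z + dir_deriv X g z"])
     (auto intro!: has_derivative_add holomorphic_several_derivative[OF assms(1)]
       holomorphic_several_derivative[OF assms(2)]
       simp: holomorphic_several_derivative(2)[OF assms(1)] holomorphic_several_derivative(2)[OF assms(2)]
        algebra_simps)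

lemma holomorphic_several_mult:
  assumes "holomorphic_several f U" "holomorphic_several g U"
  shows "holomorphic_several (\<lambda>z. f z * g z) U"
proof (rule holomorphic_several_intro[where D="\<lambda>z X. f z * dir_deriv X g z + dir_deriv X f z * g z"])
  show "\<And>z. z \<in> U \<Longrightarrow> ((\<lambda>z. f z * g z) has_derivative
      (\<lambda>X. f z * dir_deriv X g z + dir_deriv X f z * g z)) (at z)"
    by (intro has_derivative_mult holomorphic_several_derivative(1)[OF assms(1)]
       holomorphic_several_derivative(1)[OF assms(2)])
qed (auto simp: holomorphic_several_derivative(2)[OF assms(1)]
       holomorphic_several_derivative(2)[OF assms(2)] algebra_simps)

lemma holomorphic_several_cmult:
  "holomorphic_several f U \<Longrightarrow> holomorphic_several (\<lambda>z. c * f z) U"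
  using holomorphic_several_mult[OF holomorphic_several_const] .

lemma holomorphic_several_diff:
  assumes "holomorphic_several f U" "holomorphic_several g U"
  shows "holomorphic_several (\<lambda>z. f z - g z) U"
  using holomorphic_several_add[OF assms(1) holomorphic_several_cmult[OF assms(2), of "-1"]] by simp

lemma holomorphic_several_chain:
  assumes "holomorphic_several f U" "\<And>z. z \<in> U \<Longrightarrow> (h has_field_derivative h' z) (at (f z))"
  shows "holomorphic_several (\<lambda>z. h (f z)) U"
proof (rule holomorphic_several_intro[where D="\<lambda>z X. h' z * dir_deriv X f z"])
  fix z assume z: "z \<in> U"
  show "((\<lambda>z. h (f z)) has_derivative (\<lambda>X. h' z * dir_deriv X f z)) (at z)"
    using has_derivative_compose[OF holomorphic_several_derivative(1)[OF assms(1) z], of h "(*) (h' z)"]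
      assms(2)[OF z] by (simp add: has_field_derivative_def)
qed (simp add: holomorphic_several_derivative(2)[OF assms(1)])

lemma holomorphic_several_compose_affine:
  fixes L :: "complex^'m \<Rightarrow> complex^'n"
  assumes "holomorphic_several f U" "bounded_linear L" "\<And>c v. L (c *s v) = c *s L v"
    and "\<And>z. z \<in> V \<Longrightarrow> L z + b \<in> U"
  shows "holomorphic_several (\<lambda>z. f (L z + b)) V"
proof (rule holomorphic_several_intro[where D="\<lambda>z X. dir_deriv (L X) f (L z + b)"])
  fix z assume z: "z \<in> V"
  have "((\<lambda>z. L z + b) has_derivative L) (at z)"
    using bounded_linear_imp_has_derivative[OF assms(2)] by (auto intro!: derivative_eq_intros)
  from has_derivative_compose[OF this holomorphic_several_derivative(1)[OF assms(1) assms(4)[OF z]]]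
  show "((\<lambda>z. f (L z + b)) has_derivative (\<lambda>X. dir_deriv (L X) f (L z + b))) (at z)" .
  show "\<And>c v. dir_deriv (L (c *s v)) f (L z + b) = c * dir_deriv (L v) f (L z + b)"
    using holomorphic_several_derivative(2)[OF assms(1) assms(4)[OF z]] by (simp add: assms(3))
qed

lemma holomorphic_several_line:
  assumes "holomorphic_several f U" "z + \<zeta> *s X \<in> U"
  shows "((\<lambda>\<zeta>. f (z + \<zeta> *s X)) has_field_derivative dir_deriv X f (z + \<zeta> *s X)) (at \<zeta>)"
proof -
  have "((\<lambda>\<zeta>. z + \<zeta> *s X) has_derivative (\<lambda>h. h *s X)) (at \<zeta>)"
    using bounded_linear_imp_has_derivative[OF bounded_linear_smult_left[of X]]
    by (auto intro!: derivative_eq_intros)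
  from has_derivative_compose[OF this holomorphic_several_derivative(1)[OF assms]]
  show ?thesis
    by (simp add: has_field_derivative_def holomorphic_several_derivative(2)[OF assms] mult_commute_abs)
qed

section \<open>Cauchy estimates and Taylor remainders along complex lines\<close>

text \<open>By complex linearity the real directional derivative is the complex derivative at 0 of
  the slice through \<open>z\<close> in direction \<open>X\<close>, to which Cauchy's inequality in
  one variable applies.\<close>

lemma dir_deriv_cauchy:
  assumes "holomorphic_several f U" "0 < r"
    and "\<And>\<zeta>. cmod \<zeta> \<le> r \<Longrightarrow> z + \<zeta> *s X \<in> U"
    and "\<And>\<zeta>. cmod \<zeta> \<le> r \<Longrightarrow> cmod (f (z + \<zeta> *s X)) \<le> M"
  shows "cmod (dir_deriv X f z) \<le> M / r"
proof -
  let ?\<phi> = "\<lambda>\<zeta>. f (z + \<zeta> *s X)"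
  have d: "(?\<phi> has_field_derivative dir_deriv X f (z + \<zeta> *s X)) (at \<zeta>)" if "cmod \<zeta> \<le> r" for \<zeta>
    using holomorphic_several_line[OF assms(1) assms(3)[OF that]] .
  have "norm ((deriv ^^ 1) ?\<phi> 0) \<le> fact 1 * M / r ^ 1"
  proof (rule Cauchy_inequality)
    show "?\<phi> holomorphic_on ball 0 r"
      by (auto simp: holomorphic_on_open intro!: exI d)
    show "continuous_on (cball 0 r) ?\<phi>"
      by (intro continuous_at_imp_continuous_on) (auto intro: DERIV_isCont[OF d])
  qed (use assms in auto)
  moreover have "deriv ?\<phi> 0 = dir_deriv X f z"
    using d[of 0] assms(2) by (auto dest: DERIV_imp_deriv)
  ultimately show ?thesis by simp
qed

text \<open>The slice in direction \<open>h\<close> is holomorphic on a disc of radius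
  \<open>R = r / norm h\<close>, at least 4. Discs of radius \<open>R/2\<close> about points of the
  unit disc therefore fit inside, and Cauchy's inequality bounds the second derivative there by
  \<open>2 * M / (R/2)^2\<close>; this is the origin of the 8.\<close>

lemma holomorphic_several_taylor:
  assumes f: "holomorphic_several f U" and "0 < r"
    and U: "\<And>y. norm (y - z) < r \<Longrightarrow> y \<in> U"
    and M: "\<And>y. norm (y - z) < r \<Longrightarrow> cmod (f y) \<le> M"
    and h: "norm h \<le> r / 4"
  shows "cmod (f (z + h) - f z - dir_deriv h f z) \<le> 8 * M / r^2 * (norm h)^2"
proof (cases "h = 0")
  case True
  then show ?thesis using U[of z] \<open>0 < r\<close> by (simp add: dir_deriv_linear(3)[OF f])
next
  case False
  let ?\<phi> = "\<lambda>\<zeta>. f (z + \<zeta> *s h)"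
  define R where "R = r / norm h"
  have R: "4 \<le> R" using h False \<open>0 < r\<close> by (simp add: R_def field_simps)
  have in_r: "norm (z + \<zeta> *s h - z) < r" if "cmod \<zeta> < R" for \<zeta>
    using that False by (simp add: norm_vector_smult R_def field_simps)
  have d: "(?\<phi> has_field_derivative dir_deriv h f (z + \<zeta> *s h)) (at \<zeta>)" if "cmod \<zeta> < R" for \<zeta>
    using holomorphic_several_line[OF f U[OF in_r[OF that]]] .
  have hol: "?\<phi> holomorphic_on ball 0 R"
    by (auto simp: holomorphic_on_open intro!: exI d)
  have dhol: "deriv ?\<phi> holomorphic_on ball 0 R"
    using hol by (auto intro: holomorphic_deriv)
  have B: "norm ((deriv ^^ 2) ?\<phi> x) \<le> 8 * M / R^2" if "cmod x \<le> 1" for x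
  proof -
    have sub: "cball x (R/2) \<subseteq> ball 0 R"
    proof
      fix y assume "y \<in> cball x (R/2)"
      then have "cmod y \<le> R/2 + 1" using that norm_triangle_sub[of y x] by (simp add: dist_norm norm_minus_commute)
      also have "\<dots> < R" using R by simp
      finally show "y \<in> ball 0 R" by simp
    qed
    have "norm ((deriv ^^ 2) ?\<phi> x) \<le> fact 2 * M / (R/2)^2"
    proof (rule Cauchy_inequality)
      show "?\<phi> holomorphic_on ball x (R/2)"
        using sub ball_subset_cball by (blast intro: holomorphic_on_subset[OF hol])
      show "continuous_on (cball x (R/2)) ?\<phi>"
        using sub by (blast intro: holomorphic_on_imp_continuous_on holomorphic_on_subset[OF hol])
      show "norm (?\<phi> y) \<le> M" if "norm (x - y) = R/2" for y
      proof -
        have "y \<in> cball x (R/2)" using that by (simp add: dist_norm)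
        then have "cmod y < R" using sub by auto
        then show ?thesis using M in_r by blast
      qed
    qed (use R in auto)
    also have "\<dots> = 8 * M / R^2" by (simp add: power_divide)
    finally show ?thesis .
  qed
  have "cmod ((deriv ^^ 0) ?\<phi> 1 - (\<Sum>i\<le>1. (deriv ^^ i) ?\<phi> 0 * (1 - 0) ^ i / (fact i)))
      \<le> 8 * M / R^2 * cmod (1 - 0)^(Suc 1) / fact 1"
  proof (rule complex_Taylor[of "cball 0 1"])
    fix i :: nat and x :: complex assume x: "x \<in> cball 0 1" and i: "i \<le> 1"
    have xR: "x \<in> ball 0 R" using x R by auto
    have "((deriv ^^ i) ?\<phi> has_field_derivative (deriv ^^ Suc i) ?\<phi> x) (at x)"
    proof (cases "i = 0")
      case True
      then show ?thesis using holomorphic_derivI[OF hol _ xR] by simp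
    next
      case False
      then have "i = 1" using i by simp
      then show ?thesis using holomorphic_derivI[OF dhol _ xR] by simp
    qed
    then show "((deriv ^^ i) ?\<phi> has_field_derivative (deriv ^^ Suc i) ?\<phi> x) (at x within cball 0 1)"
      by (rule has_field_derivative_at_within)
  next
    show "\<And>x. x \<in> cball 0 1 \<Longrightarrow> cmod ((deriv ^^ Suc 1) (\<lambda>\<zeta>. f (z + \<zeta> *s h)) x) \<le> 8 * M / R\<^sup>2"
      using B by (simp add: numeral_2_eq_2)
  qed auto
  moreover have "deriv ?\<phi> 0 = dir_deriv h f z"
    using d[of 0] R by (auto dest: DERIV_imp_deriv)
  moreover have "8 * M / R^2 = 8 * M / r^2 * (norm h)^2"
    by (simp add: R_def power_divide)
  ultimately show ?thesis by (simp add: diff_diff_eq)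
qed

text \<open>Differentiability is obtained below from quadratic remainder bounds, because such bounds
  survive pointwise limits and can be added over blocks of variables.\<close>

lemma has_derivative_quadratic:
  fixes g :: "'a::euclidean_space \<Rightarrow> 'b::real_normed_vector"
  assumes "linear D" "0 < d" and C: "\<And>h. norm h < d \<Longrightarrow> norm (g (z + h) - g z - D h) \<le> C * (norm h)^2"
  shows "(g has_derivative D) (at z)"
proof -
  have "((\<lambda>h. norm (g (z + h) - g z - D h) / norm h) \<longlongrightarrow> 0) (at 0)"
  proof (rule Lim_null_comparison)
    have "\<forall>\<^sub>F h in at 0. norm h < d \<and> h \<noteq> (0::'a)"
      using \<open>0 < d\<close> by (auto simp: eventually_at dist_norm)
    then show "\<forall>\<^sub>F h in at 0. norm (norm (g (z + h) - g z - D h) / norm h) \<le> C * norm h"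
    proof eventually_elim
      case (elim h)
      then show ?case using C[of h] by (simp add: divide_le_eq power2_eq_square mult.assoc)
    qed
    have "((\<lambda>h::'a. C * norm h) \<longlongrightarrow> C * norm (0::'a)) (at 0)"
      by (intro tendsto_intros)
    then show "((\<lambda>h::'a. C * norm h) \<longlongrightarrow> 0) (at 0)" by simp
  qed
  then show ?thesis
    using assms(1) by (simp add: has_derivative_at linear_conv_bounded_linear)
qed

section \<open>Locally uniform limits and iterated derivatives\<close>

lemma dir_deriv_diff:
  assumes "holomorphic_several f U" "holomorphic_several g U" "z \<in> U"
  shows "dir_deriv X (\<lambda>z. f z - g z) z = dir_deriv X f z - dir_deriv X g z"
  by (rule dir_deriv_eqI[of _ "\<lambda>X. dir_deriv X f z - dir_deriv X g z"])
     (intro has_derivative_diff holomorphic_several_derivative(1)[OF assms(1,3)]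
       holomorphic_several_derivative(1)[OF assms(2,3)])

lemma complex_line_in_ball:
  assumes "0 < r"
  obtains \<rho> where "0 < \<rho>" "\<And>\<zeta>. cmod \<zeta> \<le> \<rho> \<Longrightarrow> z + \<zeta> *s X \<in> ball z r"
proof -
  define a where "a = norm X + 1"
  have a: "0 < a" "norm X \<le> a" using norm_ge_zero[of X] by (simp_all add: a_def add_nonneg_pos)
  have "z + \<zeta> *s X \<in> ball z r" if "cmod \<zeta> \<le> r / (2 * a)" for \<zeta>
  proof -
    have "cmod \<zeta> * norm X \<le> r / (2 * a) * a" using that a assms by (intro mult_mono) auto
    also have "\<dots> = r / 2" using a by simp
    finally show ?thesis using assms by (simp add: dist_norm norm_vector_smult)
  qed
  then show ?thesis using that[of "r / (2 * a)"] a assms by simp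
qed

text \<open>The Cauchy estimate for \<open>f k - g\<close> on a disc of radius \<open>\<rho>\<close>
  inside the ball turns uniform closeness into closeness of derivatives.\<close>

lemma dir_deriv_tendsto_cauchy:
  assumes f: "\<And>k. holomorphic_several (f k) U" and g: "holomorphic_several g U"
    and r: "0 < r" "ball z r \<subseteq> U" and u: "uniform_limit (ball z r) f g sequentially"
  shows "(\<lambda>k. dir_deriv X (f k) z) \<longlonglongrightarrow> dir_deriv X g z"
proof (rule tendstoI)
  fix e :: real assume "0 < e"
  obtain \<rho> where \<rho>: "0 < \<rho>" and inb: "\<And>\<zeta>. cmod \<zeta> \<le> \<rho> \<Longrightarrow> z + \<zeta> *s X \<in> ball z r"
    using complex_line_in_ball[OF r(1)] by blast
  have "z \<in> U" using r by auto
  from u have "\<forall>\<^sub>F k in sequentially. \<forall>x\<in>ball z r. dist (f k x) (g x) < e * \<rho> / 2"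
    by (rule uniform_limitD) (use \<rho> \<open>0 < e\<close> in auto)
  then show "\<forall>\<^sub>F k in sequentially. dist (dir_deriv X (f k) z) (dir_deriv X g z) < e"
  proof eventually_elim
    case (elim k)
    have "cmod (dir_deriv X (\<lambda>z. f k z - g z) z) \<le> (e * \<rho> / 2) / \<rho>"
      using inb elim r by (intro dir_deriv_cauchy[OF holomorphic_several_diff[OF f g] \<rho>])
        (auto simp: dist_norm intro!: less_imp_le)
    also have "\<dots> < e" using \<rho> \<open>0 < e\<close> by simp
    finally show ?case using dir_deriv_diff[OF f g \<open>z \<in> U\<close>] by (simp add: dist_norm)
  qed
qed

text \<open>Weierstrass' theorem. As nothing is known about \<open>g\<close> yet, the derivatives of
  \<open>f k\<close> are compared with each other: they form Cauchy sequences, their limit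
  \<open>D\<close> inherits complex linearity, and a Taylor remainder bound uniform in
  \<open>k\<close> passes to the limit and identifies \<open>D\<close> as the derivative of
  \<open>g\<close>.\<close>

lemma holomorphic_several_limit_at:
  assumes f: "\<And>k. holomorphic_several (f k) U"
    and r: "0 < r" "ball z r \<subseteq> U" and u: "uniform_limit (ball z r) f g sequentially"
  shows "\<exists>g'. (g has_derivative g') (at z) \<and> (\<forall>c v. g' (c *s v) = c * g' v)"
proof -
  have "z \<in> U" using r by auto
  have "Cauchy (\<lambda>k. dir_deriv X (f k) z)" for X
  proof (rule metric_CauchyI)
    fix e :: real assume "0 < e"
    obtain \<rho> where \<rho>: "0 < \<rho>" and inb: "\<And>\<zeta>. cmod \<zeta> \<le> \<rho> \<Longrightarrow> z + \<zeta> *s X \<in> ball z r"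
      using complex_line_in_ball[OF r(1)] by blast
    from u have "\<forall>\<^sub>F k in sequentially. \<forall>x\<in>ball z r. dist (f k x) (g x) < e * \<rho> / 4"
      by (rule uniform_limitD) (use \<rho> \<open>0 < e\<close> in auto)
    then obtain K where K: "\<And>k x. k \<ge> K \<Longrightarrow> x \<in> ball z r \<Longrightarrow> dist (f k x) (g x) < e * \<rho> / 4"
      unfolding eventually_sequentially by blast
    have "dist (dir_deriv X (f k) z) (dir_deriv X (f l) z) < e" if "k \<ge> K" "l \<ge> K" for k l
    proof -
      have bd: "cmod (f k x - f l x) \<le> e * \<rho> / 2" if "x \<in> ball z r" for x
        using K[OF \<open>k \<ge> K\<close> that] K[OF \<open>l \<ge> K\<close> that] dist_triangle2[of "f k x" "f l x" "g x"]
        by (simp add: dist_norm)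
      have "cmod (dir_deriv X (\<lambda>z. f k z - f l z) z) \<le> (e * \<rho> / 2) / \<rho>"
        using inb bd r by (intro dir_deriv_cauchy[OF holomorphic_several_diff[OF f f] \<rho>]) auto
      also have "\<dots> < e" using \<rho> \<open>0 < e\<close> by simp
      finally show ?thesis using dir_deriv_diff[OF f f \<open>z \<in> U\<close>] by (simp add: dist_norm)
    qed
    then show "\<exists>M. \<forall>m\<ge>M. \<forall>n\<ge>M. dist (dir_deriv X (f m) z) (dir_deriv X (f n) z) < e" by blast
  qed
  then have "\<forall>X. \<exists>l. (\<lambda>k. dir_deriv X (f k) z) \<longlonglongrightarrow> l"
    using Cauchy_convergent convergent_def by blast
  then obtain D where D: "\<And>X. (\<lambda>k. dir_deriv X (f k) z) \<longlonglongrightarrow> D X" by metis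
  have hom: "D (c *s X) = c * D X" for c X
    using D[of "c *s X"] tendsto_mult_left[OF D[of X], of c]
    by (simp add: holomorphic_several_derivative(2)[OF f \<open>z \<in> U\<close>] LIMSEQ_unique)
  have add: "D (X + Y) = D X + D Y" for X Y
    using D[of "X + Y"] tendsto_add[OF D[of X] D[of Y]]
    by (simp add: dir_deriv_linear(1)[OF f \<open>z \<in> U\<close>] LIMSEQ_unique)
  have lin: "linear D"
    by (rule linearI) (auto simp: add scaleR_eq_smult hom scaleR_conv_of_real)
  from u have "\<forall>\<^sub>F k in sequentially. \<forall>x\<in>ball z r. dist (f k x) (g x) < 1"
    by (rule uniform_limitD) auto
  then obtain K where K: "\<And>k x. k \<ge> K \<Longrightarrow> x \<in> ball z r \<Longrightarrow> dist (f k x) (g x) < 1"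
    unfolding eventually_sequentially by blast
  have cU: "cball z (r/2) \<subseteq> U" using r by auto
  have "compact (f K ` cball z (r/2))"
    by (intro compact_continuous_image continuous_on_subset[OF holomorphic_several_continuous[OF f] cU]
      compact_cball)
  then have "\<exists>B. \<forall>x\<in>cball z (r/2). cmod (f K x) \<le> B"
    by (auto dest!: compact_imp_bounded simp: bounded_iff simp del: mem_cball)
  then obtain B where B: "\<And>x. x \<in> cball z (r/2) \<Longrightarrow> cmod (f K x) \<le> B" by metis
  \<comment> \<open>Both \<open>f k\<close> and \<open>f K\<close> lie within 1 of \<open>g\<close>
    on the ball, so the bound for the single function \<open>f K\<close> on a compact ball yields
    one independent of \<open>k\<close>.\<close>
  have bd: "cmod (f k y) \<le> B + 2" if "k \<ge> K" "norm (y - z) < r/2" for k y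
  proof -
    have y: "y \<in> cball z (r/2)" "y \<in> ball z r" using that r by (auto simp: dist_norm norm_minus_commute)
    have "cmod (f k y - f K y) < 2"
      using K[OF that(1) y(2)] K[OF order_refl y(2)] dist_triangle2[of "f k y" "f K y" "g y"]
      by (simp add: dist_norm)
    then show ?thesis using B[OF y(1)] norm_triangle_sub[of "f k y" "f K y"] by linarith
  qed
  have lim: "(\<lambda>k. f k y) \<longlonglongrightarrow> g y" if "norm (y - z) < r" for y
    by (rule tendsto_uniform_limitI[OF u]) (use that in \<open>simp add: dist_norm norm_minus_commute\<close>)
  have "(g has_derivative D) (at z)"
  proof (rule has_derivative_quadratic[OF lin])
    show "0 < r/8" using r by simp
    fix h :: "complex^'a" assume h: "norm h < r/8"
    have "(\<lambda>k. cmod (f k (z + h) - f k z - dir_deriv h (f k) z)) \<longlonglongrightarrow> cmod (g (z + h) - g z - D h)"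
      using h r(1) by (intro tendsto_intros lim D; simp) (smt (verit) norm_ge_zero)?
    moreover have "\<forall>\<^sub>F k in sequentially. cmod (f k (z + h) - f k z - dir_deriv h (f k) z)
          \<le> 8 * (B + 2) / (r/2)^2 * (norm h)^2"
      using eventually_ge_at_top[of K]
    proof eventually_elim
      case (elim k)
      show ?case
        using h r bd[OF elim] by (intro holomorphic_several_taylor[OF f])
         (auto simp: dist_norm norm_minus_commute subset_iff)
    qed
    ultimately show "cmod (g (z + h) - g z - D h) \<le> 8 * (B + 2) / (r/2)^2 * (norm h)^2"
      by (rule tendsto_upperbound) simp
  qed
  then show ?thesis using hom by blast
qed

lemma holomorphic_several_limit:
  assumes f: "\<And>k. holomorphic_several (f k) U"
    and u: "\<And>z. z \<in> V \<Longrightarrow> \<exists>r>0. ball z r \<subseteq> U \<and> uniform_limit (ball z r) f g sequentially"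
  shows "holomorphic_several g V"
  unfolding holomorphic_several_def
  using holomorphic_several_limit_at[where f=f and g=g, OF f] u by meson

lemma holomorphic_several_locally_bounded:
  assumes "holomorphic_several f U" "open U" "z \<in> U"
  obtains r M where "0 < r" "ball z r \<subseteq> U" "\<And>y. y \<in> ball z r \<Longrightarrow> cmod (f y) \<le> M"
proof -
  obtain r where r: "0 < r" "cball z r \<subseteq> U" using assms open_contains_cball by blast
  have "compact (f ` cball z r)"
    using r by (intro compact_continuous_image continuous_on_subset[OF holomorphic_several_continuous[OF assms(1)]]) auto
  then have "\<exists>B. \<forall>x\<in>cball z r. cmod (f x) \<le> B"
    by (auto dest!: compact_imp_bounded simp: bounded_iff simp del: mem_cball)
  then obtain B where B: "\<And>x. x \<in> cball z r \<Longrightarrow> cmod (f x) \<le> B" by metis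
  show ?thesis by (rule that[of r B]) (use r B in auto)
qed

text \<open>Exhibits \<open>dir_deriv X f\<close> near \<open>z\<close> as a uniform limit of
  holomorphic functions. The Taylor remainder divided by \<open>t k\<close> is of order
  \<open>t k\<close>, uniformly on the smaller ball.\<close>

lemma difference_quotient_limit:
  assumes f: "holomorphic_several f U" and U: "open U" and z: "z \<in> U"
  obtains r t where "0 < r" "ball z r \<subseteq> U" "\<And>k. 0 < (t k :: real)" "t \<longlonglongrightarrow> 0"
    "\<And>k. holomorphic_several (\<lambda>y. (f (y + t k *\<^sub>R X) - f y) / of_real (t k)) (ball z r)"
    "uniform_limit (ball z r) (\<lambda>k y. (f (y + t k *\<^sub>R X) - f y) / of_real (t k)) (dir_deriv X f) sequentially"
    "\<And>k. z + t k *\<^sub>R X \<in> U"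
proof -
  obtain r M where r: "0 < r" "ball z r \<subseteq> U" and M: "\<And>y. y \<in> ball z r \<Longrightarrow> cmod (f y) \<le> M"
    using holomorphic_several_locally_bounded[OF f U z] by blast
  define a where "a = norm X + 1"
  have a: "0 < a" "norm X \<le> a" using norm_ge_zero[of X] by (simp_all add: a_def add_nonneg_pos)
  \<comment> \<open>Keeps every shift \<open>t k *\<^sub>R X\<close> below \<open>r/8\<close>, a
    quarter of the radius \<open>r/2\<close> with which the Taylor estimate is applied.\<close>
  define c where "c = r / (8 * a)"
  have c: "0 < c" using r a by (simp add: c_def)
  define t where "t k = c / real (Suc k)" for k
  have t: "0 < t k" "t k \<le> c" for k
    using c by (auto simp: t_def divide_le_eq mult_le_cancel_left1)
  have cX: "c * norm X \<le> r/8"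
  proof -
    have "c * norm X \<le> c * a" using c a by simp
    also have "\<dots> = r/8" using a by (simp add: c_def)
    finally show ?thesis .
  qed
  have tX: "norm (t k *\<^sub>R X) \<le> r/8" for k
  proof -
    have "t k * norm X \<le> c * norm X" using t by (intro mult_right_mono) auto
    then show ?thesis using cX t[of k] by simp
  qed
  have t0: "t \<longlonglongrightarrow> 0" unfolding t_def
    using LIMSEQ_inverse_real_of_nat[THEN tendsto_mult_left[of _ _ _ c]] by (simp add: divide_inverse)
  have sub: "ball z (r/2) \<subseteq> U" using r by auto
  have shift: "y + t k *\<^sub>R X \<in> ball z r" if "y \<in> ball z (r/2)" for y k
  proof -
    have "norm (y + t k *\<^sub>R X - z) \<le> norm (y - z) + norm (t k *\<^sub>R X)"
      using norm_triangle_ineq[of "y - z" "t k *\<^sub>R X"] by (simp add: algebra_simps)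
    then show ?thesis using that tX[of k] r by (simp add: dist_norm norm_minus_commute)
  qed
  have hol: "holomorphic_several (\<lambda>y. (f (y + t k *\<^sub>R X) - f y) / of_real (t k)) (ball z (r/2))" for k
  proof -
    have "holomorphic_several (\<lambda>y. f (id y + t k *\<^sub>R X)) (ball z (r/2))"
      by (rule holomorphic_several_compose_affine[OF f]) (use shift r in \<open>auto simp: id_def bounded_linear_ident\<close>)
    then show ?thesis
      using holomorphic_several_cmult[OF holomorphic_several_diff[OF _ holomorphic_several_subset[OF f sub]],
          of "\<lambda>y. f (y + t k *\<^sub>R X)" "1 / of_real (t k)"] by simp
  qed
  have est: "cmod ((f (y + t k *\<^sub>R X) - f y) / of_real (t k) - dir_deriv X f y)
      \<le> t k * (8 * M / (r/2)^2 * (norm X)^2)" if y: "y \<in> ball z (r/2)" for y k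
  proof -
    have inb: "v \<in> ball z r" if "norm (v - y) < r/2" for v
      using y that dist_triangle[of z v y] by (simp add: dist_norm norm_minus_commute)
    have taylor: "cmod (f (y + t k *\<^sub>R X) - f y - dir_deriv (t k *\<^sub>R X) f y)
        \<le> 8 * M / (r/2)^2 * (norm (t k *\<^sub>R X))^2"
      using inb r M tX[of k] by (intro holomorphic_several_taylor[OF f]) auto
    have "dir_deriv (t k *\<^sub>R X) f y = of_real (t k) * dir_deriv X f y"
      using y sub by (simp add: scaleR_eq_smult holomorphic_several_derivative(2)[OF f] subset_iff)
    moreover have "(f (y + t k *\<^sub>R X) - f y) / of_real (t k) - dir_deriv X f y =
      (f (y + t k *\<^sub>R X) - f y - of_real (t k) * dir_deriv X f y) / of_real (t k)"
      using t[of k] by (simp add: field_simps)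
    ultimately have "cmod ((f (y + t k *\<^sub>R X) - f y) / of_real (t k) - dir_deriv X f y) =
       cmod (f (y + t k *\<^sub>R X) - f y - dir_deriv (t k *\<^sub>R X) f y) / t k"
      using t[of k] by (simp add: norm_divide)
    also have "\<dots> \<le> (8 * M / (r/2)^2 * (norm (t k *\<^sub>R X))^2) / t k"
      using t[of k] by (intro divide_right_mono taylor) simp
    also have "\<dots> = t k * (8 * M / (r/2)^2 * (norm X)^2)"
      using t[of k] by (simp add: power_mult_distrib power2_eq_square)
    finally show ?thesis .
  qed
  have "uniform_limit (ball z (r/2)) (\<lambda>k y. (f (y + t k *\<^sub>R X) - f y) / of_real (t k)) (dir_deriv X f) sequentially"
  proof (rule uniform_limitI)
    fix e :: real assume "0 < e"
    have "(\<lambda>k. t k * (8 * M / (r/2)^2 * (norm X)^2)) \<longlonglongrightarrow> 0 * (8 * M / (r/2)^2 * (norm X)^2)"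
      by (intro tendsto_intros t0)
    then have "\<forall>\<^sub>F k in sequentially. t k * (8 * M / (r/2)^2 * (norm X)^2) < e"
      using \<open>0 < e\<close> by (intro order_tendstoD(2)) auto
    then show "\<forall>\<^sub>F k in sequentially. \<forall>y\<in>ball z (r/2).
       dist ((f (y + t k *\<^sub>R X) - f y) / of_real (t k)) (dir_deriv X f y) < e"
      by eventually_elim (auto simp: dist_norm simp del: mem_ball intro: est[THEN order_le_less_trans])
  qed
  moreover have "z + t k *\<^sub>R X \<in> U" for k
    using r shift[of z k] by auto
  ultimately show ?thesis
    using that[of "r/2" t, OF _ sub t(1) t0 hol] r by simp
qed

lemma holomorphic_several_dir_deriv:
  assumes f: "holomorphic_several f U" and U: "open U"
  shows "holomorphic_several (dir_deriv X f) U"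
  unfolding holomorphic_several_def
proof
  fix z assume z: "z \<in> U"
  obtain r t where rt: "0 < r" "ball z r \<subseteq> U" "\<And>k. 0 < (t k :: real)" "t \<longlonglongrightarrow> 0"
    "\<And>k. holomorphic_several (\<lambda>y. (f (y + t k *\<^sub>R X) - f y) / of_real (t k)) (ball z r)"
    "uniform_limit (ball z r) (\<lambda>k y. (f (y + t k *\<^sub>R X) - f y) / of_real (t k)) (dir_deriv X f) sequentially"
    "\<And>k. z + t k *\<^sub>R X \<in> U"
    by (rule difference_quotient_limit[OF f U z, where X=X]) (rule that)
  show "\<exists>f'. (dir_deriv X f has_derivative f') (at z) \<and> (\<forall>c v. f' (c *s v) = c * f' v)"
    by (rule holomorphic_several_limit_at[OF rt(5) rt(1) order_refl rt(6)])
qed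

text \<open>The difference quotients in direction \<open>X\<close> converge locally uniformly, so a derivative in
  direction \<open>Y\<close> may be taken inside the limit.\<close>

lemma dir_deriv_commute:
  assumes f: "holomorphic_several f U" and U: "open U" and z: "z \<in> U"
  shows "dir_deriv X (dir_deriv Y f) z = dir_deriv Y (dir_deriv X f) z"
proof -
  obtain r t where rt: "0 < r" "ball z r \<subseteq> U" "\<And>k. 0 < (t k :: real)" "t \<longlonglongrightarrow> 0"
    "\<And>k. holomorphic_several (\<lambda>y. (f (y + t k *\<^sub>R X) - f y) / of_real (t k)) (ball z r)"
    "uniform_limit (ball z r) (\<lambda>k y. (f (y + t k *\<^sub>R X) - f y) / of_real (t k)) (dir_deriv X f) sequentially"
    "\<And>k. z + t k *\<^sub>R X \<in> U"
    by (rule difference_quotient_limit[OF f U z, where X=X]) (rule that)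
  have dX: "holomorphic_several (dir_deriv X f) (ball z r)"
    using holomorphic_several_subset[OF holomorphic_several_dir_deriv[OF f U] rt(2)] .
  have "(\<lambda>k. dir_deriv Y (\<lambda>y. (f (y + t k *\<^sub>R X) - f y) / of_real (t k)) z) \<longlonglongrightarrow> dir_deriv Y (dir_deriv X f) z"
    by (rule dir_deriv_tendsto_cauchy[OF rt(5) dX rt(1) order_refl rt(6)])
  moreover have "dir_deriv Y (\<lambda>y. (f (y + t k *\<^sub>R X) - f y) / of_real (t k)) z
     = (dir_deriv Y f (z + t k *\<^sub>R X) - dir_deriv Y f z) / of_real (t k)" for k
  proof -
    have "((\<lambda>y. y + t k *\<^sub>R X) has_derivative (\<lambda>h. h)) (at z)"
      by (auto intro!: derivative_eq_intros)
    from has_derivative_compose[OF this holomorphic_several_derivative(1)[OF f rt(7)]]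
    have "((\<lambda>y. f (y + t k *\<^sub>R X)) has_derivative (\<lambda>Y. dir_deriv Y f (z + t k *\<^sub>R X))) (at z)" .
    from has_derivative_diff[OF this holomorphic_several_derivative(1)[OF f z]]
    have "((\<lambda>y. (f (y + t k *\<^sub>R X) - f y) / of_real (t k)) has_derivative
       (\<lambda>Y. (dir_deriv Y f (z + t k *\<^sub>R X) - dir_deriv Y f z) / of_real (t k))) (at z)"
      using has_derivative_mult_left[of "\<lambda>y. f (y + t k *\<^sub>R X) - f y" _ "at z" "1 / complex_of_real (t k)"]
      by (simp add: divide_inverse)
    then show ?thesis by (rule dir_deriv_eqI)
  qed
  moreover have "(\<lambda>k. (dir_deriv Y f (z + t k *\<^sub>R X) - dir_deriv Y f z) / of_real (t k))
     \<longlonglongrightarrow> dir_deriv X (dir_deriv Y f) z"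
  proof -
    have dY: "holomorphic_several (dir_deriv Y f) U"
      by (rule holomorphic_several_dir_deriv[OF f U])
    have "((\<lambda>\<zeta>. dir_deriv Y f (z + \<zeta> *s X)) has_field_derivative dir_deriv X (dir_deriv Y f) z) (at 0)"
      using holomorphic_several_line[OF dY, of z 0 X] z by simp
    then have "((\<lambda>\<zeta>. (dir_deriv Y f (z + \<zeta> *s X) - dir_deriv Y f z) / \<zeta>) \<longlongrightarrow> dir_deriv X (dir_deriv Y f) z) (at 0)"
      by (simp add: has_field_derivative_iff)
    moreover have "filterlim (\<lambda>k. complex_of_real (t k)) (at 0) sequentially"
      unfolding filterlim_at using tendsto_of_real[OF rt(4), where 'a=complex] rt(3)[THEN less_imp_neq]
      by (auto simp: eq_commute[of 0])
    ultimately show ?thesis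
      unfolding scaleR_eq_smult by (rule filterlim_compose)
  qed
  ultimately show ?thesis by (simp add: LIMSEQ_unique)
qed

text \<open>Sum of a first-order Cauchy bound on the disc of radius \<open>r / (2 * norm h)\<close>
  and the Taylor remainder, each contributing \<open>2 * M / r * norm h\<close>. Its linear
  dependence on the bound \<open>M\<close> is what the mixed term in Osgood's lemma
  exploits.\<close>

lemma holomorphic_several_lipschitz:
  assumes f: "holomorphic_several f U" and "0 < r"
    and U: "\<And>y. norm (y - z) < r \<Longrightarrow> y \<in> U"
    and M: "\<And>y. norm (y - z) < r \<Longrightarrow> cmod (f y) \<le> M"
    and h: "norm h \<le> r / 4"
  shows "cmod (f (z + h) - f z) \<le> 4 * M / r * norm h"
proof (cases "h = 0")
  case False
  define a where "a = norm h"
  have a: "0 < a" "a \<le> r / 4" using False h by (auto simp: a_def)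
  have zz: "norm (z - z) < r" using \<open>0 < r\<close> by simp
  have M0: "0 \<le> M" using order_trans[OF norm_ge_zero M[OF zz]] .
  have line: "norm (z + \<zeta> *s h - z) < r" if "cmod \<zeta> \<le> r / (2 * a)" for \<zeta>
  proof -
    have "cmod \<zeta> * a \<le> r / (2 * a) * a" using that a by (intro mult_right_mono) auto
    also have "\<dots> < r" using a \<open>0 < r\<close> by simp
    finally show ?thesis by (simp add: norm_vector_smult a_def)
  qed
  have "cmod (dir_deriv h f z) \<le> M / (r / (2 * a))"
    by (rule dir_deriv_cauchy[OF f]) (use a \<open>0 < r\<close> in \<open>auto intro!: U M line\<close>)
  then have 1: "cmod (dir_deriv h f z) \<le> 2 * M / r * a" by (simp add: ac_simps)
  have "cmod (f (z + h) - f z - dir_deriv h f z) \<le> 8 * M / r^2 * a^2"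
    unfolding a_def by (rule holomorphic_several_taylor[OF f \<open>0 < r\<close> U M h])
  also have "\<dots> = 8 * M / r^2 * a * a" by (simp add: power2_eq_square)
  also have "\<dots> \<le> 8 * M / r^2 * a * (r / 4)"
    using M0 a by (intro mult_left_mono) auto
  also have "\<dots> = 2 * M / r * a" using \<open>0 < r\<close> by (simp add: power2_eq_square)
  finally have 2: "cmod (f (z + h) - f z - dir_deriv h f z) \<le> 2 * M / r * a" .
  have "cmod (f (z + h) - f z) \<le> 2 * M / r * a + 2 * M / r * a"
    using 1 2 norm_triangle_sub[of "f (z + h) - f z" "dir_deriv h f z"] by linarith
  then show ?thesis by (simp add: a_def)
qed simp

section \<open>Two blocks of complex variables\<close>

text \<open>Indexing by a sum type keeps the pair a vector of complex numbers, so that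
  \<open>holomorphic_several\<close> covers functions of both blocks.\<close>

definition cpair :: "complex^'m::finite \<Rightarrow> complex^'n::finite \<Rightarrow> complex^('m::finite + 'n::finite)" where
  "cpair z w = (\<chi> i. case i of Inl a \<Rightarrow> z $ a | Inr b \<Rightarrow> w $ b)"

definition cfst :: "complex^('m::finite + 'n::finite) \<Rightarrow> complex^'m" where "cfst p = (\<chi> a. p $ Inl a)"
definition csnd :: "complex^('m::finite + 'n::finite) \<Rightarrow> complex^'n" where "csnd p = (\<chi> b. p $ Inr b)"

lemma cpair_simps [simp]:
  "cfst (cpair z w) = z" "csnd (cpair z w) = w" "cpair (cfst p) (csnd p) = p"
  by (auto simp: cpair_def cfst_def csnd_def vec_eq_iff split: sum.split)

lemma cpair_linear:
  "cpair z w + cpair z' w' = cpair (z + z') (w + w')"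
  "cpair z w - cpair z' w' = cpair (z - z') (w - w')"
  "c *s cpair z w = cpair (c *s z) (c *s w)"
  "t *\<^sub>R cpair z w = cpair (t *\<^sub>R z) (t *\<^sub>R w)"
  by (auto simp: cpair_def vec_eq_iff split: sum.split)

lemma cfst_csnd_linear:
  "cfst (p + q) = cfst p + cfst q" "csnd (p + q) = csnd p + csnd q"
  "cfst (p - q) = cfst p - cfst q" "csnd (p - q) = csnd p - csnd q"
  "cfst (c *s p) = c *s cfst p" "csnd (c *s p) = c *s csnd p"
  by (auto simp: cfst_def csnd_def vec_eq_iff)

lemma norm_cpair: "norm (cpair z w) = sqrt ((norm z)^2 + (norm w)^2)"
proof -
  have "(\<Sum>i\<in>UNIV. (cmod (cpair z w $ i))^2) = (\<Sum>i\<in>UNIV. (cmod (z $ i))^2) + (\<Sum>i\<in>UNIV. (cmod (w $ i))^2)"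
    by (simp add: cpair_def UNIV_Plus_UNIV[symmetric] sum.Plus del: UNIV_Plus_UNIV)
  then show ?thesis
    by (simp add: norm_vec_def L2_set_def sum_nonneg)
qed

lemma norm_cpair_le: "norm (cpair z w) \<le> norm z + norm w"
  unfolding norm_cpair by (rule real_le_lsqrt) (auto simp: power2_sum)

lemma norm_cfst_le: "norm (cfst p) \<le> norm p" and norm_csnd_le: "norm (csnd p) \<le> norm p"
proof -
  have "norm p = sqrt ((norm (cfst p))^2 + (norm (csnd p))^2)"
    using norm_cpair[of "cfst p" "csnd p"] by simp
  then show "norm (cfst p) \<le> norm p" "norm (csnd p) \<le> norm p"
    by (auto intro!: real_le_rsqrt)
qed

text \<open>Osgood's lemma for two blocks of variables: the mixed second difference is controlled by
  applying the Lipschitz estimate in each block in turn.\<close>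

lemma osgood:
  fixes f :: "complex^('m::finite + 'n::finite) \<Rightarrow> complex"
  assumes bd: "\<And>p. p \<in> U \<Longrightarrow> \<exists>r>0. \<exists>M. ball p r \<subseteq> U \<and> (\<forall>q\<in>ball p r. cmod (f q) \<le> M)"
    and h1: "\<And>w. holomorphic_several (\<lambda>z. f (cpair z w)) {z. cpair z w \<in> U}"
    and h2: "\<And>z. holomorphic_several (\<lambda>w. f (cpair z w)) {w. cpair z w \<in> U}"
  shows "holomorphic_several f U"
  unfolding holomorphic_several_def
proof
  fix p assume "p \<in> U"
  then obtain r M where r: "0 < r" and rU: "ball p r \<subseteq> U" and rM: "\<forall>q\<in>ball p r. cmod (f q) \<le> M"
    using bd[of p] by blast
  have U: "q \<in> U" if "norm (q - p) < r" for q
    using rU that by (auto simp: dist_norm norm_minus_commute)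
  have M: "cmod (f q) \<le> M" if "norm (q - p) < r" for q
    using rM that by (auto simp: dist_norm norm_minus_commute)
  define a b where "a = cfst p" and "b = csnd p"
  have p: "p = cpair a b" by (simp add: a_def b_def)
  have near: "norm (cpair z w - p) < r" if "norm (z - a) + norm (w - b) < r" for z w
    using norm_cpair_le[of "z - a" "w - b"] that by (simp add: p cpair_linear)
  let ?D1 = "\<lambda>x. dir_deriv x (\<lambda>z. f (cpair z b)) a" and ?D2 = "\<lambda>y. dir_deriv y (\<lambda>w. f (cpair a w)) b"
  have inU: "a \<in> {z. cpair z b \<in> U}" "b \<in> {w. cpair a w \<in> U}" using \<open>p \<in> U\<close> p by auto
  define D where "D h = ?D1 (cfst h) + ?D2 (csnd h)" for h
  have hom: "D (c *s h) = c * D h" for c h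
    by (simp add: D_def cfst_csnd_linear holomorphic_several_derivative(2)[OF h1 inU(1)]
        holomorphic_several_derivative(2)[OF h2 inU(2)] algebra_simps)
  have add: "D (h + h') = D h + D h'" for h h'
    by (simp add: D_def cfst_csnd_linear dir_deriv_linear(1)[OF h1 inU(1)]
        dir_deriv_linear(1)[OF h2 inU(2)])
  have "norm (p - p) < r" using r by simp
  then have M0: "0 \<le> M" using M order_trans[OF norm_ge_zero] by blast
  have "(f has_derivative D) (at p)"
  proof (rule has_derivative_quadratic)
    show "linear D" by (rule linearI) (auto simp: add scaleR_eq_smult hom scaleR_conv_of_real)
    show "0 < r / 8" using r by simp
    fix h :: "complex^('m::finite + 'n::finite)" assume h: "norm h < r / 8"
    define x y where "x = cfst h" and "y = csnd h"
    have xy: "norm x \<le> norm h" "norm y \<le> norm h" by (simp_all add: x_def y_def norm_cfst_le norm_csnd_le)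
    have ph: "p + h = cpair (a + x) (b + y)" by (simp add: p x_def y_def cpair_linear(1)[symmetric])
    have hx: "norm x \<le> r / 4" "norm x \<le> r / 2 / 4" "norm x < r / 2"
      and hy: "norm y \<le> r / 4" "norm y \<le> r / 2 / 4"
      using xy h norm_ge_zero[of x] by linarith+
    have near1: "norm (cpair z b - p) < r" if "norm (z - a) < r" for z by (rule near) (use that in simp)
    have near2: "norm (cpair a w - p) < r" if "norm (w - b) < r" for w by (rule near) (use that in simp)
    have near3: "norm (cpair z w - p) < r" if "norm (z - a) < r/2" "norm (w - b) < r/2" for z w
      by (rule near) (use that in simp)
    have T1: "cmod (f (cpair (a + x) b) - f (cpair a b) - ?D1 x) \<le> 8 * M / r^2 * (norm x)^2"
      by (rule holomorphic_several_taylor[OF h1 r]) (use hx near1 U M in auto)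
    have T2: "cmod (f (cpair a (b + y)) - f (cpair a b) - ?D2 y) \<le> 8 * M / r^2 * (norm y)^2"
      by (rule holomorphic_several_taylor[OF h2 r]) (use hy near2 U M in auto)
    define G where "G w = f (cpair (a + x) w) - f (cpair a w)" for w
    have r2: "0 < r/2" using r by simp
    have G: "cmod (G w) \<le> 4 * M / (r/2) * norm x" if w: "norm (w - b) < r/2" for w
      unfolding G_def
      by (rule holomorphic_several_lipschitz[OF h1 r2]) (use hx near3[OF _ w] U M in auto)
    have hG: "holomorphic_several G (ball b (r/2))"
      unfolding G_def
    proof (intro holomorphic_several_diff holomorphic_several_subset[OF h2] subsetI CollectI U near3)
      show "norm (a + x - a) < r/2" using hx by simp
    qed (use r in \<open>auto simp: dist_norm norm_minus_commute\<close>)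
    have T3: "cmod (G (b + y) - G b) \<le> 4 * (4 * M / (r/2) * norm x) / (r/2) * norm y"
      by (rule holomorphic_several_lipschitz[OF hG r2])
        (use hy G in \<open>auto simp: dist_norm norm_minus_commute\<close>)
    also have "\<dots> = 64 * M / r^2 * (norm x * norm y)" by (simp add: power2_eq_square)
    finally have T3: "cmod (G (b + y) - G b) \<le> 64 * M / r^2 * (norm x * norm y)" .
    have C: "0 \<le> M / r^2" using M0 by simp
    have sq: "(norm x)^2 \<le> (norm h)^2" "(norm y)^2 \<le> (norm h)^2" "norm x * norm y \<le> (norm h)^2"
      using xy by (auto simp: power2_eq_square intro!: mult_mono)
    \<comment> \<open>Telescoping: the increment is the mixed second difference plus the Taylor
      remainders of the two slices through \<open>p\<close>.\<close>
    have "f (p + h) - f p - D h = (G (b + y) - G b) + (f (cpair (a + x) b) - f (cpair a b) - ?D1 x)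
        + (f (cpair a (b + y)) - f (cpair a b) - ?D2 y)"
      by (simp only: ph) (simp add: D_def G_def x_def[symmetric] y_def[symmetric] p)
    moreover have "cmod (u + v + w) \<le> cmod u + cmod v + cmod w" for u v w
      using norm_triangle_ineq[of "u + v" w] norm_triangle_ineq[of u v] by linarith
    ultimately have "cmod (f (p + h) - f p - D h) \<le> cmod (G (b + y) - G b) +
       cmod (f (cpair (a + x) b) - f (cpair a b) - ?D1 x) + cmod (f (cpair a (b + y)) - f (cpair a b) - ?D2 y)"
      by (simp only:)
    also have "\<dots> \<le> M / r^2 * (64 * (norm x * norm y)) + M / r^2 * (8 * (norm x)^2) + M / r^2 * (8 * (norm y)^2)"
      by (intro add_mono T3[THEN order_trans] T1[THEN order_trans] T2[THEN order_trans]) (simp_all add: mult_ac)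
    also have "\<dots> \<le> M / r^2 * (64 * (norm h)^2) + M / r^2 * (8 * (norm h)^2) + M / r^2 * (8 * (norm h)^2)"
      using C sq by (intro add_mono mult_left_mono) auto
    also have "\<dots> = 80 * (M / r^2) * (norm h)^2" by simp
    finally show "cmod (f (p + h) - f p - D h) \<le> 80 * (M / r^2) * (norm h)^2" .
  qed
  with hom show "\<exists>f'. (f has_derivative f') (at p) \<and> (\<forall>c v. f' (c *s v) = c * f' v)" by blast
qed

section \<open>Estimates in an arbitrary complex norm\<close>

text \<open>In direction \<open>X\<close> the disc of radius \<open>s / N X\<close> stays in the
  \<open>N\<close>-ball. Measuring with an abstract norm instead of the Euclidean one keeps the
  distortion of the coordinate change out of the constants.\<close>

lemma dir_deriv_cauchy_norm:
  assumes f: "holomorphic_several f U"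
    and tri: "\<And>x y. N (x + y) \<le> N x + N y" and hom: "\<And>c x. N (c *s x) = cmod c * N x"
    and nz: "\<And>x. N x = 0 \<Longrightarrow> x = 0"
    and U: "\<And>q. N (q - p0) < R \<Longrightarrow> q \<in> U" and M: "\<And>q. N (q - p0) < R \<Longrightarrow> cmod (f q) \<le> M"
    and s: "0 < s" "N (p - p0) < R - s"
  shows "cmod (dir_deriv X f p) \<le> M * N X / s"
proof (cases "X = 0")
  case True
  have "N X = 0" using hom[of 0 X] True by simp
  moreover have "p \<in> U" using U s by simp
  ultimately show ?thesis using dir_deriv_linear(3)[OF f] True by simp
next
  case False
  have "N 0 = 0" using hom[of 0 0] by simp
  moreover have "N (- X) = N X" using hom[of "-1" X] by simp
  ultimately have "0 \<le> N X" using tri[of X "-X"] by simp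
  then have NX: "0 < N X" using False nz[of X] by linarith
  have near: "N (p + \<zeta> *s X - p0) < R" if "cmod \<zeta> \<le> s / N X" for \<zeta>
  proof -
    have "N ((p - p0) + \<zeta> *s X) \<le> N (p - p0) + cmod \<zeta> * N X" using tri[of "p - p0" "\<zeta> *s X"] by (simp only: hom)
    also have "cmod \<zeta> * N X \<le> s / N X * N X" using that NX by (intro mult_right_mono) auto
    finally show ?thesis using NX s by (simp add: algebra_simps)
  qed
  have "cmod (dir_deriv X f p) \<le> M / (s / N X)"
    by (rule dir_deriv_cauchy[OF f]) (use NX s in \<open>auto intro!: U M near\<close>)
  then show ?thesis by (simp add: mult.commute)
qed

lemma segment_bound:
  assumes f: "holomorphic_several f U"
    and U: "\<And>u. 0 \<le> u \<Longrightarrow> u \<le> 1 \<Longrightarrow> p + u *\<^sub>R (q - p) \<in> U"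
    and B: "\<And>u. 0 \<le> u \<Longrightarrow> u \<le> 1 \<Longrightarrow> cmod (dir_deriv (q - p) f (p + u *\<^sub>R (q - p))) \<le> B"
  shows "cmod (f q - f p) \<le> B"
proof -
  let ?S = "closed_segment 0 1 :: complex set"
  have S: "\<exists>u. \<zeta> = of_real u \<and> 0 \<le> u \<and> u \<le> 1" if "\<zeta> \<in> ?S" for \<zeta>
    using that by (auto simp: in_segment scaleR_conv_of_real)
  have "cmod (f (p + 1 *s (q - p)) - f (p + 0 *s (q - p))) \<le> B * cmod (1 - 0)"
  proof (rule field_differentiable_bound[where S="?S" and f="\<lambda>\<zeta>. f (p + \<zeta> *s (q - p))"
        and f'="\<lambda>\<zeta>. dir_deriv (q - p) f (p + \<zeta> *s (q - p))"])
    fix \<zeta> assume "\<zeta> \<in> ?S"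
    then obtain u where u: "\<zeta> = of_real u" "0 \<le> u" "u \<le> 1" using S[of \<zeta>] by blast
    show "((\<lambda>\<zeta>. f (p + \<zeta> *s (q - p))) has_field_derivative dir_deriv (q - p) f (p + \<zeta> *s (q - p))) (at \<zeta> within ?S)"
      using U[OF u(2,3)] u(1)
      by (intro has_field_derivative_at_within[OF holomorphic_several_line[OF f]]) (simp add: scaleR_eq_smult)
    show "cmod (dir_deriv (q - p) f (p + \<zeta> *s (q - p))) \<le> B"
      using B[OF u(2,3)] u(1) by (simp add: scaleR_eq_smult)
  qed auto
  then show ?thesis by simp
qed

section \<open>Second-order difference quotients\<close>

lemma second_order_limit:
  assumes f: "holomorphic_several f U" and U: "open U" and p: "p \<in> U"
  shows "((\<lambda>t::real. (f (p + t *\<^sub>R Z) - f p - of_real t * dir_deriv Z f p) / of_real (t^2)) \<longlongrightarrow>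
            dir_deriv Z (dir_deriv Z f) p / 2) (at 0)"
proof -
  note hd = holomorphic_several_dir_deriv[OF _ U]
  define F where "F i = (dir_deriv Z ^^ i) f" for i
  have F: "holomorphic_several (F i) U" for i
    by (induction i) (auto simp: F_def f intro: hd)
  have FS: "dir_deriv Z (F i) = F (Suc i)" for i by (simp add: F_def)
  obtain r B where r: "0 < r" "ball p r \<subseteq> U" and B: "\<And>y. y \<in> ball p r \<Longrightarrow> cmod (F 3 y) \<le> B"
    using holomorphic_several_locally_bounded[OF F U p] by blast
  obtain \<rho> where \<rho>: "0 < \<rho>" and line: "\<And>\<zeta>. cmod \<zeta> \<le> \<rho> \<Longrightarrow> p + \<zeta> *s Z \<in> ball p r"
    using complex_line_in_ball[OF r(1)] by blast
  have est: "cmod ((f (p + t *\<^sub>R Z) - f p - of_real t * dir_deriv Z f p) / of_real (t^2)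
         - dir_deriv Z (dir_deriv Z f) p / 2) \<le> B / 2 * \<bar>t\<bar>" if t: "\<bar>t\<bar> < \<rho>" "t \<noteq> 0" for t
  proof -
    have "cmod (F 0 (p + of_real t *s Z) - (\<Sum>i\<le>2. F i (p + 0 *s Z) * (of_real t - 0) ^ i / (fact i)))
        \<le> B * cmod (of_real t - 0)^(Suc 2) / fact 2"
    proof (rule complex_Taylor[of "cball 0 \<rho>" 2 "\<lambda>i \<zeta>. F i (p + \<zeta> *s Z)"])
      fix i :: nat and \<zeta> :: complex assume "\<zeta> \<in> cball 0 \<rho>"
      then have "p + \<zeta> *s Z \<in> ball p r" using line by simp
      then have "p + \<zeta> *s Z \<in> U" using r by auto
      from holomorphic_several_line[OF F this]
      show "((\<lambda>\<zeta>. F i (p + \<zeta> *s Z)) has_field_derivative F (Suc i) (p + \<zeta> *s Z)) (at \<zeta> within cball 0 \<rho>)"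
        by (simp add: FS has_field_derivative_at_within)
    next
      fix \<zeta> :: complex assume "\<zeta> \<in> cball 0 \<rho>"
      then show "cmod (F (Suc 2) (p + \<zeta> *s Z)) \<le> B"
        using B[OF line] by (simp add: eval_nat_numeral)
    qed (use t in auto)
    moreover have "(\<Sum>i\<le>2. F i (p + 0 *s Z) * (of_real t - 0) ^ i / (fact i)) =
       F 0 p + F 1 p * of_real t + F 2 p * of_real (t^2) / 2"
    proof -
      have "(\<Sum>i\<le>2. g i) = g 0 + g 1 + g 2" for g :: "nat \<Rightarrow> complex"
        by (simp add: eval_nat_numeral)
      then show ?thesis by simp
    qed
    moreover have "F 0 = f" "F 1 = dir_deriv Z f" "F 2 = dir_deriv Z (dir_deriv Z f)"
      by (simp_all add: F_def eval_nat_numeral)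
    moreover have "cmod (of_real t - 0) ^ Suc 2 = \<bar>t\<bar>^3" by simp
    ultimately have "cmod (f (p + t *\<^sub>R Z) - f p - of_real t * dir_deriv Z f p - of_real (t^2) * dir_deriv Z (dir_deriv Z f) p / 2)
        \<le> B * \<bar>t\<bar>^3 / 2"
      by (simp only: scaleR_eq_smult) (simp add: algebra_simps)
    moreover have "(f (p + t *\<^sub>R Z) - f p - of_real t * dir_deriv Z f p) / of_real (t^2) - dir_deriv Z (dir_deriv Z f) p / 2
      = (f (p + t *\<^sub>R Z) - f p - of_real t * dir_deriv Z f p - of_real (t^2) * dir_deriv Z (dir_deriv Z f) p / 2) / of_real (t^2)"
      using t by (simp add: field_simps)
    ultimately have "cmod ((f (p + t *\<^sub>R Z) - f p - of_real t * dir_deriv Z f p) / of_real (t^2) - dir_deriv Z (dir_deriv Z f) p / 2)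
       \<le> (B * \<bar>t\<bar>^3 / 2) / t^2"
      by (simp only: norm_divide norm_of_real abs_power2) (intro divide_right_mono, auto)
    also have "(B * \<bar>t\<bar>^3 / 2) / t^2 = B / 2 * \<bar>t\<bar>"
    proof -
      have "\<bar>t\<bar>^3 = \<bar>t\<bar> * t^2" by (simp add: power3_eq_cube power2_eq_square mult.assoc)
      then show ?thesis using t by simp
    qed
    finally show ?thesis .
  qed
  have "((\<lambda>t::real. (f (p + t *\<^sub>R Z) - f p - of_real t * dir_deriv Z f p) / of_real (t^2)
         - dir_deriv Z (dir_deriv Z f) p / 2) \<longlongrightarrow> 0) (at 0)"
  proof (rule Lim_null_comparison)
    have "\<forall>\<^sub>F t in at (0::real). \<bar>t\<bar> < \<rho> \<and> t \<noteq> 0"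
      using \<rho> by (auto simp: eventually_at dist_norm)
    then show "\<forall>\<^sub>F t in at 0. cmod ((f (p + t *\<^sub>R Z) - f p - of_real t * dir_deriv Z f p) / of_real (t^2)
         - dir_deriv Z (dir_deriv Z f) p / 2) \<le> B / 2 * \<bar>t\<bar>"
      by eventually_elim (rule est, auto)
    have "((\<lambda>t::real. B / 2 * \<bar>t\<bar>) \<longlongrightarrow> B / 2 * \<bar>0\<bar>) (at 0)" by (intro tendsto_intros)
    then show "((\<lambda>t::real. B / 2 * \<bar>t\<bar>) \<longlongrightarrow> 0) (at 0)" by simp
  qed
  then show ?thesis by (rule LIM_zero_cancel)
qed

text \<open>Polarisation: linearity of \<open>dir_deriv\<close> cancels the first-order terms, and
  of the three quadratic terms only the mixed one survives. It recovers a mixed derivative from the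
  values at four points.\<close>

lemma mixed_difference_limit:
  assumes f: "holomorphic_several f U" and U: "open U" and p: "p \<in> U"
  shows "((\<lambda>t::real. (f (p + t *\<^sub>R (X + Y)) - f (p + t *\<^sub>R X) - f (p + t *\<^sub>R Y) + f p) / of_real (t^2)) \<longlongrightarrow>
            dir_deriv X (dir_deriv Y f) p) (at 0)"
proof -
  note hd = holomorphic_several_dir_deriv[OF _ U]
  have lin: "dir_deriv (X + Y) (dir_deriv (X + Y) f) p =
     dir_deriv X (dir_deriv X f) p + dir_deriv Y (dir_deriv Y f) p + 2 * dir_deriv X (dir_deriv Y f) p"
  proof -
    have "dir_deriv V (dir_deriv (X + Y) f) p = dir_deriv X (dir_deriv V f) p + dir_deriv Y (dir_deriv V f) p" for V
      using dir_deriv_linear(1)[OF hd[OF f] p, of X Y V] dir_deriv_commute[OF f U p, of V] by simp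
    then show ?thesis
      by (simp add: dir_deriv_linear(1)[OF hd[OF f] p] dir_deriv_commute[OF f U p, of Y X])
  qed
  let ?q = "\<lambda>Z t. (f (p + t *\<^sub>R Z) - f p - of_real t * dir_deriv Z f p) / of_real (t^2)"
  have "((\<lambda>t::real. ?q (X + Y) t - ?q X t - ?q Y t) \<longlongrightarrow> dir_deriv (X + Y) (dir_deriv (X + Y) f) p / 2
       - dir_deriv X (dir_deriv X f) p / 2 - dir_deriv Y (dir_deriv Y f) p / 2) (at 0)"
    by (intro tendsto_diff second_order_limit[OF f U p])
  moreover have "?q (X + Y) t - ?q X t - ?q Y t =
      (f (p + t *\<^sub>R (X + Y)) - f (p + t *\<^sub>R X) - f (p + t *\<^sub>R Y) + f p) / of_real (t^2)" for t
    by (simp add: dir_deriv_linear(1)[OF f p] diff_divide_distrib[symmetric] algebra_simps)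
  ultimately show ?thesis
    by (simp add: lin add_divide_distrib)
qed

section \<open>Conjugation and the totally real subspace\<close>

definition cnjv :: "complex^'n \<Rightarrow> complex^'n" where "cnjv z = (\<chi> i. cnj (z $ i))"

lemma cnjv_simps [simp]: "cnjv (cnjv z) = z" "norm (cnjv z) = norm z" "cnjv z $ i = cnj (z $ i)"
  "cnjv (axis i 1) = axis i 1" "cnjv (axis i \<i>) = - axis i \<i>"
  by (auto simp: cnjv_def vec_eq_iff norm_vec_def axis_def)

lemma cnjv_linear: "cnjv (z + w) = cnjv z + cnjv w" "cnjv (z - w) = cnjv z - cnjv w"
  "cnjv (c *s z) = cnj c *s cnjv z" "cnjv (t *\<^sub>R z) = t *\<^sub>R cnjv z"
  by (auto simp: cnjv_def vec_eq_iff)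

text \<open>A real-analytic function \<open>f\<close> of \<open>z\<close> is studied through a holomorphic function \<open>F\<close> of twice as
  many variables, with \<open>f(z) = F(z, z\<close>-bar\<open>)\<close>; \<open>antidiag\<close> is the embedding of the totally real
  subspace on which \<open>F\<close> restricts to \<open>f\<close>, and \<open>cswap\<close> the conjugation fixing it.\<close>

definition antidiag :: "complex^'n \<Rightarrow> complex^('n::finite + 'n)" where "antidiag z = cpair z (cnjv z)"

definition cswap :: "complex^('n::finite + 'n) \<Rightarrow> complex^('n::finite + 'n)" where
  "cswap p = cpair (cnjv (csnd p)) (cnjv (cfst p))"

lemma cswap_simps [simp]: "cswap (antidiag z) = antidiag z" "cswap (cpair z w) = cpair (cnjv w) (cnjv z)"
  "cswap (cswap p) = p"
  by (simp_all add: cswap_def antidiag_def)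

lemma antidiag_linear: "antidiag (z + w) = antidiag z + antidiag w" "antidiag (z - w) = antidiag z - antidiag w"
   "antidiag (t *\<^sub>R z) = t *\<^sub>R antidiag z"
  by (simp_all add: antidiag_def cpair_linear cnjv_linear)

lemma bounded_linear_antidiag: "bounded_linear antidiag"
  by (simp add: linear_conv_bounded_linear[symmetric] linear_iff antidiag_linear)

lemma bounded_linear_cswap: "bounded_linear cswap"
  by (simp add: linear_conv_bounded_linear[symmetric] linear_iff cswap_def cfst_csnd_linear cnjv_linear
     cpair_linear scaleR_eq_smult)

lemma pullback_derivative:
  assumes "holomorphic_several G U" "antidiag z \<in> U"
  shows "((\<lambda>z. G (antidiag z)) has_derivative (\<lambda>X. dir_deriv (antidiag X) G (antidiag z))) (at z)"
  using has_derivative_compose[OF bounded_linear_imp_has_derivative[OF bounded_linear_antidiag]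
      holomorphic_several_derivative(1)[OF assms]] .

lemma dir_deriv_pullback:
  assumes G: "holomorphic_several G U" and V: "open V" "z \<in> V"
    and "\<And>z. z \<in> V \<Longrightarrow> antidiag z \<in> U" "\<And>z. z \<in> V \<Longrightarrow> f z = G (antidiag z)"
  shows "dir_deriv X f z = dir_deriv (antidiag X) G (antidiag z)"
proof -
  have "dir_deriv X f z = dir_deriv X (\<lambda>z. G (antidiag z)) z"
    by (rule dir_deriv_cong[OF V]) (rule assms(5))
  also have "\<dots> = dir_deriv (antidiag X) G (antidiag z)"
    by (rule dir_deriv_eqI[OF pullback_derivative[OF G assms(4)[OF V(2)]]])
  finally show ?thesis .
qed

lemma pullback_Re_derivative:
  assumes G: "holomorphic_several G U" and V: "open V" "z \<in> V"
    and "\<And>z. z \<in> V \<Longrightarrow> antidiag z \<in> U" "\<And>z. z \<in> V \<Longrightarrow> f z = Re (G (antidiag z))"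
  shows "(f has_derivative (\<lambda>X. Re (dir_deriv (antidiag X) G (antidiag z)))) (at z)"
    and "dir_deriv X f z = Re (dir_deriv (antidiag X) G (antidiag z))"
proof -
  have "((\<lambda>z. Re (G (antidiag z))) has_derivative (\<lambda>X. Re (dir_deriv (antidiag X) G (antidiag z)))) (at z)"
    by (rule has_derivative_Re[OF pullback_derivative[OF G assms(4)[OF V(2)]]])
  then show "(f has_derivative (\<lambda>X. Re (dir_deriv (antidiag X) G (antidiag z)))) (at z)"
    by (rule has_derivative_transform_within_open[OF _ V]) (rule assms(5)[symmetric])
  then show "dir_deriv X f z = Re (dir_deriv (antidiag X) G (antidiag z))"
    by (rule dir_deriv_eqI[where f' = "\<lambda>X. Re (dir_deriv (antidiag X) G (antidiag z))"])
qed

text \<open>Functions that are locally the real part of a holomorphic function restricted by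
  \<open>antidiag\<close> are differentiable, and their directional derivatives are of the same
  kind; induction then gives every order.\<close>

lemma Ck_on_pullback:
  fixes S :: "(complex^'n) set" and f :: "complex^'n \<Rightarrow> real"
  assumes "\<And>z0. z0 \<in> S \<Longrightarrow> \<exists>U V G. open U \<and> open V \<and> z0 \<in> V \<and> holomorphic_several G U \<and>
     (\<forall>z\<in>V. antidiag z \<in> U \<and> f z = Re (G (antidiag z)))"
  shows "Ck_on k S f"
proof -
  have locally_differentiable: "f differentiable (at z0)" if loc: "\<exists>U V G. open U \<and> open V \<and> z0 \<in> V \<and>
     holomorphic_several G U \<and> (\<forall>z\<in>V. antidiag z \<in> U \<and> f z = Re (G (antidiag z)))"
      for z0 :: "complex^'n" and f :: "complex^'n \<Rightarrow> real"
  proof -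
    obtain U V G where *: "open V" "z0 \<in> V" "holomorphic_several G U"
      "\<forall>z\<in>V. antidiag z \<in> U \<and> f z = Re (G (antidiag z))"
      using loc by blast
    have "(f has_derivative (\<lambda>X. Re (dir_deriv (antidiag X) G (antidiag z0)))) (at z0)"
      by (rule pullback_Re_derivative(1)[OF *(3,1,2)]) (use *(4) in auto)
    then show ?thesis unfolding differentiable_def by blast
  qed
  show ?thesis using assms
proof (induction k arbitrary: f)
  case 0
  have "isCont f z" if "z \<in> S" for z
    using locally_differentiable[OF "0"[OF that]] by (rule differentiable_imp_continuous_within)
  then show ?case by (simp add: continuous_at_imp_continuous_on)
next
  case (Suc k)
  have "f differentiable (at z)" if "z \<in> S" for z
    using locally_differentiable[OF Suc.prems[OF that]] .
  moreover have "Ck_on k S (dir_deriv X f)" for X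
  proof (rule Suc.IH)
    fix z0 assume "z0 \<in> S"
    then obtain U V G where *: "open U" "open V" "z0 \<in> V" "holomorphic_several G U"
      "\<forall>z\<in>V. antidiag z \<in> U \<and> f z = Re (G (antidiag z))"
      using Suc.prems[OF \<open>z0 \<in> S\<close>] by blast
    have "dir_deriv X f z = Re (dir_deriv (antidiag X) G (antidiag z))" if "z \<in> V" for z
      by (rule pullback_Re_derivative(2)[OF *(4,2) that]) (use *(5) in auto)
    then show "\<exists>U V G. open U \<and> open V \<and> z0 \<in> V \<and> holomorphic_several G U \<and>
     (\<forall>z\<in>V. antidiag z \<in> U \<and> dir_deriv X f z = Re (G (antidiag z)))"
      by (intro exI[of _ U] exI[of _ V] exI[of _ "dir_deriv (antidiag X) G"] conjI ballI
          holomorphic_several_dir_deriv *(1-4)) (use *(5) in auto)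
  qed
  ultimately show ?case by simp
qed
qed

text \<open>\<open>cswap\<close> composed with complex conjugation of values preserves holomorphy,
  so a Hermitian symmetry can be differentiated. Iterated, it yields the symmetry of the metric and
  the closedness of its form.\<close>

lemma dir_deriv_cswap:
  assumes g: "holomorphic_several g U" and U: "open U" "p \<in> U" "\<And>q. q \<in> U \<Longrightarrow> cswap q \<in> U"
    and "\<And>q. q \<in> U \<Longrightarrow> f q = cnj (g (cswap q))"
  shows "dir_deriv X f p = cnj (dir_deriv (cswap X) g (cswap p))"
proof -
  have "((\<lambda>q. cnj (g (cswap q))) has_derivative (\<lambda>X. cnj (dir_deriv (cswap X) g (cswap p)))) (at p)"
    by (rule has_derivative_cnj[OF has_derivative_compose[OF bounded_linear_imp_has_derivative[OF bounded_linear_cswap]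
      holomorphic_several_derivative(1)[OF g U(3)[OF U(2)]]]])
  then show ?thesis
    using dir_deriv_eqI dir_deriv_cong[OF U(1,2) assms(5), where X=X] by simp
qed

subsection \<open>Lebesgue measure and mean values\<close>

lemma nn_integral_lborel_affine:
  fixes g :: "'a::euclidean_space \<Rightarrow> ennreal"
  assumes g: "g \<in> borel_measurable borel" and c: "\<bar>c\<bar> = 1"
  shows "(\<integral>\<^sup>+x. g (t + c *\<^sub>R x) \<partial>lborel) = (\<integral>\<^sup>+x. g x \<partial>lborel)"
proof -
  have c0: "c \<noteq> 0" using c by auto
  have "(\<integral>\<^sup>+x. g x \<partial>lborel) = (\<integral>\<^sup>+x. g x \<partial>density (distr lborel borel (\<lambda>x. t + c *\<^sub>R x)) (\<lambda>_. \<bar>c\<bar>^DIM('a)))"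
    using lborel_affine[OF c0, of t] by simp
  also have "\<dots> = (\<integral>\<^sup>+x. g x \<partial>distr lborel borel (\<lambda>x. t + c *\<^sub>R x))"
    using c by (simp add: nn_integral_density g)
  also have "\<dots> = (\<integral>\<^sup>+x. g (t + c *\<^sub>R x) \<partial>lborel)"
    using g by (intro nn_integral_distr) auto
  finally show ?thesis by simp
qed

lemma nn_integral_lborel_translate:
  fixes g :: "'a::euclidean_space \<Rightarrow> ennreal"
  assumes "g \<in> borel_measurable borel"
  shows "(\<integral>\<^sup>+x. g (t + x) \<partial>lborel) = (\<integral>\<^sup>+x. g x \<partial>lborel)"
  using nn_integral_lborel_affine[OF assms, of 1 t] by simp

text \<open>Uniqueness of Haar measure, specialised to the image of Lebesgue measure under a linear
  isomorphism: substituting \<open>y \<mapsto> y + T x\<close> and then \<open>x \<mapsto> x - T\<close>-inverse\<open> y\<close> in a double integral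
  exchanges the roles of the two measures.\<close>

lemma nn_integral_linear_exchange:
  fixes T :: "'a::euclidean_space \<Rightarrow> 'a" and F B :: "'a \<Rightarrow> ennreal"
  assumes T: "linear T" "bij T" and F: "F \<in> borel_measurable borel" and B: "B \<in> borel_measurable borel"
  shows "(\<integral>\<^sup>+x. F (T x) \<partial>lborel) * (\<integral>\<^sup>+x. B x \<partial>lborel) = (\<integral>\<^sup>+x. B (T x) \<partial>lborel) * (\<integral>\<^sup>+x. F x \<partial>lborel)"
proof -
  obtain S where S: "\<And>y. T (S y) = y" using T(2) by (metis bij_is_surj surj_f_inv_f)
  have Tc: "continuous_on UNIV T" using T(1) linear_continuous_on linear_conv_bounded_linear by blast
  have Tm: "T \<in> borel_measurable borel" using Tc by (rule borel_measurable_continuous_onI)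
  have FT: "(\<lambda>x. F (T x)) \<in> borel_measurable borel" and BT: "(\<lambda>x. B (T x)) \<in> borel_measurable borel"
    using measurable_compose[OF Tm F] measurable_compose[OF Tm B] by auto
  have "(\<integral>\<^sup>+x. F (T x) \<partial>lborel) * (\<integral>\<^sup>+x. B x \<partial>lborel) = (\<integral>\<^sup>+x. F (T x) * (\<integral>\<^sup>+y. B y \<partial>lborel) \<partial>lborel)"
    using FT by (intro nn_integral_multc[symmetric]) auto
  also have "\<dots> = (\<integral>\<^sup>+x. \<integral>\<^sup>+y. F (T x) * B (T x + y) \<partial>lborel \<partial>lborel)"
  proof (intro nn_integral_cong)
    fix x
    have "(\<lambda>y. B (T x + y)) \<in> borel_measurable borel"
      by (rule measurable_compose[OF _ B]) auto
    then show "F (T x) * (\<integral>\<^sup>+y. B y \<partial>lborel) = (\<integral>\<^sup>+y. F (T x) * B (T x + y) \<partial>lborel)"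
      by (subst nn_integral_cmult) (auto simp: nn_integral_lborel_translate[OF B])
  qed
  also have "\<dots> = (\<integral>\<^sup>+y. \<integral>\<^sup>+x. F (T x) * B (T x + y) \<partial>lborel \<partial>lborel)"
  proof (rule lborel_pair.Fubini')
    have "(\<lambda>p. F (T (snd p)) * B (T (snd p) + fst p)) \<in> borel_measurable (borel \<Otimes>\<^sub>M borel)"
      by (intro borel_measurable_times_ennreal measurable_compose[OF _ FT] measurable_compose[OF _ B]
        borel_measurable_add measurable_compose[OF _ Tm]) auto
    then show "(\<lambda>(y, x). F (T x) * B (T x + y)) \<in> borel_measurable (lborel \<Otimes>\<^sub>M lborel)"
      by (simp add: case_prod_beta' measurable_def sets_pair_measure space_pair_measure cong: measurable_cong_sets)
  qed
  also have "\<dots> = (\<integral>\<^sup>+y. \<integral>\<^sup>+x. F (T x - y) * B (T x) \<partial>lborel \<partial>lborel)"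
  proof (rule nn_integral_cong)
    fix y
    have m: "(\<lambda>x. F (T x - y) * B (T x)) \<in> borel_measurable borel"
      by (intro borel_measurable_times_ennreal BT measurable_compose[OF _ F] borel_measurable_diff Tm) auto
    have "T (S y + x) = y + T x" for x using linear_add[OF T(1)] S by simp
    then show "(\<integral>\<^sup>+x. F (T x) * B (T x + y) \<partial>lborel) = (\<integral>\<^sup>+x. F (T x - y) * B (T x) \<partial>lborel)"
      using nn_integral_lborel_translate[OF m, of "S y"] by (simp add: add.commute)
  qed
  also have "\<dots> = (\<integral>\<^sup>+x. \<integral>\<^sup>+y. F (T x - y) * B (T x) \<partial>lborel \<partial>lborel)"
  proof (rule lborel_pair.Fubini')
    have "(\<lambda>p. F (T (fst p) - snd p) * B (T (fst p))) \<in> borel_measurable (borel \<Otimes>\<^sub>M borel)"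
      by (intro borel_measurable_times_ennreal measurable_compose[OF _ BT] measurable_compose[OF _ F]
        borel_measurable_diff measurable_compose[OF _ Tm]) auto
    then show "(\<lambda>(x, y). F (T x - y) * B (T x)) \<in> borel_measurable (lborel \<Otimes>\<^sub>M lborel)"
      by (simp add: case_prod_beta' measurable_def sets_pair_measure space_pair_measure cong: measurable_cong_sets)
  qed
  also have "\<dots> = (\<integral>\<^sup>+x. (\<integral>\<^sup>+y. F y \<partial>lborel) * B (T x) \<partial>lborel)"
  proof (intro nn_integral_cong)
    fix x
    have "(\<lambda>y. F (T x - y)) \<in> borel_measurable borel"
      by (rule measurable_compose[OF _ F]) auto
    then show "(\<integral>\<^sup>+y. F (T x - y) * B (T x) \<partial>lborel) = (\<integral>\<^sup>+y. F y \<partial>lborel) * B (T x)"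
      using nn_integral_lborel_affine[OF F, of "-1" "T x"] by (simp add: nn_integral_multc)
  qed
  also have "\<dots> = (\<integral>\<^sup>+x. B (T x) \<partial>lborel) * (\<integral>\<^sup>+x. F x \<partial>lborel)"
    using BT nn_integral_cmult[of "\<lambda>x. B (T x)" lborel "integral\<^sup>N lborel F"]
    by (simp add: mult.commute)
  finally show ?thesis .
qed

lemma emeasure_unit_ball:
  "0 < emeasure lborel (ball (0::'a::euclidean_space) 1)" "emeasure lborel (ball (0::'a::euclidean_space) 1) < \<infinity>"
  by (auto simp: emeasure_ball)

lemma emeasure_lborel_open_pos:
  fixes U :: "'a::euclidean_space set"
  assumes "open U" "U \<noteq> {}"
  shows "0 < emeasure lborel U"
proof -
  obtain x r where "0 < r" "ball x r \<subseteq> U" using assms open_contains_ball by blast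
  then have "emeasure lborel (ball x r) \<le> emeasure lborel U" using assms by (intro emeasure_mono) auto
  moreover have "0 < emeasure lborel (ball x r)" using \<open>0 < r\<close> by (simp add: emeasure_ball)
  ultimately show ?thesis by simp
qed

text \<open>With the indicator of the unit ball as second function, the exchange identity leaves a
  constant factor: the volume of the preimage of the ball over that of the ball. It is positive
  because the preimage is open and nonempty, and finite because \<open>T\<close> is bounded below.
  No determinant is computed, as the factor cancels when kernel bounds are compared.\<close>

lemma nn_integral_linear_image:
  fixes T :: "'a::euclidean_space \<Rightarrow> 'a"
  assumes T: "linear T" "bij T"
  obtains \<kappa> :: real where "0 < \<kappa>"
    "\<And>F. F \<in> borel_measurable borel \<Longrightarrow> (\<integral>\<^sup>+x. F (T x) \<partial>lborel) = ennreal \<kappa> * (\<integral>\<^sup>+x. F x \<partial>lborel)"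
proof -
  let ?B = "ball (0::'a) 1"
  have Tc: "continuous_on UNIV T" using T(1) linear_continuous_on linear_conv_bounded_linear by blast
  have op: "open (T -` ?B)" using Tc open_vimage by blast
  have "0 \<in> T -` ?B" using linear_0[OF T(1)] by simp
  then have pos: "0 < emeasure lborel (T -` ?B)" using op by (intro emeasure_lborel_open_pos) auto
  have fin: "emeasure lborel (T -` ?B) < \<infinity>"
  proof -
    obtain b where b: "0 < b" "\<And>x. b * norm x \<le> norm (T x)"
      using linear_inj_bounded_below_pos[OF T(1) bij_is_inj[OF T(2)]] by blast
    have "T -` ?B \<subseteq> cball 0 (1/b)"
    proof
      fix x assume "x \<in> T -` ?B"
      then have "b * norm x \<le> 1" using b(2)[of x] by simp
      then show "x \<in> cball 0 (1/b)" using b(1) by (simp add: field_simps)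
    qed
    then have "bounded (T -` ?B)" using bounded_cball bounded_subset by blast
    then show ?thesis using emeasure_bounded_finite by blast
  qed
  define V where "V = emeasure lborel ?B"
  define \<kappa> where "\<kappa> = enn2real (emeasure lborel (T -` ?B)) / enn2real V"
  have V: "0 < V" "V < \<infinity>" using emeasure_unit_ball by (auto simp: V_def)
  have V': "V = ennreal (enn2real V)" "0 < enn2real V"
    using V by (auto simp: ennreal_enn2real_if enn2real_positive_iff)
  have T': "emeasure lborel (T -` ?B) = ennreal (enn2real (emeasure lborel (T -` ?B)))"
     "0 < enn2real (emeasure lborel (T -` ?B))"
    using pos fin by (auto simp: ennreal_enn2real_if enn2real_positive_iff)
  show ?thesis
  proof (rule that[of \<kappa>])
    show "0 < \<kappa>" using V' T' by (simp add: \<kappa>_def)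
    fix F :: "'a \<Rightarrow> ennreal" assume F: "F \<in> borel_measurable borel"
    have B: "indicator ?B \<in> borel_measurable borel" by (rule borel_measurable_indicator) simp
    have "(\<integral>\<^sup>+x. indicator ?B (T x) \<partial>lborel) = (\<integral>\<^sup>+x. indicator (T -` ?B) x \<partial>lborel)"
      by (intro nn_integral_cong) (auto simp: indicator_def)
    also have "\<dots> = emeasure lborel (T -` ?B)" using op by (intro nn_integral_indicator) auto
    finally have 1: "(\<integral>\<^sup>+x. indicator ?B (T x) \<partial>lborel) = emeasure lborel (T -` ?B)" .
    have 2: "(\<integral>\<^sup>+x. indicator ?B x \<partial>lborel) = V" unfolding V_def by (intro nn_integral_indicator) auto
    have "(\<integral>\<^sup>+x. F (T x) \<partial>lborel) * V = emeasure lborel (T -` ?B) * (\<integral>\<^sup>+x. F x \<partial>lborel)"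
      using nn_integral_linear_exchange[OF T F B] unfolding 1 2 .
    also have "emeasure lborel (T -` ?B) = ennreal (\<kappa> * enn2real V)"
      using T' V' by (simp add: \<kappa>_def)
    also have "\<dots> = ennreal \<kappa> * V"
      using V' T' by (subst ennreal_mult) (auto simp: \<kappa>_def)
    finally have "V * (\<integral>\<^sup>+x. F (T x) \<partial>lborel) = V * (ennreal \<kappa> * (\<integral>\<^sup>+x. F x \<partial>lborel))"
      by (simp add: mult_ac)
    then show "(\<integral>\<^sup>+x. F (T x) \<partial>lborel) = ennreal \<kappa> * (\<integral>\<^sup>+x. F x \<partial>lborel)"
      using V by (subst (asm) ennreal_mult_cancel_left) auto
  qed
qed

text \<open>The unit ball is invariant under \<open>c\<close>, so the exchange identity has equal
  factors on both sides.\<close>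

lemma nn_integral_rotation:
  fixes F :: "complex^'n \<Rightarrow> ennreal"
  assumes c: "cmod c = 1" and F: "F \<in> borel_measurable borel"
  shows "(\<integral>\<^sup>+x. F (c *s x) \<partial>lborel) = (\<integral>\<^sup>+x. F x \<partial>lborel)"
proof -
  have c0: "c \<noteq> 0" using c by auto
  have lin: "linear (\<lambda>x::complex^'n. c *s x)"
    using bounded_linear_smult_right by (simp add: linear_conv_bounded_linear)
  have bij: "bij (\<lambda>x::complex^'n. c *s x)"
    by (rule o_bij[of "\<lambda>x. inverse c *s x"]) (auto simp: fun_eq_iff vector_smult_assoc c0)
  let ?B = "indicator (ball 0 1) :: complex^'n \<Rightarrow> ennreal"
  have "(\<integral>\<^sup>+x. ?B (c *s x) \<partial>lborel) = (\<integral>\<^sup>+x. ?B x \<partial>lborel)"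
    by (intro nn_integral_cong) (simp add: indicator_def norm_vector_smult c)
  moreover have "(\<integral>\<^sup>+x. ?B x \<partial>lborel) = emeasure lborel (ball (0::complex^'n) 1)"
    by (intro nn_integral_indicator) auto
  ultimately have "emeasure lborel (ball (0::complex^'n) 1) * (\<integral>\<^sup>+x. F (c *s x) \<partial>lborel) =
       emeasure lborel (ball (0::complex^'n) 1) * (\<integral>\<^sup>+x. F x \<partial>lborel)"
    using nn_integral_linear_exchange[OF lin bij F borel_measurable_indicator, of "ball 0 1"]
    by (simp add: mult.commute)
  then show ?thesis
    using emeasure_unit_ball[where 'a="complex^'n"] by (subst (asm) ennreal_mult_cancel_left) auto
qed

section \<open>Circular averages and the sub-mean value property\<close>

text \<open>Cauchy's formula at the centre, parametrised over the unit interval. The form with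
  nonnegative integrals makes Tonelli's theorem available when averaging over rotations.\<close>

lemma circle_mean_bound:
  assumes g: "g holomorphic_on cball 0 1"
  shows "ennreal (cmod (g 0)) \<le> (\<integral>\<^sup>+t. indicator {0..1} t * ennreal (cmod (g (exp (2 * of_real pi * \<i> * of_real t)))) \<partial>lborel)"
proof -
  let ?e = "\<lambda>t::real. exp (2 * of_real pi * \<i> * of_real t) :: complex"
  let ?h = "\<lambda>t. g (?e t)"
  have e: "cmod (?e t) = 1" for t by (simp add: norm_exp_eq_Re)
  have "((\<lambda>u. g u / (u - 0)) has_contour_integral (2 * of_real pi * \<i> * g 0)) (circlepath 0 1)"
    by (rule Cauchy_integral_circlepath_simple[OF g]) simp
  then have "((\<lambda>t. g (circlepath 0 1 t) / (circlepath 0 1 t - 0) * vector_derivative (circlepath 0 1) (at t within {0..1}))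
      has_integral (2 * of_real pi * \<i> * g 0)) {0..1}"
    by (simp only: has_contour_integral_def)
  then have "((\<lambda>t. 2 * of_real pi * \<i> * ?h t) has_integral (2 * of_real pi * \<i> * g 0)) {0..1}"
  proof (rule has_integral_eq[rotated])
    fix t :: real assume t: "t \<in> {0..1}"
    have c: "circlepath 0 1 t = ?e t" by (simp add: circlepath)
    show "g (circlepath 0 1 t) / (circlepath 0 1 t - 0) * vector_derivative (circlepath 0 1) (at t within {0..1})
        = 2 * of_real pi * \<i> * ?h t"
      using t vector_derivative_circlepath01[of t 0 1] by (simp add: c)
  qed
  from has_integral_mult_right[OF this, of "1 / (2 * of_real pi * \<i>)"]
  have I: "(?h has_integral g 0) {0..1}" by simp
  have cont: "continuous_on {0..1} ?h"
    by (rule continuous_on_compose2[OF holomorphic_on_imp_continuous_on[OF g]])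
       (auto intro!: continuous_intros simp: e simp del: norm_exp_eq_Re)
  have si: "set_integrable lborel {0..1} ?h"
    by (rule borel_integrable_atLeastAtMost'[OF cont])
  have "(LINT t:{0..1}|lborel. ?h t) = g 0"
    using set_borel_integral_eq_integral(2)[OF si] integral_unique[OF I] by simp
  then have "ennreal (cmod (g 0)) = norm (LINT t|lborel. indicator {0..1} t *\<^sub>R ?h t)"
    by (simp add: set_lebesgue_integral_def)
  also have "\<dots> \<le> (\<integral>\<^sup>+t. norm (indicator {0..1} t *\<^sub>R ?h t) \<partial>lborel)"
    using si unfolding set_integrable_def by (rule integral_norm_bound_ennreal)
  also have "\<dots> = (\<integral>\<^sup>+t. indicator {0..1} t * ennreal (cmod (?h t)) \<partial>lborel)"
    by (intro nn_integral_cong) (auto simp: indicator_def)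
  finally show ?thesis .
qed

text \<open>Average over the circle action first: for each \<open>x\<close> in \<open>P\<close> the
  slice through \<open>z\<close> satisfies the circle bound. Integrating over \<open>P\<close>,
  exchanging the integrals and using rotation invariance removes the circle again.\<close>

lemma sub_mean_value:
  fixes f :: "complex^'n \<Rightarrow> complex"
  assumes f: "holomorphic_several f \<Omega>" and \<Omega>: "open \<Omega>" and P: "open P"
    and circ: "\<And>c x. cmod c \<le> 1 \<Longrightarrow> x \<in> P \<Longrightarrow> c *s x \<in> P"
    and sub: "\<And>x. x \<in> P \<Longrightarrow> z + x \<in> \<Omega>"
  shows "ennreal ((cmod (f z))^2) * emeasure lborel P \<le> (\<integral>\<^sup>+x. indicator \<Omega> x * ennreal ((cmod (f x))^2) \<partial>lborel)"
proof -
  let ?e = "\<lambda>t::real. exp (2 * of_real pi * \<i> * of_real t) :: complex"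
  have e: "cmod (?e t) = 1" for t by (simp add: norm_exp_eq_Re)
  define G where "G x = indicator \<Omega> x * ennreal ((cmod (f x))^2)" for x
  have G: "G \<in> borel_measurable borel"
  proof -
    have "(\<lambda>x. indicator \<Omega> x *\<^sub>R f x) \<in> borel_measurable borel"
      using \<Omega> holomorphic_several_continuous[OF f] by (intro borel_measurable_continuous_on_indicator) auto
    then have "(\<lambda>x. ennreal ((cmod (indicator \<Omega> x *\<^sub>R f x))^2)) \<in> borel_measurable borel" by measurable
    also have "(\<lambda>x. ennreal ((cmod (indicator \<Omega> x *\<^sub>R f x))^2)) = G"
      by (auto simp: G_def indicator_def)
    finally show ?thesis .
  qed
  define F where "F x = indicator P x * G (z + x)" for x
  have Gz: "(\<lambda>x. G (z + x)) \<in> borel_measurable borel"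
    by (rule measurable_compose[OF _ G]) auto
  have F: "F \<in> borel_measurable borel"
    unfolding F_def using P by (intro borel_measurable_times_ennreal Gz) auto
  have pt: "indicator P x * ennreal ((cmod (f z))^2) \<le> (\<integral>\<^sup>+t. indicator {0..1} t * F (?e t *s x) \<partial>lborel)" for x
  proof (cases "x \<in> P")
    case True
    \<comment> \<open>Squaring the slice keeps it holomorphic and makes its modulus the integrand
      wanted.\<close>
    define g where "g \<zeta> = (f (z + \<zeta> *s x))^2" for \<zeta>
    have "(g has_field_derivative 2 * f (z + \<zeta> *s x) * dir_deriv x f (z + \<zeta> *s x)) (at \<zeta>)" if "cmod \<zeta> \<le> 1" for \<zeta>
      unfolding g_def using holomorphic_several_line[OF f sub[OF circ[OF that True]]]
      by (auto intro!: derivative_eq_intros)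
    then have "g holomorphic_on cball 0 1"
      unfolding holomorphic_on_def field_differentiable_def
      by (meson has_field_derivative_at_within mem_cball_0)
    then have "ennreal (cmod (g 0)) \<le> (\<integral>\<^sup>+t. indicator {0..1} t * ennreal (cmod (g (?e t))) \<partial>lborel)"
      by (rule circle_mean_bound)
    also have "\<dots> = (\<integral>\<^sup>+t. indicator {0..1} t * F (?e t *s x) \<partial>lborel)"
    proof (intro nn_integral_cong)
      fix t
      have "?e t *s x \<in> P" using circ[OF _ True] e by simp
      then show "indicator {0..1} t * ennreal (cmod (g (?e t))) = indicator {0..1} t * F (?e t *s x)"
        using sub by (simp add: F_def G_def g_def norm_power)
    qed
    finally show ?thesis using True by (simp add: g_def norm_power)
  qed simp
  have "ennreal ((cmod (f z))^2) * emeasure lborel P = (\<integral>\<^sup>+x. ennreal ((cmod (f z))^2) * indicator P x \<partial>lborel)"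
    using P by (subst nn_integral_cmult_indicator) auto
  also have "\<dots> \<le> (\<integral>\<^sup>+x. \<integral>\<^sup>+t. indicator {0..1} t * F (?e t *s x) \<partial>lborel \<partial>lborel)"
    using pt by (intro nn_integral_mono) (simp add: mult.commute)
  also have "\<dots> = (\<integral>\<^sup>+t. \<integral>\<^sup>+x. indicator {0..1} t * F (?e t *s x) \<partial>lborel \<partial>lborel)"
  proof (rule lborel_pair.Fubini')
    have "continuous_on UNIV (\<lambda>p::real \<times> (complex^'n). ?e (fst p) *s snd p)"
      unfolding vector_scalar_mult_def by (intro continuous_intros)
    then have "(\<lambda>p::real \<times> (complex^'n). ?e (fst p) *s snd p) \<in> borel_measurable borel"
      by (rule borel_measurable_continuous_onI)
    then have m: "(\<lambda>p::real \<times> (complex^'n). ?e (fst p) *s snd p) \<in> borel_measurable (borel \<Otimes>\<^sub>M borel)"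
      by (simp add: borel_prod)
    have "(\<lambda>p::real \<times> (complex^'n). indicator {0..1} (fst p) * F (?e (fst p) *s snd p)) \<in> borel_measurable (borel \<Otimes>\<^sub>M borel)"
      by (intro borel_measurable_times_ennreal measurable_compose[OF m F]) auto
    then show "(\<lambda>(t, x). indicator {0..1} t * F (?e t *s x)) \<in> borel_measurable (lborel \<Otimes>\<^sub>M lborel)"
      by (simp add: case_prod_beta' cong: measurable_cong_sets)
  qed
  also have "\<dots> = (\<integral>\<^sup>+t. indicator {0..1::real} t * (\<integral>\<^sup>+x. F x \<partial>lborel) \<partial>lborel)"
  proof (rule nn_integral_cong)
    fix t
    have "continuous_on UNIV (\<lambda>x::complex^'n. ?e t *s x)"
      unfolding vector_scalar_mult_def by (intro continuous_intros)
    then have "(\<lambda>x. F (?e t *s x)) \<in> borel_measurable borel"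
      by (intro measurable_compose[OF _ F] borel_measurable_continuous_onI)
    then show "(\<integral>\<^sup>+x. indicator {0..1} t * F (?e t *s x) \<partial>lborel) = indicator {0..1} t * (\<integral>\<^sup>+x. F x \<partial>lborel)"
      using nn_integral_rotation[OF e F, of t] by (simp add: nn_integral_cmult)
  qed
  also have "\<dots> = (\<integral>\<^sup>+x. F x \<partial>lborel)"
    by (simp add: nn_integral_multc)
  also have "\<dots> \<le> (\<integral>\<^sup>+x. G (z + x) \<partial>lborel)"
    by (intro nn_integral_mono) (auto simp: F_def indicator_def)
  also have "\<dots> = (\<integral>\<^sup>+x. G x \<partial>lborel)" by (rule nn_integral_lborel_translate[OF G])
  finally show ?thesis by (simp add: G_def)
qed

section \<open>Integrable weights\<close>

text \<open>Dyadic shells: on the shell of index \<open>j\<close> the integrand is at most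
  \<open>2 ^ -(j * (D + 1))\<close> while the enclosing ball has volume of order
  \<open>2 ^ (j * D)\<close>, with \<open>D\<close> the real dimension. The extra power leaves a
  geometric series of ratio 1/2.\<close>

lemma nn_integral_decay:
  "(\<integral>\<^sup>+x. ennreal (1 / (1 + norm (x::'a::euclidean_space)) ^ (DIM('a) + 1)) \<partial>lborel) < \<infinity>"
proof -
  let ?D = "DIM('a)"
  let ?g = "\<lambda>j x. ennreal (1 / 2 ^ (j * (?D + 1))) * indicator (ball (0::'a) (2 ^ (j + 1))) x"
  define V where "V = unit_ball_vol (real ?D)"
  have V: "0 \<le> V" by (simp add: V_def)
  have le: "ennreal (1 / (1 + norm x) ^ (?D + 1)) \<le> (\<Sum>j. ?g j x)" for x :: 'a
  proof -
    define n where "n = (LEAST n. 1 + norm x < 2 ^ n)"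
    have ex: "\<exists>n. 1 + norm x < 2 ^ n" using real_arch_pow[of 2 "1 + norm x"] by simp
    have n1: "1 + norm x < 2 ^ n" unfolding n_def using ex by (rule LeastI_ex)
    have "n \<noteq> 0" using n1 by (intro notI) (simp add: not_less)
    then obtain j where j: "n = Suc j" using not0_implies_Suc by blast
    have "\<not> 1 + norm x < 2 ^ j" using not_less_Least[of j "\<lambda>n. 1 + norm x < 2 ^ n"] j by (simp add: n_def)
    then have lo: "2 ^ j \<le> 1 + norm x" by simp
    have "1 / (1 + norm x) ^ (?D + 1) \<le> 1 / (2 ^ j) ^ (?D + 1)"
      using lo by (intro divide_left_mono power_mono) (auto intro!: mult_pos_pos zero_less_power add_pos_nonneg)
    then have "ennreal (1 / (1 + norm x) ^ (?D + 1)) \<le> ennreal (1 / 2 ^ (j * (?D + 1)))"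
      by (intro ennreal_leI) (simp only: power_mult)
    also have "\<dots> = ?g j x" using n1 j by simp
    also have "\<dots> \<le> (\<Sum>j. ?g j x)"
    proof -
      have s: "sum h {j} = h j" for h :: "nat \<Rightarrow> ennreal" by simp
      show ?thesis using sum_le_suminf[of "\<lambda>j. ?g j x" "{j}"] unfolding s by (simp del: power_Suc)
    qed
    finally show ?thesis .
  qed
  have "(\<integral>\<^sup>+x. ennreal (1 / (1 + norm (x::'a)) ^ (?D + 1)) \<partial>lborel) \<le> (\<integral>\<^sup>+x. (\<Sum>j. ?g j x) \<partial>lborel)"
    by (intro nn_integral_mono le)
  also have "\<dots> = (\<Sum>j. \<integral>\<^sup>+x. ?g j x \<partial>lborel)"
    by (intro nn_integral_suminf borel_measurable_times_ennreal borel_measurable_const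
        borel_measurable_indicator) auto
  also have "\<dots> = (\<Sum>j. ennreal (V * 2 ^ ?D * (1/2) ^ j))"
  proof (intro suminf_cong)
    fix j
    have "(\<integral>\<^sup>+x. ?g j x \<partial>lborel) = ennreal (1 / 2 ^ (j * (?D + 1))) * ennreal (V * (2 ^ (j + 1)) ^ ?D)"
      by (subst nn_integral_cmult_indicator) (auto simp: emeasure_ball V_def)
    also have "\<dots> = ennreal (1 / 2 ^ (j * (?D + 1)) * (V * (2 ^ (j + 1)) ^ ?D))"
      using V by (intro ennreal_mult[symmetric]) auto
    also have "1 / 2 ^ (j * (?D + 1)) * (V * (2 ^ (j + 1)) ^ ?D) = V * 2 ^ ?D * (1/2) ^ j"
    proof -
      have "(2 ^ (j + 1)) ^ ?D = 2 ^ ?D * (2::real) ^ (j * ?D)"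
        by (simp only: power_mult[symmetric] power_add[symmetric]) (simp add: algebra_simps)
      moreover have "(2::real) ^ (j * (?D + 1)) = 2 ^ (j * ?D) * 2 ^ j"
        by (simp add: power_add[symmetric])
      ultimately show ?thesis by (simp add: power_one_over)
    qed
    finally show "(\<integral>\<^sup>+x. ?g j x \<partial>lborel) = ennreal (V * 2 ^ ?D * (1/2) ^ j)" .
  qed
  also have "\<dots> < \<infinity>"
  proof -
    have "(\<Sum>j. ennreal (V * 2 ^ ?D * (1/2) ^ j)) \<noteq> top"
      by (intro ennreal_suminf_neq_top summable_mult summable_geometric) (use V in auto)
    then show ?thesis by (simp add: less_top)
  qed
  finally show ?thesis .
qed

text \<open>The exponent is large enough for the weight, and for its product with a coordinate, to be
  square integrable over the product of the half planes \<open>Re w\<^sub>i < 1\<close>.\<close>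

definition halfplane_weight :: "complex^'n \<Rightarrow> complex" where
  "halfplane_weight w = (\<Prod>i\<in>UNIV. inverse (2 - w $ i)) ^ (CARD('n) + 2)"

text \<open>In the half planes each factor \<open>2 - w $ i\<close> has modulus at least 1, so their
  product \<open>q\<close> dominates every single factor and
  \<open>1 + norm w \<le> (1 + 3 n) q\<close>. The squared weight is \<open>q\<close> to the power
  \<open>-(2n+4)\<close>, and a coordinate costs a factor \<open>9 q^2\<close>; both stay below the
  rate \<open>-(2n+1)\<close>, one more than the real dimension.\<close>

lemma halfplane_weight_bound:
  fixes w :: "complex^'n"
  assumes w: "\<And>i. Re (w $ i) \<le> 1"
  shows "(cmod (halfplane_weight w))^2 \<le> 9 * (1 + 3 * real CARD('n)) ^ (2 * CARD('n) + 1) / (1 + norm w) ^ (2 * CARD('n) + 1)" (is "_ \<le> ?R")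
    and "(cmod (w $ i * halfplane_weight w))^2 \<le> 9 * (1 + 3 * real CARD('n)) ^ (2 * CARD('n) + 1) / (1 + norm w) ^ (2 * CARD('n) + 1)"
proof -
  define n where "n = CARD('n)"
  define q where "q = (\<Prod>i\<in>UNIV. cmod (2 - w $ i))"
  have one: "1 \<le> cmod (2 - w $ i)" for i
    using w[of i] abs_Re_le_cmod[of "2 - w $ i"] by simp
  have q1: "1 \<le> q" unfolding q_def by (intro prod_ge_1 one)
  have qi: "cmod (2 - w $ i) \<le> q" for i
  proof -
    have "q = cmod (2 - w $ i) * (\<Prod>i\<in>UNIV - {i}. cmod (2 - w $ i))"
      unfolding q_def by (rule prod.remove) auto
    moreover have "1 \<le> (\<Prod>i\<in>UNIV - {i}. cmod (2 - w $ i))" by (intro prod_ge_1 one)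
    ultimately show ?thesis using mult_left_mono[of 1 "\<Prod>i\<in>UNIV - {i}. cmod (2 - w $ i)" "cmod (2 - w $ i)"] by simp
  qed
  have wi: "cmod (w $ i) \<le> 3 * q" for i
  proof -
    have "cmod (w $ i) \<le> 2 + cmod (2 - w $ i)" using norm_triangle_ineq4[of 2 "2 - w $ i"] by simp
    then show ?thesis using one[of i] qi[of i] by linarith
  qed
  have "norm w \<le> (\<Sum>i\<in>UNIV. cmod (w $ i))" unfolding norm_vec_def by (rule L2_set_le_sum) simp
  also have "\<dots> \<le> (\<Sum>i\<in>(UNIV::'n set). 3 * q)" by (intro sum_mono wi)
  also have "\<dots> = 3 * real n * q" by (simp add: n_def)
  finally have nw: "1 + norm w \<le> (1 + 3 * real n) * q" using q1 by (simp add: algebra_simps)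
  have hw: "cmod (halfplane_weight w) = inverse q ^ (n + 2)"
    unfolding halfplane_weight_def q_def n_def
    by (simp only: norm_power prod_norm[symmetric] norm_inverse prod_inversef[unfolded o_def])
  have dec: "inverse q ^ (2 * n + 1) \<le> (1 + 3 * real n) ^ (2 * n + 1) / (1 + norm w) ^ (2 * n + 1)"
  proof -
    have gen: "inverse b \<le> c / a" if "0 < a" "0 < b" "a \<le> c * b" for a b c :: real
      using that by (simp add: field_simps)
    have "(1 + norm w) ^ (2 * n + 1) \<le> (1 + 3 * real n) ^ (2 * n + 1) * q ^ (2 * n + 1)"
      using power_mono[OF nw, of "2 * n + 1"] by (simp only: power_mult_distrib) simp
    moreover have "0 < (1 + norm w) ^ (2 * n + 1)" by (intro zero_less_power add_pos_nonneg) auto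
    moreover have "0 < q ^ (2 * n + 1)" using q1 by (intro zero_less_power) simp
    ultimately show ?thesis unfolding power_inverse by (rule gen[rotated 2])
  qed
  have iq: "0 < inverse q" "inverse q \<le> 1" using q1 by (auto intro: inverse_le_1_iff[THEN iffD2])
  have "(cmod (halfplane_weight w))^2 = inverse q ^ (2 * n + 4)"
    unfolding hw power_mult[symmetric] by (rule arg_cong[where f="power (inverse q)"]) simp
  also have "\<dots> \<le> inverse q ^ (2 * n + 1)" using iq by (intro power_decreasing) auto
  also have "\<dots> \<le> 9 * ((1 + 3 * real n) ^ (2 * n + 1) / (1 + norm w) ^ (2 * n + 1))"
  proof -
    have "0 \<le> (1 + 3 * real n) ^ (2 * n + 1) / (1 + norm w) ^ (2 * n + 1)"
      by (intro divide_nonneg_nonneg zero_le_power) auto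
    then show ?thesis using dec by linarith
  qed
  finally show "(cmod (halfplane_weight w))^2 \<le> ?R" by (simp add: n_def)
  have "cmod (w $ i) * inverse q ^ (n + 2) \<le> 3 * q * inverse q ^ (n + 2)"
    using wi iq by (intro mult_right_mono) auto
  also have "\<dots> = 3 * inverse q ^ (n + 1)" using q1 by simp
  finally have "(cmod (w $ i * halfplane_weight w))^2 \<le> (3 * inverse q ^ (n + 1))^2"
    unfolding norm_mult hw using iq by (intro power_mono) auto
  also have "\<dots> = 9 * inverse q ^ (2 * n + 2)"
    by (simp only: power_mult_distrib power_mult[symmetric]) (simp add: algebra_simps)
  also have "\<dots> \<le> 9 * inverse q ^ (2 * n + 1)" using iq by (intro mult_left_mono power_decreasing) auto
  also have "\<dots> \<le> 9 * ((1 + 3 * real n) ^ (2 * n + 1) / (1 + norm w) ^ (2 * n + 1))"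
    using dec by simp
  finally show "(cmod (w $ i * halfplane_weight w))^2 \<le> ?R" by (simp add: n_def)
qed

subsection \<open>Coordinates adapted to a point of a convex domain\<close>

text \<open>Bilinear, not Hermitian: the rows of a matrix then act as complex linear functionals,
  and real functionals are recovered as their real parts.\<close>

definition dotc :: "complex^'n \<Rightarrow> complex^'n \<Rightarrow> complex" where
  "dotc a z = (\<Sum>i\<in>UNIV. a $ i * z $ i)"

lemma dotc_linear: "dotc a (z + w) = dotc a z + dotc a w" "dotc a (z - w) = dotc a z - dotc a w"
  "dotc a (c *s z) = c * dotc a z" "dotc a (t *\<^sub>R z) = t *\<^sub>R dotc a z"
  "dotc (c *s a) z = c * dotc a z" "dotc 0 z = 0" "dotc (a + b) z = dotc a z + dotc b z"
  by (simp_all add: dotc_def algebra_simps sum.distrib sum_subtractf sum_distrib_left scaleR_sum_right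
      scaleR_conv_of_real[where 'a=complex])

lemma matrix_vector_dotc: "(A *v z) $ j = dotc (A $ j) z"
  by (simp add: matrix_vector_mult_def dotc_def)

lemma inner_eq_dotc: "inner u z = Re (dotc (cnjv u) z)"
  by (simp add: inner_vec_def dotc_def inner_complex_def)

lemma dotc_cnjv: "dotc a (cnjv a) = of_real ((norm a)^2)"
proof -
  have "of_real ((norm a)^2) = (\<Sum>i\<in>UNIV. complex_of_real ((cmod (a $ i))^2))"
    by (simp add: norm_vec_def L2_set_def sum_nonneg)
  also have "\<dots> = dotc a (cnjv a)"
    unfolding dotc_def cnjv_simps by (intro sum.cong refl complex_norm_square)
  finally show ?thesis by simp
qed

lemma continuous_on_dotc [continuous_intros]:
  "continuous_on S f \<Longrightarrow> continuous_on S g \<Longrightarrow> continuous_on S (\<lambda>x. dotc (f x) (g x))"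
  unfolding dotc_def by (intro continuous_intros)

text \<open>A separating hyperplane, written as the real part of a complex linear functional and
  rescaled to take the value 1 at \<open>z - z0\<close>. Rescaling is possible because
  \<open>z0\<close> is interior, which makes the separation strict there.\<close>

lemma polar_separation:
  fixes \<Omega> :: "(complex^'n) set"
  assumes \<Omega>: "open \<Omega>" "convex \<Omega>" and z0: "z0 \<in> \<Omega>" and z: "z \<notin> \<Omega>"
  obtains a where "\<And>x. x \<in> \<Omega> \<Longrightarrow> Re (dotc a (x - z0)) \<le> 1" "Re (dotc a (z - z0)) = 1"
proof -
  have "\<exists>u b. u \<noteq> 0 \<and> (\<forall>x\<in>\<Omega>. inner u x \<le> b) \<and> (\<forall>x\<in>{z}. inner u x \<ge> b)"
    using \<Omega> z0 z by (intro separating_hyperplane_sets) auto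
  then obtain u b where u: "u \<noteq> 0" and le: "\<And>x. x \<in> \<Omega> \<Longrightarrow> inner u x \<le> b" and ge: "b \<le> inner u z" by auto
  obtain r where r: "0 < r" "cball z0 r \<subseteq> \<Omega>" using \<Omega> z0 open_contains_cball by blast
  have "z0 + (r / norm u) *\<^sub>R u \<in> \<Omega>" using r u by (auto simp: dist_norm subset_iff)
  from le[OF this] have "inner u z0 + (r / norm u) * (norm u)^2 \<le> b"
    by (simp add: inner_add_right power2_norm_eq_inner)
  moreover have "0 < (r / norm u) * (norm u)^2" using r u by simp
  ultimately have lt: "inner u z0 < b" by linarith
  define s where "s = inner u (z - z0)"
  have s: "0 < s" using lt ge by (simp add: s_def inner_diff_right)
  define a where "a = complex_of_real (1 / s) *s cnjv u"
  have a: "Re (dotc a y) = inner u y / s" for y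
    by (simp add: a_def dotc_linear inner_eq_dotc)
  have "Re (dotc a (x - z0)) \<le> 1" if "x \<in> \<Omega>" for x
    using le[OF that] ge s unfolding a by (simp add: s_def inner_diff_right)
  moreover have "Re (dotc a (z - z0)) = 1" using s unfolding a by (simp add: s_def)
  ultimately show ?thesis using that by blast
qed

text \<open>The rows of \<open>A\<close> maximise \<open>|det|\<close> over the polar set of \<open>\<Omega> - z0\<close>, so by Cramer's rule every
  element of the polar set is a combination of them with coefficients of modulus at most \<open>1\<close>.\<close>

lemma exists_frame:
  fixes \<Omega> :: "(complex^'n) set"
  assumes \<Omega>: "\<Omega> \<in> convex_domains_no_line" and z0: "z0 \<in> \<Omega>"
  obtains A :: "complex^'n^'n" where "det A \<noteq> 0"
    "\<And>y. (\<Sum>j\<in>UNIV. cmod ((A *v y) $ j)) < 1 \<Longrightarrow> z0 + y \<in> \<Omega>"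
    "\<And>z j. z \<in> \<Omega> \<Longrightarrow> Re ((A *v (z - z0)) $ j) < 1"
proof -
  have op: "open \<Omega>" and cv: "convex \<Omega>"
    and nl: "\<And>a b. b \<noteq> 0 \<Longrightarrow> \<exists>\<zeta>. a + \<zeta> *s b \<notin> \<Omega>"
    using \<Omega> by (auto simp: convex_domains_no_line_def)
  define Q where "Q = {a. \<forall>x\<in>\<Omega>. Re (dotc a (x - z0)) \<le> 1}"
  obtain r where r: "0 < r" "cball z0 r \<subseteq> \<Omega>" using op z0 open_contains_cball by blast
  \<comment> \<open>A ball of radius \<open>r\<close> about \<open>z0\<close> bounds the polar set:
    a functional \<open>a\<close> is largest in the direction \<open>cnjv a\<close>.\<close>
  have Qb: "norm a \<le> 1 / r" if "a \<in> Q" for a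
  proof (cases "a = 0")
    case False
    have "z0 + (r / norm a) *\<^sub>R cnjv a \<in> \<Omega>" using r False by (auto simp: dist_norm subset_iff)
    then have "Re (dotc a ((r / norm a) *\<^sub>R cnjv a)) \<le> 1" using that by (force simp: Q_def)
    then have "(r / norm a) * (norm a)^2 \<le> 1" by (simp add: dotc_linear dotc_cnjv)
    then show ?thesis using r False by (simp add: power2_eq_square field_simps)
  qed (use r in simp)
  have Qc: "closed Q"
  proof -
    have "Q = (\<Inter>x\<in>\<Omega>. {a. Re (dotc a (x - z0)) \<le> 1})" by (auto simp: Q_def)
    also have "closed \<dots>" by (intro closed_INT ballI closed_Collect_le continuous_intros)
    finally show ?thesis .
  qed
  have Q0: "0 \<in> Q" by (simp add: Q_def dotc_linear)
  define M where "M = {A :: complex^'n^'n. \<forall>i. A $ i \<in> Q}"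
  have "closed M"
  proof -
    have "M = (\<Inter>i. (\<lambda>A. A $ i) -` Q)" by (auto simp: M_def)
    also have "closed \<dots>" by (intro closed_INT ballI closed_vimage Qc continuous_intros)
    finally show ?thesis .
  qed
  moreover have "bounded M"
  proof (rule boundedI)
    fix A assume "A \<in> M"
    have "norm A \<le> (\<Sum>i\<in>UNIV. norm (A $ i))" unfolding norm_vec_def[of A] by (rule L2_set_le_sum) simp
    also have "\<dots> \<le> (\<Sum>i\<in>(UNIV :: 'n set). 1 / r)" using \<open>A \<in> M\<close> Qb by (intro sum_mono) (auto simp: M_def)
    finally show "norm A \<le> (\<Sum>i\<in>(UNIV :: 'n set). 1 / r)" .
  qed
  ultimately have "compact M" by (simp add: compact_eq_bounded_closed)
  moreover have "M \<noteq> {}" using Q0 by (auto simp: M_def intro!: exI[of _ 0])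
  moreover have "continuous_on M (\<lambda>A. cmod (det A))" unfolding det_def by (intro continuous_intros)
  ultimately have "\<exists>A\<in>M. \<forall>B\<in>M. cmod (det B) \<le> cmod (det A)" by (rule continuous_attains_sup)
  then obtain A where A: "A \<in> M" and Amax: "\<And>B. B \<in> M \<Longrightarrow> cmod (det B) \<le> cmod (det A)" by blast
  have sep: "\<exists>a\<in>Q. Re (dotc a (z - z0)) = 1" if "z \<notin> \<Omega>" for z
    by (rule polar_separation[OF op cv z0 that]) (auto simp: Q_def)
  \<comment> \<open>The absence of complex lines enters here. A vector orthogonal to the complex
    span of \<open>Q\<close> gives, after multiplication by \<open>\<i>\<close>, a direction killed
    by all of \<open>Q\<close>; the line in that direction leaves the domain, yet the functional
    separating the exit point would vanish along it.\<close>
  have spanQ: "vec.span Q = UNIV"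
  proof (rule ccontr)
    assume ne: "vec.span Q \<noteq> UNIV"
    have sub: "subspace (vec.span Q)"
      unfolding subspace_def scaleR_eq_smult using vec.subspace_span[of Q] by (simp add: vec.subspace_def)
    have sp: "span (vec.span Q) = vec.span Q"
      by (intro subset_antisym span_minimal order_refl sub span_superset)
    have "span (vec.span Q) \<noteq> UNIV" using ne unfolding sp .
    then obtain u where u: "u \<noteq> 0" "\<And>x. x \<in> vec.span Q \<Longrightarrow> inner u x = 0"
      using span_not_UNIV_orthogonal[of "vec.span Q"] unfolding sp by auto
    have z: "dotc (cnjv u) x = 0" if x: "x \<in> vec.span Q" for x
    proof -
      have "\<i> *s x \<in> vec.span Q" using x by (rule vec.span_scale)
      from u(2)[OF this] have "Re (\<i> * dotc (cnjv u) x) = 0" unfolding inner_eq_dotc dotc_linear(3) .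
      moreover have "Re (dotc (cnjv u) x) = 0" using u(2)[OF x] by (simp add: inner_eq_dotc)
      ultimately show ?thesis by (simp add: complex_eq_iff)
    qed
    have "norm (cnjv u) \<noteq> 0" using u(1) by simp
    then have "cnjv u \<noteq> 0" by (metis norm_zero)
    then obtain \<zeta> where "z0 + \<zeta> *s cnjv u \<notin> \<Omega>" using nl by blast
    then obtain a where a: "a \<in> Q" "Re (dotc a (\<zeta> *s cnjv u)) = 1" using sep by force
    have "dotc a (cnjv u) = dotc (cnjv u) a" by (simp add: dotc_def mult.commute)
    also have "\<dots> = 0" using a(1) by (intro z vec.span_base)
    finally show False using a(2) by (simp add: dotc_linear)
  qed
  \<comment> \<open>A basis chosen inside \<open>Q\<close> supplies the rows of an invertible
    competitor, so the maximum is not zero.\<close>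
  have detA: "det A \<noteq> 0"
  proof -
    obtain B where B: "B \<subseteq> Q" "vec.independent B" "Q \<subseteq> vec.span B" "card B = vec.dim Q"
      using vec.basis_exists by blast
    have sB: "vec.span B = UNIV"
      using vec.span_mono[OF B(3)] spanQ by (simp add: vec.span_span top.extremum_unique)
    have "vec.dim Q = CARD('n)"
      using vec.dim_span[of Q] vec_dim_card[where 'a=complex and 'n='n] unfolding spanQ by (rule trans[OF sym])
    then have "card B = card (UNIV :: 'n set)" using B(4) by simp
    moreover have "finite B" using B(2) by (rule vec.finiteI_independent)
    ultimately obtain h where h: "bij_betw h (UNIV :: 'n set) B"
      using finite_same_card_bij[of "UNIV :: 'n set" B] by auto
    define C :: "complex^'n^'n" where "C = (\<chi> i. h i)"
    have "rows C = B" using h by (auto simp: rows_def row_def C_def bij_betw_def)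
    then obtain D where "D ** C = mat 1" using matrix_left_invertible_span_rows_gen[of C] sB by auto
    then have "det D * det C = 1" by (metis det_mul det_I)
    then have "det C \<noteq> 0" by auto
    moreover have "C \<in> M" using h B(1) by (auto simp: M_def C_def bij_betw_def)
    ultimately show ?thesis using Amax by fastforce
  qed
  have coords: "\<exists>c. (\<forall>j. cmod (c j) \<le> 1) \<and> (\<forall>y. dotc a y = (\<Sum>j\<in>UNIV. c j * (A *v y) $ j))" if a: "a \<in> Q" for a
  proof -
    obtain A' where A': "A' ** A = mat 1" using detA invertible_det_nz[of A] by (auto simp: invertible_def)
    define c where "c = (\<chi> i. \<Sum>j\<in>UNIV. a $ j * A' $ j $ i)"
    have rep: "(\<Sum>i\<in>UNIV. c $ i *s row i A) = a"
    proof (rule vec_eq_iff[THEN iffD2], rule allI)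
      fix l
      have "(\<Sum>i\<in>UNIV. c $ i *s row i A) $ l = (\<Sum>i\<in>UNIV. \<Sum>j\<in>UNIV. a $ j * A' $ j $ i * A $ i $ l)"
        by (simp add: c_def row_def sum_distrib_right)
      also have "\<dots> = (\<Sum>j\<in>UNIV. a $ j * (\<Sum>i\<in>UNIV. A' $ j $ i * A $ i $ l))"
        by (subst sum.swap) (simp add: sum_distrib_left mult.assoc)
      also have "\<dots> = (\<Sum>j\<in>UNIV. a $ j * (A' ** A) $ j $ l)" by (simp add: matrix_matrix_mult_def)
      also have "\<dots> = a $ l" unfolding A' by (simp add: mat_def if_distrib cong: if_cong)
      finally show "(\<Sum>i\<in>UNIV. c $ i *s row i A) $ l = a $ l" .
    qed
    have "cmod (c $ k) \<le> 1" for k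
    proof -
      \<comment> \<open>Putting \<open>a\<close> in place of row \<open>k\<close> gives another
        competitor, whose determinant is \<open>c $ k\<close> times that of
        \<open>A\<close>.\<close>
      define B where "B = (\<chi> i. if i = k then a else row i A)"
      have "B \<in> M" using a A by (auto simp: M_def B_def row_def)
      have "det B = c $ k * det A" using cramer_lemma_transpose[of k c A] unfolding rep B_def .
      then have "cmod (c $ k) * cmod (det A) \<le> 1 * cmod (det A)" using Amax[OF \<open>B \<in> M\<close>] by (simp add: norm_mult)
      then show ?thesis using detA by (subst (asm) mult_le_cancel_right_pos) auto
    qed
    moreover have "dotc a y = (\<Sum>j\<in>UNIV. c $ j * (A *v y) $ j)" for y
    proof -
      have "(\<Sum>j\<in>UNIV. c $ j * (A *v y) $ j) = (\<Sum>j\<in>UNIV. \<Sum>i\<in>UNIV. (c $ j *s row j A) $ i * y $ i)"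
        by (simp add: matrix_vector_mult_def row_def sum_distrib_left mult.assoc)
      also have "\<dots> = (\<Sum>i\<in>UNIV. (\<Sum>j\<in>UNIV. c $ j *s row j A) $ i * y $ i)"
        by (subst sum.swap) (simp add: sum_distrib_right)
      finally show ?thesis unfolding rep by (simp add: dotc_def)
    qed
    ultimately show ?thesis by (intro exI[of _ "\<lambda>j. c $ j"]) blast
  qed
  show ?thesis
  proof (rule that[OF detA])
    fix y assume y: "(\<Sum>j\<in>UNIV. cmod ((A *v y) $ j)) < 1"
    show "z0 + y \<in> \<Omega>"
    proof (rule ccontr)
      assume "z0 + y \<notin> \<Omega>"
      \<comment> \<open>If the point were outside, some element of the polar set would take real
        part 1 at \<open>y\<close>; its coefficients of modulus at most 1 bound that value by the
        \<open>l\<^sup>1\<close> norm of the coordinates.\<close>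
      then obtain a where a: "a \<in> Q" "Re (dotc a y) = 1" using sep by force
      obtain c where c: "\<And>j. cmod (c j) \<le> 1" "\<And>y. dotc a y = (\<Sum>j\<in>UNIV. c j * (A *v y) $ j)"
        using coords[OF a(1)] by blast
      have "1 \<le> cmod (dotc a y)" using a(2) complex_Re_le_cmod[of "dotc a y"] by simp
      also have "\<dots> \<le> (\<Sum>j\<in>UNIV. cmod (c j * (A *v y) $ j))" unfolding c(2) by (rule norm_sum)
      also have "\<dots> \<le> (\<Sum>j\<in>UNIV. cmod ((A *v y) $ j))"
        using c(1) by (intro sum_mono) (simp add: norm_mult mult_left_le_one_le)
      finally show False using y by simp
    qed
  next
    fix z j assume z: "z \<in> \<Omega>"
    \<comment> \<open>Strictness comes from openness: \<open>z\<close> may be pushed a little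
      further away from \<open>z0\<close>, and the weak inequality at the pushed point is strict at
      \<open>z\<close>.\<close>
    obtain e where e: "0 < e" "ball z e \<subseteq> \<Omega>" using op z open_contains_ball by blast
    have le: "Re (dotc (A $ j) (x - z0)) \<le> 1" if "x \<in> \<Omega>" for x
      using A that by (auto simp: M_def Q_def)
    define n where "n = norm (z - z0) + 1"
    have n: "0 < n" "norm (z - z0) \<le> n" by (simp_all add: n_def add_nonneg_pos)
    define t where "t = e / (2 * n)"
    have t: "0 < t" using e n by (simp add: t_def)
    have "t * norm (z - z0) \<le> t * n" using t n by simp
    also have "\<dots> = e / 2" using n by (simp add: t_def)
    finally have "z + t *\<^sub>R (z - z0) \<in> ball z e" using t e by (simp add: dist_norm)
    then have "Re (dotc (A $ j) ((z + t *\<^sub>R (z - z0)) - z0)) \<le> 1" using le e by blast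
    moreover have "(z + t *\<^sub>R (z - z0)) - z0 = (1 + t) *\<^sub>R (z - z0)" by (simp add: algebra_simps)
    ultimately have scaled: "(1 + t) * Re (dotc (A $ j) (z - z0)) \<le> 1" by (simp add: dotc_linear)
    have "Re (dotc (A $ j) (z - z0)) < 1"
    proof (rule ccontr)
      assume "\<not> Re (dotc (A $ j) (z - z0)) < 1"
      then have "(1 + t) * 1 \<le> (1 + t) * Re (dotc (A $ j) (z - z0))" using t by (intro mult_left_mono) auto
      also note scaled
      finally show False using t by simp
    qed
    then show "Re ((A *v (z - z0)) $ j) < 1" by (simp add: matrix_vector_dotc)
  qed
qed

subsection \<open>Chains of discs\<close>

text \<open>With \<open>m\<close> and \<open>n\<close> the moduli of numerator and denominator,
  \<open>n^2 = m^2 + (1 - a^2) * (1 - b^2)\<close>. The last product is at most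
  \<open>1 - (b - a)^2\<close>, and \<open>m\<close> is at least \<open>b - a\<close>, so
  \<open>((b - a) * n)^2 \<le> m^2\<close>.\<close>

lemma pseudohyperbolic_ge:
  assumes w: "cmod w1 < 1" "cmod w2 < 1"
  shows "cmod w2 - cmod w1 \<le> cmod ((w2 - w1) / (1 - cnj w1 * w2))"
proof (cases "cmod w2 \<le> cmod w1")
  case True
  then show ?thesis using norm_ge_zero[of "(w2 - w1) / (1 - cnj w1 * w2)"] by linarith
next
  case False
  define a b where "a = cmod w1" and "b = cmod w2"
  have ab: "0 \<le> a" "a < b" "b < 1" using w False by (auto simp: a_def b_def)
  have D: "0 < cmod (1 - cnj w1 * w2)"
  proof -
    have "cmod (cnj w1 * w2) < 1"
      using w mult_strict_mono'[of "cmod w1" 1 "cmod w2" 1] by (simp add: norm_mult)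
    then show ?thesis by auto
  qed
  have id: "(cmod (1 - cnj w1 * w2))^2 = (cmod (w2 - w1))^2 + (1 - a^2) * (1 - b^2)"
    unfolding a_def b_def cmod_power2 by (simp add: power2_eq_square algebra_simps)
  have up: "cmod (1 - cnj w1 * w2) \<le> 1 + a * b"
    using norm_triangle_ineq4[of 1 "cnj w1 * w2"] by (simp add: norm_mult a_def b_def)
  have ab1: "a * b < 1" using ab mult_strict_mono'[of a 1 b 1] by simp
  define m where "m = cmod (w2 - w1)"
  define n where "n = cmod (1 - cnj w1 * w2)"
  have m: "b - a \<le> m" using norm_triangle_ineq2[of w2 w1] by (simp add: a_def b_def m_def)
  have n2: "n^2 = m^2 + (1 - a^2) * (1 - b^2)" using id by (simp add: m_def n_def)
  have n0: "0 < n" "n \<le> 1 + a * b" using D up by (simp_all add: n_def)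
  have "((b - a) * n)^2 \<le> m^2"
  proof -
    have c: "(b - a)^2 + (1 - a^2) * (1 - b^2) = (1 - a * b)^2" by (simp add: power2_eq_square algebra_simps)
    have ba: "(b - a)^2 \<le> 1" using ab by (simp add: power_le_one)
    have "(b - a)^2 * ((1 - a^2) * (1 - b^2)) \<le> (1 - (b - a)^2) * (b - a)^2"
    proof -
      have "(1 - a^2) * (1 - b^2) \<le> 1 - (b - a)^2"
      proof -
        have "(1 - a * b)^2 \<le> 1" using ab ab1 by (simp add: power_le_one)
        then show ?thesis using c by linarith
      qed
      then show ?thesis by (simp only: mult.commute[of "1 - (b - a)^2"]) (intro mult_left_mono, auto)
    qed
    also have "\<dots> \<le> (1 - (b - a)^2) * m^2"
      using ab m ba by (intro mult_left_mono power_mono) auto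
    finally show ?thesis unfolding power_mult_distrib n2 by (simp add: algebra_simps)
  qed
  then have "(b - a) * n \<le> m" using power2_le_imp_le[of "(b - a) * n" m] by (simp add: m_def)
  then show ?thesis using n0 by (simp add: norm_divide a_def b_def m_def n_def pos_le_divide_eq)
qed

lemma le_artanh:
  assumes "0 \<le> x" "x < (1::real)"
  shows "x \<le> artanh x"
proof -
  let ?f = "\<lambda>x::real. ln (1 + x) - ln (1 - x) - 2 * x"
  have "?f 0 \<le> ?f x"
  proof (rule DERIV_nonneg_imp_nondecreasing[OF assms(1)])
    fix y assume y: "0 \<le> y" "y \<le> x"
    then have y1: "y < 1" using assms by simp
    have "(?f has_real_derivative (1 / (1 + y) + 1 / (1 - y) - 2)) (at y)"
      using y y1 by (auto intro!: derivative_eq_intros)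
    moreover have "0 \<le> 1 / (1 + y) + 1 / (1 - y) - 2"
    proof -
      have "1 / (1 + y) + 1 / (1 - y) - 2 = 2 * y^2 / ((1 + y) * (1 - y))"
        using y y1 by (simp add: divide_simps) (simp add: power2_eq_square algebra_simps)
      also have "\<dots> \<ge> 0" using y y1 by simp
      finally show ?thesis .
    qed
    ultimately show "\<exists>d. (?f has_real_derivative d) (at y) \<and> 0 \<le> d" by blast
  qed
  then show ?thesis using assms by (simp add: artanh_def ln_div)
qed

lemma pseudohyperbolic_lt_1:
  assumes "cmod a < 1" "cmod b < 1"
  shows "cmod ((b - a) / (1 - cnj a * b)) < 1"
  using Moebius_function_norm_lt_1[OF assms, of 0] by (simp add: Moebius_function_simple)

text \<open>Schwarz's lemma after moving \<open>a\<close> and \<open>h a\<close> to the origin by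
  Moebius maps.\<close>

lemma schwarz_pick:
  assumes h: "h holomorphic_on ball 0 1" "\<And>\<zeta>. cmod \<zeta> < 1 \<Longrightarrow> cmod (h \<zeta>) < 1"
    and a: "cmod a < 1" and b: "cmod b < 1"
  shows "cmod ((h b - h a) / (1 - cnj (h a) * h b)) \<le> cmod ((b - a) / (1 - cnj a * b))"
proof -
  define \<phi> where "\<phi> \<zeta> = Moebius_function 0 (h a) (h (Moebius_function 0 (- a) \<zeta>))" for \<zeta>
  have in1: "cmod (Moebius_function 0 (- a) \<zeta>) < 1" if "cmod \<zeta> < 1" for \<zeta>
    using Moebius_function_norm_lt_1[of "- a" \<zeta>] a that by simp
  have m1: "(\<lambda>\<zeta>. Moebius_function 0 (- a) \<zeta>) holomorphic_on ball 0 1"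
    using Moebius_function_holomorphic[of "- a" 0] a by simp
  have m2: "(\<lambda>\<zeta>. h (Moebius_function 0 (- a) \<zeta>)) holomorphic_on ball 0 1"
    by (rule holomorphic_on_compose_gen[unfolded o_def, OF m1 h(1)]) (use in1 in auto)
  have "\<phi> holomorphic_on ball 0 1"
    unfolding \<phi>_def
    by (rule holomorphic_on_compose_gen[unfolded o_def, OF m2 Moebius_function_holomorphic[OF h(2)[OF a], of 0]])
      (use in1 h(2) in auto)
  moreover have "\<phi> 0 = 0" by (simp add: \<phi>_def Moebius_function_simple)
  moreover have "cmod (\<phi> \<zeta>) < 1" if "cmod \<zeta> < 1" for \<zeta>
    unfolding \<phi>_def by (rule Moebius_function_norm_lt_1[OF h(2)[OF a] h(2)[OF in1[OF that]]])
  ultimately have S: "cmod (\<phi> \<zeta>) \<le> cmod \<zeta>" if "cmod \<zeta> < 1" for \<zeta>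
    using Schwarz_Lemma(1)[of \<phi> \<zeta>] that by blast
  define \<zeta> where "\<zeta> = Moebius_function 0 a b"
  have \<zeta>: "cmod \<zeta> < 1" unfolding \<zeta>_def by (rule Moebius_function_norm_lt_1[OF a b])
  have "Moebius_function 0 (- a) \<zeta> = b"
    unfolding \<zeta>_def by (rule Moebius_function_compose) (use a b in auto)
  then have "\<phi> \<zeta> = (h b - h a) / (1 - cnj (h a) * h b)"
    by (simp add: \<phi>_def Moebius_function_simple)
  then show ?thesis using S[OF \<zeta>] by (simp add: \<zeta>_def Moebius_function_simple)
qed

text \<open>Along each disc the modulus of \<open>\<psi>\<close> grows by at most the
  pseudohyperbolic distance, by Schwarz-Pick, and this is below the Poincare length. Moduli add up
  along the chain, so no triangle inequality for \<open>poincare_dist\<close> is called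
  upon.\<close>

lemma disc_chain_bound:
  fixes \<psi> :: "complex^'n \<Rightarrow> complex"
  assumes hol: "\<And>f. f \<in> analytic_discs \<Omega> \<Longrightarrow> (\<lambda>\<zeta>. \<psi> (f \<zeta>)) holomorphic_on ball 0 1"
    and lt: "\<And>z. z \<in> \<Omega> \<Longrightarrow> cmod (\<psi> z) < 1"
    and "disc_chain \<Omega> p q L"
  shows "cmod (\<psi> q) \<le> cmod (\<psi> p) + L"
  using assms(3)
proof (induction rule: disc_chain.induct)
  case (step p f a L b)
  define h where "h \<zeta> = \<psi> (f \<zeta>)" for \<zeta>
  have ab: "cmod a < 1" "cmod b < 1" using step by auto
  have f: "f \<zeta> \<in> \<Omega>" if "cmod \<zeta> < 1" for \<zeta> using step.hyps(2) that by (auto simp: analytic_discs_def)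
  have h1: "cmod (h \<zeta>) < 1" if "cmod \<zeta> < 1" for \<zeta> unfolding h_def by (rule lt[OF f[OF that]])
  have hh: "h holomorphic_on ball 0 1" unfolding h_def by (rule hol[OF step.hyps(2)])
  have "cmod (h b) - cmod (h a) \<le> cmod ((h b - h a) / (1 - cnj (h a) * h b))"
    by (rule pseudohyperbolic_ge[OF h1[OF ab(1)] h1[OF ab(2)]])
  also have "\<dots> \<le> cmod ((b - a) / (1 - cnj a * b))"
    by (rule schwarz_pick[OF hh h1 ab])
  also have "\<dots> = cmod ((a - b) / (1 - cnj b * a))"
  proof -
    have "cmod (1 - cnj a * b) = cmod (cnj (1 - cnj a * b))" by (rule complex_mod_cnj[symmetric])
    also have "cnj (1 - cnj a * b) = 1 - cnj b * a" by (simp add: mult.commute)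
    finally show ?thesis by (simp add: norm_divide norm_minus_commute)
  qed
  also have "\<dots> \<le> poincare_dist a b"
    unfolding poincare_dist_def by (rule le_artanh) (use pseudohyperbolic_lt_1[OF ab(2,1)] in auto)
  finally show ?case using step.IH by (simp add: h_def)
qed simp

lemma affine_disc:
  assumes "\<And>\<zeta>. cmod \<zeta> < 1 \<Longrightarrow> x + \<zeta> *s v \<in> \<Omega>"
  shows "(\<lambda>\<zeta>. x + \<zeta> *s v) \<in> analytic_discs \<Omega>"
    and "(\<chi> i. deriv (\<lambda>\<zeta>. (x + \<zeta> *s v) $ i) 0) = v"
proof -
  have "(\<lambda>\<zeta>. (x + \<zeta> *s v) $ i) holomorphic_on ball 0 1" for i
    by (simp, intro holomorphic_intros)
  then show "(\<lambda>\<zeta>. x + \<zeta> *s v) \<in> analytic_discs \<Omega>"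
    using assms by (auto simp: analytic_discs_def)
  have "((\<lambda>\<zeta>. (x + \<zeta> *s v) $ i) has_field_derivative v $ i) (at 0)" for i
    by (auto intro!: derivative_eq_intros)
  then have "deriv (\<lambda>\<zeta>. (x + \<zeta> *s v) $ i) 0 = v $ i" for i by (rule DERIV_imp_deriv)
  then show "(\<chi> i. deriv (\<lambda>\<zeta>. (x + \<zeta> *s v) $ i) 0) = v" by (simp only: vec_eq_iff vec_lambda_beta) simp
qed

text \<open>Ensures that the infimum in \<open>kobayashi_dist\<close> is over a nonempty set. The
  segment stays at a positive distance from the complement, so small affine discs can be strung
  along it.\<close>

lemma disc_chain_exists:
  fixes \<Omega> :: "(complex^'n) set"
  assumes \<Omega>: "open \<Omega>" "convex \<Omega>" and p: "p \<in> \<Omega>" and q: "q \<in> \<Omega>"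
  shows "\<exists>L. disc_chain \<Omega> p q L"
proof -
  have "closed_segment p q \<subseteq> \<Omega>" using \<Omega>(2) p q by (simp add: closed_segment_subset)
  then obtain e where e: "0 < e" "(\<Union>x\<in>closed_segment p q. ball x e) \<subseteq> \<Omega>"
    using compact_subset_open_imp_ball_epsilon_subset[OF compact_segment \<Omega>(1)] by blast
  obtain m :: nat where m: "2 * norm (q - p) / e < real m" using reals_Archimedean2 by blast
  have "0 \<le> 2 * norm (q - p) / e" using e by simp
  then have m0: "0 < real m" using m by linarith
  define h where "h = (1 / real m) *\<^sub>R (q - p)"
  have "2 * norm (q - p) / real m < e" using m m0 e by (simp add: field_simps)
  moreover have "norm (2 *\<^sub>R h) = 2 * norm (q - p) / real m" unfolding h_def norm_scaleR using m0 by simp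
  ultimately have hn: "norm (2 *\<^sub>R h) < e" by (simp only:)
  have "\<exists>L. disc_chain \<Omega> p (p + real i *\<^sub>R h) L" if "i \<le> m" for i
    using that
  proof (induction i)
    case 0
    then show ?case using disc_chain.empty[OF p] by auto
  next
    case (Suc i)
    then obtain L where L: "disc_chain \<Omega> p (p + real i *\<^sub>R h) L" by auto
    define x where "x = p + real i *\<^sub>R h"
    \<comment> \<open>The disc has derivative \<open>2 *\<^sub>R h\<close>, so the parameter 1/2
      advances by exactly one step \<open>h\<close>.\<close>
    define f where "f \<zeta> = x + \<zeta> *s (2 *\<^sub>R h)" for \<zeta>
    have "x \<in> closed_segment p q"
    proof -
      have "x = (1 - real i / real m) *\<^sub>R p + (real i / real m) *\<^sub>R q"
        by (simp add: x_def h_def algebra_simps)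
      moreover have "0 \<le> real i / real m" "real i / real m \<le> 1" using Suc.prems m0 by auto
      ultimately show ?thesis unfolding in_segment by blast
    qed
    then have ball: "ball x e \<subseteq> \<Omega>" using e by auto
    have "f \<in> analytic_discs \<Omega>"
      unfolding f_def
    proof (rule affine_disc(1))
      fix \<zeta> assume "cmod \<zeta> < 1"
      then have "cmod \<zeta> * norm (2 *\<^sub>R h) \<le> 1 * norm (2 *\<^sub>R h)" by (intro mult_right_mono) auto
      then have "norm (\<zeta> *s (2 *\<^sub>R h)) < e" using hn by (simp only: norm_vector_smult)
      then have "x + \<zeta> *s (2 *\<^sub>R h) \<in> ball x e" by (simp add: dist_norm)
      then show "x + \<zeta> *s (2 *\<^sub>R h) \<in> \<Omega>" using ball by blast
    qed
    moreover have "disc_chain \<Omega> p (f 0) L" using L by (simp add: f_def x_def)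
    moreover have "(0::complex) \<in> ball 0 1" "(1/2::complex) \<in> ball 0 1" by (simp_all add: norm_divide)
    ultimately have "disc_chain \<Omega> p (f (1/2)) (L + poincare_dist 0 (1/2))" by (intro disc_chain.step)
    moreover have "f (1/2) = p + real (Suc i) *\<^sub>R h"
    proof -
      have "(1/2::complex) *s (2 *\<^sub>R h) = h" by (simp add: scaleR_eq_smult vector_smult_assoc)
      then show ?thesis by (simp add: f_def x_def algebra_simps)
    qed
    ultimately show ?case by auto
  qed
  from this[of m] show ?thesis using m0 by (simp add: h_def)
qed

subsection \<open>The Bergman kernel\<close>

lemma of_real_cmod_sq: "(complex_of_real (cmod x))^2 = x * cnj x"
  by (metis complex_norm_square of_real_power)

lemma bergman_space_iff:
  "f \<in> bergman_space \<Omega> \<longleftrightarrow> holomorphic_several f \<Omega> \<and>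
     set_integrable lborel \<Omega> (\<lambda>z. (cmod (f z))\<^sup>2) \<and> (\<forall>z. z \<notin> \<Omega> \<longrightarrow> f z = 0)"
  by (simp add: bergman_space_def)

definition l2_norm2 :: "(complex^'n) set \<Rightarrow> (complex^'n \<Rightarrow> complex) \<Rightarrow> real" where
  "l2_norm2 \<Omega> f = set_lebesgue_integral lborel \<Omega> (\<lambda>z. (cmod (f z))\<^sup>2)"

definition l2_inner :: "(complex^'n) set \<Rightarrow> (complex^'n \<Rightarrow> complex) \<Rightarrow> (complex^'n \<Rightarrow> complex) \<Rightarrow> complex" where
  "l2_inner \<Omega> f g = set_lebesgue_integral lborel \<Omega> (\<lambda>z. f z * cnj (g z))"

locale open_domain =
  fixes \<Omega> :: "(complex^'n) set"
  assumes open_dom: "open \<Omega>"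
begin

lemma measurable_dom:
  assumes "holomorphic_several f \<Omega>"
  shows "(\<lambda>z. indicator \<Omega> z *\<^sub>R f z) \<in> borel_measurable lborel"
proof -
  have "(\<lambda>z. indicator \<Omega> z *\<^sub>R f z) \<in> borel_measurable borel"
    using open_dom holomorphic_several_continuous[OF assms]
    by (intro borel_measurable_continuous_on_indicator) auto
  then show ?thesis by simp
qed

lemma nn_l2:
  assumes "set_integrable lborel \<Omega> (\<lambda>z. (cmod (f z))\<^sup>2)"
  shows "(\<integral>\<^sup>+z. indicator \<Omega> z * ennreal ((cmod (f z))^2) \<partial>lborel) = ennreal (l2_norm2 \<Omega> f)"
proof -
  have "(\<integral>\<^sup>+z. ennreal (indicator \<Omega> z *\<^sub>R (cmod (f z))^2) \<partial>lborel) = ennreal (l2_norm2 \<Omega> f)"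
    unfolding l2_norm2_def set_lebesgue_integral_def
    using assms unfolding set_integrable_def by (intro nn_integral_eq_integral) auto
  moreover have "(\<integral>\<^sup>+z. ennreal (indicator \<Omega> z *\<^sub>R (cmod (f z))^2) \<partial>lborel) =
      (\<integral>\<^sup>+z. indicator \<Omega> z * ennreal ((cmod (f z))^2) \<partial>lborel)"
    by (intro nn_integral_cong) (simp add: indicator_def)
  ultimately show ?thesis by simp
qed

lemma l2_integrableI:
  assumes f: "holomorphic_several f \<Omega>"
    and fin: "(\<integral>\<^sup>+z. indicator \<Omega> z * ennreal ((cmod (f z))^2) \<partial>lborel) < \<infinity>"
  shows "set_integrable lborel \<Omega> (\<lambda>z. (cmod (f z))\<^sup>2)"
  unfolding set_integrable_def
proof (rule integrableI_bounded)
  have "(\<lambda>z. (cmod (indicator \<Omega> z *\<^sub>R f z))^2) \<in> borel_measurable lborel"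
    using measurable_dom[OF f] by measurable
  also have "(\<lambda>z. (cmod (indicator \<Omega> z *\<^sub>R f z))^2) = (\<lambda>z. indicator \<Omega> z *\<^sub>R (cmod (f z))\<^sup>2)"
    by (auto simp: indicator_def)
  finally show "(\<lambda>z. indicator \<Omega> z *\<^sub>R (cmod (f z))\<^sup>2) \<in> borel_measurable lborel" .
  have "(\<integral>\<^sup>+z. ennreal (norm (indicator \<Omega> z *\<^sub>R (cmod (f z))\<^sup>2)) \<partial>lborel) =
      (\<integral>\<^sup>+z. indicator \<Omega> z * ennreal ((cmod (f z))^2) \<partial>lborel)"
    by (intro nn_integral_cong) (simp add: indicator_def)
  then show "(\<integral>\<^sup>+z. ennreal (norm (indicator \<Omega> z *\<^sub>R (cmod (f z))\<^sup>2)) \<partial>lborel) < \<infinity>"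
    using fin by simp
qed

lemma l2_product_integrable:
  assumes f: "f \<in> bergman_space \<Omega>" and g: "g \<in> bergman_space \<Omega>"
  shows "set_integrable lborel \<Omega> (\<lambda>z. f z * cnj (g z))"
  unfolding set_integrable_def
proof (rule Bochner_Integration.integrable_bound)
  have fi: "set_integrable lborel \<Omega> (\<lambda>z. (cmod (f z))\<^sup>2)" "set_integrable lborel \<Omega> (\<lambda>z. (cmod (g z))\<^sup>2)"
    and h: "holomorphic_several f \<Omega>" "holomorphic_several g \<Omega>"
    using f g by (auto simp: bergman_space_iff)
  show "integrable lborel (\<lambda>z. indicator \<Omega> z *\<^sub>R ((cmod (f z))\<^sup>2 + (cmod (g z))\<^sup>2))"
    using set_integral_add(1)[OF fi] unfolding set_integrable_def .
  have "cnj \<in> borel_measurable borel" by (intro borel_measurable_continuous_onI continuous_intros)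
  then have "(\<lambda>z. (indicator \<Omega> z *\<^sub>R f z) * cnj (indicator \<Omega> z *\<^sub>R g z)) \<in> borel_measurable lborel"
    by (intro borel_measurable_times measurable_dom[OF h(1)] measurable_compose[OF measurable_dom[OF h(2)]])
  also have "(\<lambda>z. (indicator \<Omega> z *\<^sub>R f z) * cnj (indicator \<Omega> z *\<^sub>R g z)) = (\<lambda>z. indicator \<Omega> z *\<^sub>R (f z * cnj (g z)))"
    by (auto simp: indicator_def)
  finally show "(\<lambda>z. indicator \<Omega> z *\<^sub>R (f z * cnj (g z))) \<in> borel_measurable lborel" .
  have "a * b \<le> a\<^sup>2 + b\<^sup>2" for a b :: real
    using zero_le_power2[of "a - b"] zero_le_power2[of a] zero_le_power2[of b]
    unfolding power2_diff by linarith
  then have "norm (indicator \<Omega> z *\<^sub>R (f z * cnj (g z))) \<le> norm (indicator \<Omega> z *\<^sub>R ((cmod (f z))\<^sup>2 + (cmod (g z))\<^sup>2))" for z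
    by (simp add: indicator_def norm_mult)
  then show "AE z in lborel. norm (indicator \<Omega> z *\<^sub>R (f z * cnj (g z)))
      \<le> norm (indicator \<Omega> z *\<^sub>R ((cmod (f z))\<^sup>2 + (cmod (g z))\<^sup>2))" by simp
qed

lemma bergman_space_lincomb:
  assumes f: "f \<in> bergman_space \<Omega>" and g: "g \<in> bergman_space \<Omega>"
  shows "(\<lambda>z. a * f z + b * g z) \<in> bergman_space \<Omega>"
proof -
  have fi: "set_integrable lborel \<Omega> (\<lambda>z. (cmod (f z))\<^sup>2)" "set_integrable lborel \<Omega> (\<lambda>z. (cmod (g z))\<^sup>2)"
    and h: "holomorphic_several f \<Omega>" "holomorphic_several g \<Omega>" and z: "\<And>z. z \<notin> \<Omega> \<Longrightarrow> f z = 0 \<and> g z = 0"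
    using f g by (auto simp: bergman_space_iff)
  have hol: "holomorphic_several (\<lambda>z. a * f z + b * g z) \<Omega>"
    by (intro holomorphic_several_add holomorphic_several_cmult h)
  have le: "(cmod (a * u + b * v))^2 \<le> 2 * (cmod a)^2 * (cmod u)^2 + 2 * (cmod b)^2 * (cmod v)^2" for u v
  proof -
    have "(cmod (a * u + b * v))^2 \<le> (cmod a * cmod u + cmod b * cmod v)^2"
      using norm_triangle_ineq[of "a * u" "b * v"] by (intro power_mono) (auto simp: norm_mult)
    also have "\<dots> \<le> 2 * (cmod a * cmod u)^2 + 2 * (cmod b * cmod v)^2"
      using zero_le_power2[of "cmod a * cmod u - cmod b * cmod v"] unfolding power2_diff power2_sum by linarith
    finally show ?thesis by (simp add: power_mult_distrib)
  qed
  have "set_integrable lborel \<Omega> (\<lambda>z. (cmod (a * f z + b * g z))\<^sup>2)"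
    unfolding set_integrable_def
  proof (rule Bochner_Integration.integrable_bound)
    have "set_integrable lborel \<Omega> (\<lambda>z. 2 * (cmod a)^2 * (cmod (f z))\<^sup>2 + 2 * (cmod b)^2 * (cmod (g z))\<^sup>2)"
      by (intro set_integral_add set_integrable_mult_right fi)
    then show "integrable lborel (\<lambda>z. indicator \<Omega> z *\<^sub>R (2 * (cmod a)^2 * (cmod (f z))\<^sup>2 + 2 * (cmod b)^2 * (cmod (g z))\<^sup>2))"
      unfolding set_integrable_def .
    have "(\<lambda>z. (cmod (indicator \<Omega> z *\<^sub>R (a * f z + b * g z)))^2) \<in> borel_measurable lborel"
      using measurable_dom[OF hol] by measurable
    also have "(\<lambda>z. (cmod (indicator \<Omega> z *\<^sub>R (a * f z + b * g z)))^2) = (\<lambda>z. indicator \<Omega> z *\<^sub>R (cmod (a * f z + b * g z))\<^sup>2)"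
      by (auto simp: indicator_def)
    finally show "(\<lambda>z. indicator \<Omega> z *\<^sub>R (cmod (a * f z + b * g z))\<^sup>2) \<in> borel_measurable lborel" .
    show "AE z in lborel. norm (indicator \<Omega> z *\<^sub>R (cmod (a * f z + b * g z))\<^sup>2)
        \<le> norm (indicator \<Omega> z *\<^sub>R (2 * (cmod a)^2 * (cmod (f z))\<^sup>2 + 2 * (cmod b)^2 * (cmod (g z))\<^sup>2))"
      using le by (auto simp: indicator_def intro: order_trans[OF _ abs_ge_self])
  qed
  then show ?thesis using hol z by (simp add: bergman_space_iff)
qed

lemma bergman_space_cmult: "f \<in> bergman_space \<Omega> \<Longrightarrow> (\<lambda>z. a * f z) \<in> bergman_space \<Omega>"
  using bergman_space_lincomb[of f f a 0] by simp

lemma l2_inner_lincomb: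
  assumes "f \<in> bergman_space \<Omega>" "g \<in> bergman_space \<Omega>" "h \<in> bergman_space \<Omega>"
  shows "l2_inner \<Omega> (\<lambda>z. a * f z + b * g z) h = a * l2_inner \<Omega> f h + b * l2_inner \<Omega> g h"
proof -
  have "l2_inner \<Omega> (\<lambda>z. a * f z + b * g z) h =
      set_lebesgue_integral lborel \<Omega> (\<lambda>z. a * (f z * cnj (h z)) + b * (g z * cnj (h z)))"
    by (simp add: l2_inner_def algebra_simps)
  also have "\<dots> = set_lebesgue_integral lborel \<Omega> (\<lambda>z. a * (f z * cnj (h z)))
      + set_lebesgue_integral lborel \<Omega> (\<lambda>z. b * (g z * cnj (h z)))"
    by (intro set_integral_add set_integrable_mult_right l2_product_integrable assms)
  finally show ?thesis by (simp add: l2_inner_def)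
qed

lemma l2_inner_cnj: "l2_inner \<Omega> g f = cnj (l2_inner \<Omega> f g)"
proof -
  have "cnj (l2_inner \<Omega> f g) = (LINT z|lborel. cnj (indicator \<Omega> z *\<^sub>R (f z * cnj (g z))))"
    unfolding l2_inner_def set_lebesgue_integral_def
    using Bochner_Integration.integral_cnj[of lborel "\<lambda>z. indicator \<Omega> z *\<^sub>R (f z * cnj (g z))"] by (simp only:)
  also have "\<dots> = l2_inner \<Omega> g f"
    unfolding l2_inner_def set_lebesgue_integral_def
    by (intro Bochner_Integration.integral_cong) (auto simp: mult.commute)
  finally show ?thesis by simp
qed

lemma l2_inner_self: "l2_inner \<Omega> f f = of_real (l2_norm2 \<Omega> f)"
proof -
  have "l2_inner \<Omega> f f = (LINT z|lborel. complex_of_real (indicator \<Omega> z *\<^sub>R (cmod (f z))^2))"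
    unfolding l2_inner_def set_lebesgue_integral_def
    by (intro Bochner_Integration.integral_cong) (auto simp: indicator_def of_real_cmod_sq)
  then show ?thesis unfolding l2_norm2_def set_lebesgue_integral_def by (simp only: integral_complex_of_real)
qed

lemma l2_norm2_nonneg: "0 \<le> l2_norm2 \<Omega> f"
  unfolding l2_norm2_def set_lebesgue_integral_def by (intro Bochner_Integration.integral_nonneg) simp

lemma l2_norm2_lincomb:
  assumes f: "f \<in> bergman_space \<Omega>" and g: "g \<in> bergman_space \<Omega>"
  shows "l2_norm2 \<Omega> (\<lambda>z. a * f z + b * g z) =
    (cmod a)^2 * l2_norm2 \<Omega> f + (cmod b)^2 * l2_norm2 \<Omega> g + 2 * Re (a * cnj b * l2_inner \<Omega> f g)"
proof -
  let ?u = "\<lambda>z. a * f z + b * g z"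
  have u: "?u \<in> bergman_space \<Omega>" by (rule bergman_space_lincomb[OF f g])
  have fu: "l2_inner \<Omega> f ?u = cnj a * l2_inner \<Omega> f f + cnj b * l2_inner \<Omega> f g"
    unfolding l2_inner_cnj[of f ?u] l2_inner_lincomb[OF f g f] l2_inner_cnj[of g f] by simp (simp add: l2_inner_self)
  have gu: "l2_inner \<Omega> g ?u = cnj a * cnj (l2_inner \<Omega> f g) + cnj b * l2_inner \<Omega> g g"
    unfolding l2_inner_cnj[of g ?u] l2_inner_lincomb[OF f g g] by simp (simp add: l2_inner_self)
  have "complex_of_real (l2_norm2 \<Omega> ?u) = a * l2_inner \<Omega> f ?u + b * l2_inner \<Omega> g ?u"
    using l2_inner_lincomb[OF f g u, of a b] l2_inner_self[of ?u] by simp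
  also have "\<dots> = of_real ((cmod a)^2 * l2_norm2 \<Omega> f + (cmod b)^2 * l2_norm2 \<Omega> g)
     + (a * cnj b * l2_inner \<Omega> f g + cnj (a * cnj b * l2_inner \<Omega> f g))"
    unfolding fu gu l2_inner_self by (simp add: of_real_cmod_sq algebra_simps)
  finally have "Re (complex_of_real (l2_norm2 \<Omega> ?u)) = Re (of_real ((cmod a)^2 * l2_norm2 \<Omega> f + (cmod b)^2 * l2_norm2 \<Omega> g)
     + (a * cnj b * l2_inner \<Omega> f g + cnj (a * cnj b * l2_inner \<Omega> f g)))" by (rule arg_cong)
  moreover have "Re (of_real A + (X + cnj X)) = A + 2 * Re X" for A X by simp
  ultimately show ?thesis by (simp only: Re_complex_of_real)
qed

lemma point_evaluation_bound:
  assumes f: "f \<in> bergman_space \<Omega>" and P: "open P" "P \<noteq> {}" "emeasure lborel P < \<infinity>"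
    and circ: "\<And>c x. cmod c \<le> 1 \<Longrightarrow> x \<in> P \<Longrightarrow> c *s x \<in> P"
    and sub: "\<And>x. x \<in> P \<Longrightarrow> z + x \<in> \<Omega>"
  shows "(cmod (f z))^2 * measure lborel P \<le> l2_norm2 \<Omega> f"
proof -
  have "ennreal ((cmod (f z))^2) * emeasure lborel P \<le> ennreal (l2_norm2 \<Omega> f)"
    using sub_mean_value[OF _ open_dom P(1) circ sub, of f] nn_l2[of f] f by (simp add: bergman_space_iff)
  then have "ennreal ((cmod (f z))^2 * measure lborel P) \<le> ennreal (l2_norm2 \<Omega> f)"
    using P(3) by (simp add: emeasure_eq_ennreal_measure ennreal_mult)
  then show ?thesis using l2_norm2_nonneg[of f] by (simp add: ennreal_le_iff)
qed

text \<open>Turns smallness of the square-integral norm into locally uniform smallness. The constant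
  is the reciprocal volume of a ball that fits around every point of the smaller ball.\<close>

lemma local_evaluation_bound:
  assumes "z \<in> \<Omega>"
  obtains r C where "0 < r" "0 < C" "ball z r \<subseteq> \<Omega>"
    "\<And>f y. f \<in> bergman_space \<Omega> \<Longrightarrow> y \<in> ball z r \<Longrightarrow> (cmod (f y))^2 \<le> C * l2_norm2 \<Omega> f"
proof -
  obtain r where r: "0 < r" "ball z r \<subseteq> \<Omega>" using open_dom assms open_contains_ball by blast
  let ?P = "ball (0::complex^'n) (r/2)"
  define V where "V = measure lborel ?P"
  have fin: "emeasure lborel ?P < \<infinity>" by (rule emeasure_bounded_finite[OF bounded_ball])
  have "0 < emeasure lborel ?P" using r by (intro emeasure_lborel_open_pos) auto
  then have V: "0 < V" using fin unfolding V_def measure_def by (simp add: enn2real_positive_iff)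
  have "(cmod (f y))^2 \<le> 1 / V * l2_norm2 \<Omega> f" if f: "f \<in> bergman_space \<Omega>" and y: "y \<in> ball z (r/2)" for f y
  proof -
    have "(cmod (f y))^2 * V \<le> l2_norm2 \<Omega> f"
      unfolding V_def
    proof (rule point_evaluation_bound[OF f])
      fix c :: complex and x :: "complex^'n" assume c: "cmod c \<le> 1" "x \<in> ?P"
      have "cmod c * norm x \<le> 1 * norm x" using c by (intro mult_right_mono) auto
      then show "c *s x \<in> ?P" using c by (simp add: norm_vector_smult)
    next
      fix x assume "x \<in> ?P"
      then have "dist z (y + x) < r"
        using y norm_triangle_ineq4[of "z - y" x] by (simp add: dist_norm algebra_simps)
      then show "y + x \<in> \<Omega>" using r by auto
    qed (use r fin in auto)
    then show ?thesis using V by (simp add: field_simps)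
  qed
  then show ?thesis using that[of "r/2" "1 / V"] r V subset_trans[OF subset_ball r(2), of "r/2"] by simp
qed

section \<open>The extremal problem and existence of the kernel\<close>

text \<open>A minimising sequence is Cauchy by the parallelogram law, converges locally uniformly by
  the evaluation bound, and has a holomorphic limit; Fatou's lemma shows that the limit attains the
  infimum. Working with functions on points avoids completeness of a quotient space of
  classes.\<close>

lemma exists_extremal:
  assumes w: "w \<in> \<Omega>" and ex: "f0 \<in> bergman_space \<Omega>" "f0 w \<noteq> 0"
  obtains g where "g \<in> bergman_space \<Omega>" "g w = 1"
    "\<And>f. f \<in> bergman_space \<Omega> \<Longrightarrow> f w = 1 \<Longrightarrow> l2_norm2 \<Omega> g \<le> l2_norm2 \<Omega> f"
proof -
  define A where "A = {f \<in> bergman_space \<Omega>. f w = 1}"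
  have "(\<lambda>z. (1 / f0 w) * f0 z) \<in> A"
    unfolding A_def using ex(2) bergman_space_cmult[OF ex(1), of "1 / f0 w"] by simp
  then have Ane: "A \<noteq> {}" by blast
  define m where "m = Inf (l2_norm2 \<Omega> ` A)"
  have bdd: "bdd_below (l2_norm2 \<Omega> ` A)" by (rule bdd_belowI[of _ 0]) (auto simp: l2_norm2_nonneg)
  have m: "m \<le> l2_norm2 \<Omega> f" if "f \<in> A" for f
    unfolding m_def using that bdd by (intro cInf_lower) auto
  have "\<exists>f\<in>A. l2_norm2 \<Omega> f < m + 1 / real (Suc k)" for k
  proof -
    have "Inf (l2_norm2 \<Omega> ` A) < m + 1 / real (Suc k)" by (simp add: m_def)
    then show ?thesis using cInf_lessD[of "l2_norm2 \<Omega> ` A"] Ane by blast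
  qed
  then obtain F where F: "\<And>k. F k \<in> A" "\<And>k. l2_norm2 \<Omega> (F k) < m + 1 / real (Suc k)" by metis
  have FB: "F k \<in> bergman_space \<Omega>" "F k w = 1" for k using F(1) by (auto simp: A_def)
  have Fhol: "holomorphic_several (F k) \<Omega>" for k using FB by (simp add: bergman_space_iff)
  \<comment> \<open>The midpoint is again a competitor, so its squared norm is at least
    \<open>m\<close>; the parallelogram law leaves only the two excesses over \<open>m\<close>,
    doubled.\<close>
  have par: "l2_norm2 \<Omega> (\<lambda>z. F k z - F l z) \<le> 2 / real (Suc k) + 2 / real (Suc l)" for k l
  proof -
    have mid: "(\<lambda>z. (1/2) * F k z + (1/2) * F l z) \<in> A"
      unfolding A_def mem_Collect_eq by (intro conjI bergman_space_lincomb FB(1)) (simp add: FB(2))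
    have 1: "l2_norm2 \<Omega> (\<lambda>z. (1/2) * F k z + (1/2) * F l z) =
       l2_norm2 \<Omega> (F k) / 4 + l2_norm2 \<Omega> (F l) / 4 + Re (l2_inner \<Omega> (F k) (F l)) / 2"
      using l2_norm2_lincomb[OF FB(1) FB(1), of "1/2" k "1/2" l] by (simp add: power2_eq_square)
    have 2: "l2_norm2 \<Omega> (\<lambda>z. F k z - F l z) = l2_norm2 \<Omega> (F k) + l2_norm2 \<Omega> (F l) - 2 * Re (l2_inner \<Omega> (F k) (F l))"
      using l2_norm2_lincomb[OF FB(1) FB(1), of 1 k "-1" l] by simp
    have 3: "2 / real (Suc j) = 2 * (1 / real (Suc j))" for j by simp
    show ?thesis using m[OF mid] F(2)[of k] F(2)[of l] unfolding 1 2 3 by linarith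
  qed
  have bound: "(cmod (F k y - F l y))^2 \<le> C * (2 / real (Suc k) + 2 / real (Suc l))"
    if C: "0 < C" and ev: "\<And>f y. f \<in> bergman_space \<Omega> \<Longrightarrow> y \<in> S \<Longrightarrow> (cmod (f y))^2 \<le> C * l2_norm2 \<Omega> f" and y: "y \<in> S" for k l y C S
  proof -
    have d: "(\<lambda>z. F k z - F l z) \<in> bergman_space \<Omega>"
      using bergman_space_lincomb[OF FB(1)[of k] FB(1)[of l], of 1 "-1"] by simp
    have "(cmod (F k y - F l y))^2 \<le> C * l2_norm2 \<Omega> (\<lambda>z. F k z - F l z)"
      by (rule ev[OF d y])
    also have "\<dots> \<le> C * (2 / real (Suc k) + 2 / real (Suc l))"
      using par C by (intro mult_left_mono) auto
    finally show ?thesis .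
  qed
  define g where "g y = lim (\<lambda>k. F k y)" for y
  have unif: "\<exists>r>0. ball z r \<subseteq> \<Omega> \<and> uniform_limit (ball z r) F g sequentially" if z: "z \<in> \<Omega>" for z
  proof -
    obtain r C where r: "0 < r" "0 < C" "ball z r \<subseteq> \<Omega>"
      and ev: "\<And>f y. f \<in> bergman_space \<Omega> \<Longrightarrow> y \<in> ball z r \<Longrightarrow> (cmod (f y))^2 \<le> C * l2_norm2 \<Omega> f"
      by (rule local_evaluation_bound[OF z]) (rule that)
    have "uniformly_Cauchy_on (ball z r) F"
      unfolding uniformly_Cauchy_on_def
    proof (intro allI impI)
      fix e :: real assume e: "0 < e"
      obtain K where K: "4 * C / e^2 < real K" using reals_Archimedean2 by blast
      have "0 < 4 * C / e^2" using r e by simp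
      then have K0: "0 < real K" using K by linarith
      have "dist (F k y) (F l y) < e" if "y \<in> ball z r" "K \<le> k" "K \<le> l" for y k l
      proof -
        have "2 / real (Suc k) \<le> 2 / real K" "2 / real (Suc l) \<le> 2 / real K"
          using that K0 by (auto intro!: divide_left_mono mult_pos_pos)
        then have "C * (2 / real (Suc k) + 2 / real (Suc l)) \<le> C * (4 / real K)"
          using r by (intro mult_left_mono) auto
        also have "\<dots> < e^2" using K K0 e by (simp add: field_simps)
        finally have "(cmod (F k y - F l y))^2 < e^2"
          using bound[OF r(2) ev that(1), of k l] by linarith
        then show ?thesis using e by (simp add: dist_norm power2_less_imp_less)
      qed
      then show "\<exists>M. \<forall>x\<in>ball z r. \<forall>m\<ge>M. \<forall>n\<ge>M. dist (F m x) (F n x) < e" by blast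
    qed
    then have cv: "uniformly_convergent_on (ball z r) F" by (simp add: uniformly_convergent_eq_Cauchy)
    then have "uniform_limit (ball z r) F g sequentially"
      unfolding g_def by (simp add: uniformly_convergent_uniform_limit_iff)
    then show ?thesis using r by blast
  qed
  have ghol: "holomorphic_several g \<Omega>"
    by (rule holomorphic_several_limit[OF Fhol]) (rule unif)
  have lim: "(\<lambda>k. F k y) \<longlonglongrightarrow> g y" for y
  proof (cases "y \<in> \<Omega>")
    case True
    then obtain r where r: "0 < r" "uniform_limit (ball y r) F g sequentially" using unif by blast
    show ?thesis by (rule tendsto_uniform_limitI[OF r(2)]) (simp add: r(1))
  next
    case False
    then have "F k y = 0" for k using FB(1)[of k] by (simp add: bergman_space_iff)
    then show ?thesis by (simp add: g_def)
  qed
  have g0: "g y = 0" if "y \<notin> \<Omega>" for y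
  proof -
    have "F k y = 0" for k using that FB(1)[of k] by (simp add: bergman_space_iff)
    then show ?thesis by (simp add: g_def)
  qed
  have gw: "g w = 1" using LIMSEQ_unique[OF lim[of w]] by (simp add: FB(2))
  \<comment> \<open>The pointwise limit is rewritten as a lower limit so that Fatou's lemma applies;
    only an upper bound for the norm of \<open>g\<close> is required.\<close>
  have "(\<integral>\<^sup>+z. indicator \<Omega> z * ennreal ((cmod (g z))^2) \<partial>lborel) = (\<integral>\<^sup>+z. liminf (\<lambda>k. indicator \<Omega> z * ennreal ((cmod (F k z))^2)) \<partial>lborel)"
  proof (rule nn_integral_cong)
    fix z
    have "(\<lambda>k. indicator \<Omega> z * ennreal ((cmod (F k z))^2)) \<longlonglongrightarrow> indicator \<Omega> z * ennreal ((cmod (g z))^2)"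
    proof (cases "z \<in> \<Omega>")
      case True
      then show ?thesis using lim[of z] by (auto intro!: tendsto_intros)
    qed simp
    then show "indicator \<Omega> z * ennreal ((cmod (g z))^2) = liminf (\<lambda>k. indicator \<Omega> z * ennreal ((cmod (F k z))^2))"
      by (rule lim_imp_Liminf[symmetric, rotated]) simp
  qed
  also have "\<dots> \<le> liminf (\<lambda>k. \<integral>\<^sup>+z. indicator \<Omega> z * ennreal ((cmod (F k z))^2) \<partial>lborel)"
  proof (rule nn_integral_liminf)
    fix k
    have "(\<lambda>z. ennreal ((cmod (indicator \<Omega> z *\<^sub>R F k z))^2)) \<in> borel_measurable lborel"
      using measurable_dom[OF Fhol] by measurable
    also have "(\<lambda>z. ennreal ((cmod (indicator \<Omega> z *\<^sub>R F k z))^2)) = (\<lambda>z. indicator \<Omega> z * ennreal ((cmod (F k z))^2))"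
      by (auto simp: indicator_def)
    finally show "(\<lambda>z. indicator \<Omega> z * ennreal ((cmod (F k z))^2)) \<in> borel_measurable lborel" .
  qed
  also have "\<dots> = liminf (\<lambda>k. ennreal (l2_norm2 \<Omega> (F k)))"
    using nn_l2 FB(1) by (simp add: bergman_space_iff)
  also have "\<dots> = ennreal m"
  proof (rule lim_imp_Liminf)
    have "(\<lambda>k. l2_norm2 \<Omega> (F k)) \<longlonglongrightarrow> m"
    proof (rule tendsto_sandwich)
      show "\<forall>\<^sub>F k in sequentially. m \<le> l2_norm2 \<Omega> (F k)" using m F(1) by simp
      show "\<forall>\<^sub>F k in sequentially. l2_norm2 \<Omega> (F k) \<le> m + 1 / real (Suc k)"
        by (intro always_eventually allI less_imp_le F(2))
      have "(\<lambda>k. m + 1 / real (Suc k)) \<longlonglongrightarrow> m + 0"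
        using LIMSEQ_inverse_real_of_nat by (intro tendsto_add tendsto_const) (simp add: inverse_eq_divide)
      then show "(\<lambda>k. m + 1 / real (Suc k)) \<longlonglongrightarrow> m" by simp
    qed simp
    then show "(\<lambda>k. ennreal (l2_norm2 \<Omega> (F k))) \<longlonglongrightarrow> ennreal m" by (rule tendsto_ennrealI)
  qed simp
  finally have gm: "(\<integral>\<^sup>+z. indicator \<Omega> z * ennreal ((cmod (g z))^2) \<partial>lborel) \<le> ennreal m" .
  then have gi: "set_integrable lborel \<Omega> (\<lambda>z. (cmod (g z))\<^sup>2)"
    by (intro l2_integrableI[OF ghol] le_less_trans[OF gm]) simp
  have gB: "g \<in> bergman_space \<Omega>" using ghol gi g0 by (simp add: bergman_space_iff)
  have "0 \<le> m" unfolding m_def using Ane by (intro cInf_greatest) (auto simp: l2_norm2_nonneg)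
  then have "l2_norm2 \<Omega> g \<le> m" using gm nn_l2[OF gi] by (simp add: ennreal_le_iff)
  then show ?thesis
    by (intro that[OF gB gw] order_trans[OF _ m]) (simp_all add: A_def)
qed

text \<open>First variation at the minimiser. The multiple of \<open>h\<close> is aligned against
  the phase of the inner product, which makes the linear term \<open>-2 * t * (cmod a)^2\<close>;
  the choice of \<open>t\<close> keeps the quadratic term at most half as large. The summand 1 in
  \<open>t\<close> covers \<open>h\<close> of norm zero.\<close>

lemma extremal_orthogonal:
  assumes g: "g \<in> bergman_space \<Omega>" "g w = 1"
    and min: "\<And>f. f \<in> bergman_space \<Omega> \<Longrightarrow> f w = 1 \<Longrightarrow> l2_norm2 \<Omega> g \<le> l2_norm2 \<Omega> f"
    and h: "h \<in> bergman_space \<Omega>" "h w = 0"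
  shows "l2_inner \<Omega> h g = 0"
proof -
  define a where "a = l2_inner \<Omega> h g"
  define t where "t = 1 / (l2_norm2 \<Omega> h + 1)"
  have n: "0 \<le> l2_norm2 \<Omega> h" by (rule l2_norm2_nonneg)
  then have t: "0 < t" "t * l2_norm2 \<Omega> h \<le> 1" by (auto simp: t_def)
  let ?c = "- (of_real t * cnj a)"
  have "l2_norm2 \<Omega> g \<le> l2_norm2 \<Omega> (\<lambda>z. ?c * h z + 1 * g z)"
    using g h by (intro min bergman_space_lincomb) auto
  also have "\<dots> = (t * cmod a)^2 * l2_norm2 \<Omega> h + l2_norm2 \<Omega> g - 2 * t * (cmod a)^2"
  proof -
    have "Re (?c * cnj 1 * l2_inner \<Omega> h g) = - (t * (cmod a)^2)"
    proof -
      have "?c * cnj 1 * a = of_real (- (t * (cmod a)^2))" by (simp add: of_real_cmod_sq mult_ac)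
      then show ?thesis unfolding a_def[symmetric] by (simp only: Re_complex_of_real)
    qed
    moreover have "cmod ?c = t * cmod a" using t by (simp add: norm_mult)
    ultimately show ?thesis unfolding l2_norm2_lincomb[OF h(1) g(1)] by simp
  qed
  finally have "2 * t * (cmod a)^2 \<le> t * (cmod a)^2 * (t * l2_norm2 \<Omega> h)"
    by (simp add: power2_eq_square algebra_simps)
  also have "\<dots> \<le> t * (cmod a)^2 * 1" using t by (intro mult_left_mono) auto
  finally have "t * (cmod a)^2 \<le> 0" by simp
  then have "(cmod a)^2 \<le> 0" using t by (simp add: mult_le_0_iff)
  then show ?thesis by (simp add: a_def)
qed

lemma l2_zero_imp_zero:
  assumes f: "f \<in> bergman_space \<Omega>" and z: "l2_norm2 \<Omega> f = 0"
  shows "f = (\<lambda>_. 0)"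
proof
  fix y show "f y = 0"
  proof (cases "y \<in> \<Omega>")
    case True
    obtain r C where r: "0 < r" "0 < C" "ball y r \<subseteq> \<Omega>"
      and ev: "\<And>f x. f \<in> bergman_space \<Omega> \<Longrightarrow> x \<in> ball y r \<Longrightarrow> (cmod (f x))^2 \<le> C * l2_norm2 \<Omega> f"
      by (rule local_evaluation_bound[OF True]) (rule that)
    then show ?thesis using ev[OF f, of y] z by simp
  qed (use f in \<open>simp add: bergman_space_iff\<close>)
qed

text \<open>The extremal function divided by its squared norm represents evaluation at
  \<open>w\<close>, and a second representer differs from it by a function of norm zero. This unique
  existence gives the definite description in \<open>bergman_kernel\<close> its meaning;
  \<open>f0\<close> provides a competitor for the extremal problem.\<close>

lemma bergman_kernel_characterization:
  assumes w: "w \<in> \<Omega>" and ex: "f0 \<in> bergman_space \<Omega>" "f0 w \<noteq> 0"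
  shows "(\<lambda>z. bergman_kernel \<Omega> z w) \<in> bergman_space \<Omega> \<and>
    (\<forall>f\<in>bergman_space \<Omega>. f w = l2_inner \<Omega> f (\<lambda>z. bergman_kernel \<Omega> z w))"
proof -
  obtain g where g: "g \<in> bergman_space \<Omega>" "g w = 1"
    and min: "\<And>f. f \<in> bergman_space \<Omega> \<Longrightarrow> f w = 1 \<Longrightarrow> l2_norm2 \<Omega> g \<le> l2_norm2 \<Omega> f"
    by (rule exists_extremal[OF w ex]) (rule that)
  define m where "m = l2_norm2 \<Omega> g"
  have m: "m \<noteq> 0" using l2_zero_imp_zero[OF g(1)] g(2) by (auto simp: m_def)
  let ?P = "\<lambda>h. h \<in> bergman_space \<Omega> \<and> (\<forall>f\<in>bergman_space \<Omega>. f w = l2_inner \<Omega> f h)"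
  define k where "k = (\<lambda>z. of_real (1 / m) * g z)"
  have kB: "k \<in> bergman_space \<Omega>" unfolding k_def by (rule bergman_space_cmult[OF g(1)])
  have rep: "f w = l2_inner \<Omega> f k" if f: "f \<in> bergman_space \<Omega>" for f
  proof -
    \<comment> \<open>Subtracting \<open>f w\<close> times the extremal function leaves a function
      vanishing at \<open>w\<close>, hence orthogonal to it.\<close>
    let ?h = "\<lambda>z. 1 * f z + (- f w) * g z"
    have "l2_inner \<Omega> ?h g = 0"
    proof (rule extremal_orthogonal[OF g])
      show "?h \<in> bergman_space \<Omega>" by (rule bergman_space_lincomb[OF f g(1)])
    qed (use min g(2) in simp_all)
    then have "l2_inner \<Omega> f g = f w * of_real m"
      unfolding l2_inner_lincomb[OF f g(1) g(1)] l2_inner_self m_def by simp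
    moreover have "l2_inner \<Omega> k f = of_real (1 / m) * l2_inner \<Omega> g f"
      using l2_inner_lincomb[OF g(1) g(1) f, of "of_real (1 / m)" 0] by (simp add: k_def)
    then have "l2_inner \<Omega> f k = of_real (1 / m) * l2_inner \<Omega> f g"
      using l2_inner_cnj[of f k] l2_inner_cnj[of f g] by simp
    ultimately show ?thesis using m by simp
  qed
  have "\<exists>!h. ?P h"
  proof (rule ex1I[of _ k])
    show "?P k" using kB rep by blast
    fix h assume h: "?P h"
    let ?d = "\<lambda>z. 1 * h z + (-1) * k z"
    have dB: "?d \<in> bergman_space \<Omega>" using h kB by (intro bergman_space_lincomb) auto
    have "l2_inner \<Omega> ?d h = l2_inner \<Omega> ?d k" using h rep[OF dB] dB by metis
    then have "l2_inner \<Omega> h ?d = l2_inner \<Omega> k ?d" using l2_inner_cnj by metis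
    then have "l2_inner \<Omega> ?d ?d = 0" using l2_inner_lincomb[OF _ kB dB, of h 1 "-1"] h by simp
    then have "l2_norm2 \<Omega> ?d = 0" unfolding l2_inner_self by simp
    from l2_zero_imp_zero[OF dB this] show "h = k" by (auto simp: fun_eq_iff)
  qed
  from theI'[OF this] show ?thesis
    by (simp add: bergman_kernel_def l2_inner_def)
qed

end

text \<open>A domain whose Bergman space has no base points; only then is the kernel not a junk value.\<close>

locale bergman_domain = open_domain +
  assumes no_base_point: "\<And>w. w \<in> \<Omega> \<Longrightarrow> \<exists>f\<in>bergman_space \<Omega>. f w \<noteq> 0"
begin

abbreviation "k z w \<equiv> bergman_kernel \<Omega> z w"

lemma kernel_space: "w \<in> \<Omega> \<Longrightarrow> (\<lambda>z. k z w) \<in> bergman_space \<Omega>"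
  and kernel_reproducing: "w \<in> \<Omega> \<Longrightarrow> f \<in> bergman_space \<Omega> \<Longrightarrow> l2_inner \<Omega> f (\<lambda>z. k z w) = f w"
  using bergman_kernel_characterization no_base_point by (metis, metis)

lemma kernel_holomorphic: "w \<in> \<Omega> \<Longrightarrow> holomorphic_several (\<lambda>z. k z w) \<Omega>"
  using kernel_space by (simp add: bergman_space_iff)

lemma kernel_cnj:
  assumes "z \<in> \<Omega>" "w \<in> \<Omega>" shows "k z w = cnj (k w z)"
proof -
  have "k z w = l2_inner \<Omega> (\<lambda>x. k x w) (\<lambda>x. k x z)"
    using kernel_reproducing[OF assms(1) kernel_space[OF assms(2)]] by simp
  also have "\<dots> = cnj (l2_inner \<Omega> (\<lambda>x. k x z) (\<lambda>x. k x w))" by (rule l2_inner_cnj)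
  also have "l2_inner \<Omega> (\<lambda>x. k x z) (\<lambda>x. k x w) = k w z"
    by (rule kernel_reproducing[OF assms(2) kernel_space[OF assms(1)]])
  finally show ?thesis .
qed

lemma kernel_norm:
  assumes "w \<in> \<Omega>" shows "k w w = of_real (l2_norm2 \<Omega> (\<lambda>z. k z w))"
  using kernel_reproducing[OF assms kernel_space[OF assms]] by (simp add: l2_inner_self)

lemma kernel_diagonal: "w \<in> \<Omega> \<Longrightarrow> of_real (Re (k w w)) = k w w"
  and kernel_diagonal_norm: "w \<in> \<Omega> \<Longrightarrow> l2_norm2 \<Omega> (\<lambda>z. k z w) = Re (k w w)"
  by (simp_all add: kernel_norm)

lemma kernel_pos:
  assumes w: "w \<in> \<Omega>" shows "0 < Re (k w w)"
proof -
  obtain f where f: "f \<in> bergman_space \<Omega>" "f w \<noteq> 0" using no_base_point[OF w] by blast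
  have "l2_norm2 \<Omega> (\<lambda>z. k z w) \<noteq> 0"
  proof
    assume "l2_norm2 \<Omega> (\<lambda>z. k z w) = 0"
    then have "(\<lambda>z. k z w) = (\<lambda>_. 0)" by (rule l2_zero_imp_zero[OF kernel_space[OF w]])
    then have "f w = l2_inner \<Omega> f (\<lambda>_. 0)" using kernel_reproducing[OF w f(1)] by simp
    then show False using f(2) by (simp add: l2_inner_def)
  qed
  then show ?thesis using l2_norm2_nonneg[of "\<lambda>z. k z w"] by (simp add: kernel_diagonal_norm[OF w])
qed

text \<open>Cauchy-Schwarz, read off from the nonnegative squared norm of \<open>f\<close> minus its
  projection on the kernel function at \<open>w\<close>.\<close>

lemma evaluation_le_kernel:
  assumes w: "w \<in> \<Omega>" and f: "f \<in> bergman_space \<Omega>"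
  shows "(cmod (f w))^2 \<le> Re (k w w) * l2_norm2 \<Omega> f"
proof -
  define K where "K = Re (k w w)"
  have K: "0 < K" using kernel_pos[OF w] by (simp add: K_def)
  let ?c = "- (f w / of_real K)"
  have "0 \<le> l2_norm2 \<Omega> (\<lambda>z. 1 * f z + ?c * k z w)" by (rule l2_norm2_nonneg)
  also have "\<dots> = l2_norm2 \<Omega> f + (cmod (f w) / K)^2 * K + 2 * Re (cnj ?c * f w)"
    unfolding l2_norm2_lincomb[OF f kernel_space[OF w]] kernel_reproducing[OF w f]
      kernel_diagonal_norm[OF w] K_def[symmetric] using K by (simp add: norm_divide)
  also have "Re (cnj ?c * f w) = - ((cmod (f w))^2 / K)"
  proof -
    have "cnj ?c * f w = of_real (- ((cmod (f w))^2 / K))" by (simp add: of_real_cmod_sq mult_ac)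
    then show ?thesis by (simp only: Re_complex_of_real)
  qed
  also have "(cmod (f w) / K)^2 * K = (cmod (f w))^2 / K"
    using K by (simp add: power2_eq_square)
  finally show ?thesis using K by (simp add: K_def[symmetric] field_simps)
qed

lemma kernel_cauchy_schwarz:
  assumes "z \<in> \<Omega>" "w \<in> \<Omega>"
  shows "(cmod (k z w))^2 \<le> Re (k z z) * Re (k w w)"
  using evaluation_le_kernel[OF assms(1) kernel_space[OF assms(2)]] kernel_diagonal_norm[OF assms(2)] by simp

text \<open>The mean value bound is applied to the kernel function at \<open>w\<close>, whose
  squared norm equals its own value at \<open>w\<close>; one factor then cancels.\<close>

lemma kernel_upper_bound:
  assumes w: "w \<in> \<Omega>" and P: "open P" "P \<noteq> {}" "emeasure lborel P < \<infinity>"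
    and circ: "\<And>c x. cmod c \<le> 1 \<Longrightarrow> x \<in> P \<Longrightarrow> c *s x \<in> P"
    and sub: "\<And>x. x \<in> P \<Longrightarrow> w + x \<in> \<Omega>"
  shows "Re (k w w) * measure lborel P \<le> 1"
proof -
  have "(cmod (k w w))^2 * measure lborel P \<le> Re (k w w)"
    using point_evaluation_bound[OF kernel_space[OF w] P circ sub] kernel_diagonal_norm[OF w] by simp
  moreover have "cmod (k w w) = Re (k w w)"
    using kernel_diagonal[OF w] kernel_pos[OF w] by (metis norm_of_real abs_of_pos)
  ultimately have "Re (k w w) * (Re (k w w) * measure lborel P) \<le> Re (k w w) * 1"
    by (simp add: power2_eq_square mult.assoc)
  then show ?thesis using kernel_pos[OF w] by (simp only: mult_le_cancel_left_pos)
qed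

text \<open>Since \<open>f w = 0\<close>, \<open>f\<close> is orthogonal to the kernel function at
  \<open>w\<close>. The combination \<open>?u\<close> is the representer of evaluation at
  \<open>z\<close> projected on their span: its value at \<open>z\<close> and its squared norm are
  both the left-hand side.\<close>

lemma kernel_bessel:
  assumes z: "z \<in> \<Omega>" and w: "w \<in> \<Omega>" and f: "f \<in> bergman_space \<Omega>" "f w = 0" "0 < l2_norm2 \<Omega> f"
  shows "(cmod (k z w))^2 / Re (k w w) + (cmod (f z))^2 / l2_norm2 \<Omega> f \<le> Re (k z z)"
proof -
  define K F where "K = Re (k w w)" and "F = l2_norm2 \<Omega> f"
  have K: "0 < K" and F: "0 < F" using kernel_pos[OF w] f by (simp_all add: K_def F_def)
  define S where "S = (cmod (k z w))^2 / K + (cmod (f z))^2 / F"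
  define a b where "a = cnj (k z w) / of_real K" and "b = cnj (f z) / of_real F"
  let ?u = "\<lambda>x. b * f x + a * k x w"
  have S: "0 \<le> S" using K F by (simp add: S_def)
  have uB: "?u \<in> bergman_space \<Omega>" by (rule bergman_space_lincomb[OF f(1) kernel_space[OF w]])
  have "?u z = of_real S"
    using K F by (simp add: S_def a_def b_def of_real_cmod_sq mult.commute)
  moreover have "l2_norm2 \<Omega> ?u = S"
    unfolding l2_norm2_lincomb[OF f(1) kernel_space[OF w]] kernel_reproducing[OF w f(1)] f(2)
      kernel_diagonal_norm[OF w] K_def[symmetric] F_def[symmetric] using K F
    by (simp add: a_def b_def S_def norm_divide power_divide) (simp add: power2_eq_square)
  ultimately have "S * S \<le> Re (k z z) * S"
    using evaluation_le_kernel[OF z uB] S by (simp add: power2_eq_square)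
  then have "S \<le> Re (k z z)" using S kernel_pos[OF z] by (cases "S = 0") auto
  then show ?thesis by (simp add: S_def K_def F_def)
qed

end

subsection \<open>Domains with an adapted frame\<close>

definition l1_ball :: "real \<Rightarrow> (complex^'n) set" where
  "l1_ball r = {w. (\<Sum>j\<in>UNIV. cmod (w $ j)) < r}"

definition decay :: "complex^'n \<Rightarrow> real" where
  "decay w = 9 * (1 + 3 * real CARD('n)) ^ (2 * CARD('n) + 1) / (1 + norm w) ^ (2 * CARD('n) + 1)"

text \<open>The \<open>itself\<close> argument of this and the following constants makes explicit
  that they depend on the index type alone, never on the domain, the point or the frame.\<close>

definition decay_mass :: "'n::finite itself \<Rightarrow> real" where
  "decay_mass _ = enn2real (\<integral>\<^sup>+w. ennreal (decay (w::complex^'n)) \<partial>lborel)"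

text \<open>Radius 1/2, because around any point at frame distance below 1/2 from \<open>z0\<close>
  a ball of that radius still fits into the unit ball of the frame.\<close>

definition l1_volume :: "'n::finite itself \<Rightarrow> real" where
  "l1_volume _ = measure lborel (l1_ball (1/2) :: (complex^'n) set)"

definition weight_at_zero :: "'n::finite itself \<Rightarrow> real" where
  "weight_at_zero _ = (1/2) ^ (CARD('n) * (CARD('n) + 2))"

text \<open>The volume bound from above divided by the weight bound from below for the kernel at
  \<open>z0\<close>; the Jacobian of the frame appears in both and is gone from the
  quotient.\<close>

definition kernel_ratio :: "'n::finite itself \<Rightarrow> real" where
  "kernel_ratio T = decay_mass T / ((weight_at_zero T)^2 * l1_volume T)"

lemma weight_at_zero_pos: "0 < weight_at_zero T"
  by (simp add: weight_at_zero_def)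

lemma halfplane_weight_zero: "halfplane_weight (0::complex^'n) = of_real (weight_at_zero TYPE('n))"
proof -
  have "(\<Prod>i\<in>UNIV. inverse (2 - (0::complex^'n) $ i)) = (1/2) ^ CARD('n)" by (simp add: inverse_eq_divide)
  then have "halfplane_weight (0::complex^'n) = (1/2) ^ (CARD('n) * (CARD('n) + 2))"
    unfolding halfplane_weight_def by (simp only: power_mult)
  then show ?thesis by (simp add: weight_at_zero_def)
qed

lemma decay_mass: "(\<integral>\<^sup>+w. ennreal (decay (w::complex^'n)) \<partial>lborel) = ennreal (decay_mass TYPE('n))"
proof -
  define c where "c = 9 * (1 + 3 * real CARD('n)) ^ (2 * CARD('n) + 1)"
  have c: "0 \<le> c" by (simp add: c_def)
  have "(\<integral>\<^sup>+w. ennreal (decay (w::complex^'n)) \<partial>lborel) =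
     (\<integral>\<^sup>+w. ennreal c * ennreal (1 / (1 + norm (w::complex^'n)) ^ (DIM(complex^'n) + 1)) \<partial>lborel)"
  proof (rule nn_integral_cong)
    fix w :: "complex^'n"
    have "decay w = c * (1 / (1 + norm w) ^ (DIM(complex^'n) + 1))"
      by (simp add: decay_def c_def mult.commute)
    then show "ennreal (decay w) = ennreal c * ennreal (1 / (1 + norm w) ^ (DIM(complex^'n) + 1))"
      using c by (simp only: ennreal_mult')
  qed
  also have "\<dots> = ennreal c * (\<integral>\<^sup>+w. ennreal (1 / (1 + norm (w::complex^'n)) ^ (DIM(complex^'n) + 1)) \<partial>lborel)"
    by (intro nn_integral_cmult) measurable
  also have "\<dots> < \<infinity>" using nn_integral_decay[where 'a="complex^'n"] by (simp add: ennreal_mult_less_top)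
  finally show ?thesis by (simp add: decay_mass_def less_top)
qed

lemma open_l1_ball: "open (l1_ball r)"
  unfolding l1_ball_def by (intro open_Collect_less continuous_intros)

lemma emeasure_l1_ball: "emeasure lborel (l1_ball (1/2) :: (complex^'n) set) = ennreal (l1_volume TYPE('n))"
  and l1_volume_pos: "0 < l1_volume TYPE('n::finite)"
proof -
  have "bounded (l1_ball (1/2) :: (complex^'n) set)"
  proof (rule boundedI)
    fix w :: "complex^'n" assume "w \<in> l1_ball (1/2)"
    moreover have "norm w \<le> (\<Sum>j\<in>UNIV. cmod (w $ j))"
      unfolding norm_vec_def by (rule L2_set_le_sum) simp
    ultimately show "norm w \<le> 1/2" by (simp add: l1_ball_def)
  qed
  then have fin: "emeasure lborel (l1_ball (1/2) :: (complex^'n) set) < \<infinity>" by (rule emeasure_bounded_finite)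
  then show e: "emeasure lborel (l1_ball (1/2) :: (complex^'n) set) = ennreal (l1_volume TYPE('n))"
    by (simp add: l1_volume_def emeasure_eq_ennreal_measure)
  have "0 < emeasure lborel (l1_ball (1/2) :: (complex^'n) set)"
    by (rule emeasure_lborel_open_pos[OF open_l1_ball]) (auto simp: l1_ball_def intro!: exI[of _ 0])
  then show "0 < l1_volume TYPE('n)" unfolding e by simp
qed

lemma holomorphic_several_matrix: "holomorphic_several (\<lambda>z. (A *v (z - z0)) $ j) U"
proof (rule holomorphic_several_intro[where D="\<lambda>z X. (A *v X) $ j"])
  fix z
  have "bounded_linear (\<lambda>z. (A *v z) $ j)"
    unfolding linear_conv_bounded_linear[symmetric] by (simp add: linear_iff matrix_vector_dotc dotc_linear)
  from bounded_linear_imp_has_derivative[OF this]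
  have "((\<lambda>z. (A *v z) $ j) has_derivative (\<lambda>X. (A *v X) $ j)) (at (z - z0))" .
  moreover have "((\<lambda>z. z - z0) has_derivative (\<lambda>X. X)) (at z)" by (auto intro!: derivative_eq_intros)
  ultimately show "((\<lambda>z. (A *v (z - z0)) $ j) has_derivative (\<lambda>X. (A *v X) $ j)) (at z)"
    by (rule has_derivative_compose[rotated])
next
  show "\<And>c v. (A *v (c *s v)) $ j = c * (A *v v) $ j" by (simp add: matrix_vector_dotc dotc_linear)
qed

lemma dir_deriv_matrix:
  fixes A :: "complex^'n^'m"
  shows "dir_deriv X (\<lambda>z. (A *v (z - z0)) $ j) z = (A *v X) $ j"
proof -
  have "((\<lambda>t::real. (A *v (z + t *\<^sub>R X - z0)) $ j) has_vector_derivative (A *v X) $ j) (at 0)"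
  proof -
    have "(A *v (z + t *\<^sub>R X - z0)) $ j = (A *v (z - z0)) $ j + t *\<^sub>R (A *v X) $ j" for t
      by (simp add: matrix_vector_dotc dotc_linear)
    then show ?thesis by (simp, intro derivative_eq_intros) auto
  qed
  then show ?thesis by (simp add: dir_deriv_def vector_derivative_at)
qed

lemma holomorphic_several_prod:
  assumes "finite I" "\<And>i. i \<in> I \<Longrightarrow> holomorphic_several (f i) U"
  shows "holomorphic_several (\<lambda>z. \<Prod>i\<in>I. f i z) U"
  using assms by (induction I) (auto intro: holomorphic_several_const holomorphic_several_mult)

lemma holomorphic_several_power:
  "holomorphic_several f U \<Longrightarrow> holomorphic_several (\<lambda>z. f z ^ m) U"
  by (induction m) (auto intro: holomorphic_several_const holomorphic_several_mult)

lemma holomorphic_several_inverse: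
  assumes "holomorphic_several f U" "\<And>z. z \<in> U \<Longrightarrow> f z \<noteq> 0"
  shows "holomorphic_several (\<lambda>z. inverse (f z)) U"
  by (rule holomorphic_several_chain[where h=inverse, OF assms(1)]) (auto intro!: DERIV_inverse assms(2))

lemma dir_deriv_mult_zero:
  assumes "holomorphic_several f U" "holomorphic_several g U" "z \<in> U" "f z = 0"
  shows "dir_deriv X (\<lambda>z. f z * g z) z = dir_deriv X f z * g z"
  using dir_deriv_eqI[OF has_derivative_mult[OF holomorphic_several_derivative(1)[OF assms(1,3)]
    holomorphic_several_derivative(1)[OF assms(2,3)]], of X] assms(4) by simp

section \<open>The frame norm at a base point\<close>

text \<open>Fixes the data of one base point. Statements about other points of the same domain are
  obtained by interpreting the locale anew with a frame chosen there.\<close>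

locale adapted_frame =
  fixes \<Omega> :: "(complex^'n) set" and z0 :: "complex^'n" and A :: "complex^'n^'n"
  assumes dom: "\<Omega> \<in> convex_domains_no_line" and z0: "z0 \<in> \<Omega>" and detA: "det A \<noteq> 0"
    and inner_frame: "\<And>y. (\<Sum>j\<in>UNIV. cmod ((A *v y) $ j)) < 1 \<Longrightarrow> z0 + y \<in> \<Omega>"
    and outer_frame: "\<And>z j. z \<in> \<Omega> \<Longrightarrow> Re ((A *v (z - z0)) $ j) < 1"
begin

lemma dom_open: "open \<Omega>" and dom_convex: "convex \<Omega>"
  using dom by (auto simp: convex_domains_no_line_def)

definition N :: "complex^'n \<Rightarrow> real" where "N v = (\<Sum>j\<in>UNIV. cmod ((A *v v) $ j))"

lemma N_triangle: "N (v + w) \<le> N v + N w"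
  unfolding N_def sum.distrib[symmetric] matrix_vector_dotc dotc_linear
  by (intro sum_mono norm_triangle_ineq)

lemma N_scale: "N (c *s v) = cmod c * N v"
  unfolding N_def matrix_vector_dotc dotc_linear norm_mult by (rule sum_distrib_left[symmetric])

lemma N_nonneg: "0 \<le> N v" unfolding N_def by (intro sum_nonneg) simp

lemma N_zero [simp]: "N 0 = 0" using N_scale[of 0 0] by simp

lemma linear_A: "linear ((*v) A)" by (rule matrix_vector_mul_linear)

lemma bij_A: "bij ((*v) A)"
proof -
  obtain B where B: "A ** B = mat 1" "B ** A = mat 1"
    using detA invertible_det_nz[of A] by (auto simp: invertible_def)
  show ?thesis
    by (rule o_bij[of "(*v) B"]) (auto simp: fun_eq_iff matrix_vector_mul_assoc B)
qed

lemma N_eq_0: "N v = 0 \<Longrightarrow> v = 0"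
proof -
  assume "N v = 0"
  then have "A *v v = 0" unfolding N_def by (subst (asm) sum_nonneg_eq_0_iff) (auto simp: vec_eq_iff)
  then have "A *v v = A *v 0" by simp
  then show "v = 0" using bij_is_inj[OF bij_A] by (simp only: inj_eq)
qed

lemma continuous_N [continuous_intros]: "continuous_on S f \<Longrightarrow> continuous_on S (\<lambda>x. N (f x))"
  unfolding N_def matrix_vector_dotc by (intro continuous_intros)

lemma in_dom: "N (z - z0) < 1 \<Longrightarrow> z \<in> \<Omega>"
  using inner_frame[of "z - z0"] by (simp add: N_def)

subsection \<open>Comparison with the Kobayashi metric and distance\<close>

lemma analytic_disc_component:
  assumes "f \<in> analytic_discs \<Omega>"
  shows "(\<lambda>\<zeta>. (A *v (f \<zeta> - z0)) $ j) holomorphic_on ball 0 1"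
    and "f 0 = z0 \<Longrightarrow> deriv (\<lambda>\<zeta>. (A *v (f \<zeta> - z0)) $ j) 0 = (A *v (\<chi> i. deriv (\<lambda>\<zeta>. f \<zeta> $ i) 0)) $ j"
proof -
  have h: "(\<lambda>\<zeta>. f \<zeta> $ i) holomorphic_on ball 0 1" for i using assms by (auto simp: analytic_discs_def)
  have e: "(\<lambda>\<zeta>. (A *v (f \<zeta> - z0)) $ j) = (\<lambda>\<zeta>. \<Sum>i\<in>UNIV. A $ j $ i * (f \<zeta> $ i - z0 $ i))"
    by (simp add: matrix_vector_mult_def)
  show "(\<lambda>\<zeta>. (A *v (f \<zeta> - z0)) $ j) holomorphic_on ball 0 1"
    unfolding e by (intro holomorphic_intros h)
  have d: "((\<lambda>\<zeta>. f \<zeta> $ i) has_field_derivative deriv (\<lambda>\<zeta>. f \<zeta> $ i) 0) (at 0)" for i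
    by (rule holomorphic_derivI[OF h]) auto
  have "((\<lambda>\<zeta>. \<Sum>i\<in>UNIV. A $ j $ i * (f \<zeta> $ i - z0 $ i)) has_field_derivative
      (\<Sum>i\<in>UNIV. A $ j $ i * deriv (\<lambda>\<zeta>. f \<zeta> $ i) 0)) (at 0)"
    by (intro DERIV_sum) (auto intro!: derivative_eq_intros d)
  then show "deriv (\<lambda>\<zeta>. (A *v (f \<zeta> - z0)) $ j) 0 = (A *v (\<chi> i. deriv (\<lambda>\<zeta>. f \<zeta> $ i) 0)) $ j"
    unfolding e by (simp add: DERIV_imp_deriv matrix_vector_mult_def)
qed

text \<open>The Cayley transform \<open>w \<mapsto> w / (2 - w)\<close> maps the half plane \<open>Re w < 1\<close> to the unit disc.\<close>

definition cayley :: "'n \<Rightarrow> complex^'n \<Rightarrow> complex" where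
  "cayley j z = (A *v (z - z0)) $ j / (2 - (A *v (z - z0)) $ j)"

lemma cayley_lt_1:
  assumes "z \<in> \<Omega>" shows "cmod (cayley j z) < 1"
proof -
  define w where "w = (A *v (z - z0)) $ j"
  have w: "Re w < 1" unfolding w_def by (rule outer_frame[OF assms])
  then have "(cmod w)^2 < (cmod (2 - w))^2" unfolding cmod_power2 by (simp add: power2_eq_square algebra_simps)
  then have lt: "cmod w < cmod (2 - w)" by (rule power2_less_imp_less) simp
  moreover have "0 < cmod (2 - w)" using lt norm_ge_zero[of w] by linarith
  ultimately show ?thesis by (simp add: cayley_def w_def[symmetric] norm_divide)
qed

lemma two_minus_nonzero: "z \<in> \<Omega> \<Longrightarrow> 2 - (A *v (z - z0)) $ j \<noteq> 0"
  using outer_frame[of z j] by auto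

lemma cayley_disc:
  assumes "f \<in> analytic_discs \<Omega>"
  shows "(\<lambda>\<zeta>. cayley j (f \<zeta>)) holomorphic_on ball 0 1"
  unfolding cayley_def
  by (intro holomorphic_intros analytic_disc_component(1)[OF assms] two_minus_nonzero)
     (use assms in \<open>auto simp: analytic_discs_def\<close>)

lemma kobayashi_le: "kobayashi_metric \<Omega> z0 v \<le> N v"
proof -
  define S where "S = {cmod \<xi> | \<xi> f. f \<in> analytic_discs \<Omega> \<and> f 0 = z0 \<and>
                       \<xi> *s (\<chi> i. deriv (\<lambda>\<zeta>. f \<zeta> $ i) 0) = v}"
  \<comment> \<open>A vector of frame norm at most 1 on the ray of \<open>v\<close>; when
    \<open>N v = 0\<close> also \<open>v = 0\<close>, and the constant disc serves.\<close>
  define u where "u = (if N v = 0 then 0 else of_real (1 / N v) *s v)"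
  have "N u \<le> 1" by (auto simp: u_def N_scale N_nonneg norm_divide)
  have disc: "z0 + \<zeta> *s u \<in> \<Omega>" if "cmod \<zeta> < 1" for \<zeta>
  proof -
    have "cmod \<zeta> * N u \<le> cmod \<zeta>" using \<open>N u \<le> 1\<close> by (simp add: mult_left_le N_nonneg)
    then show ?thesis using that by (intro inner_frame) (simp add: N_def[symmetric] N_scale)
  qed
  have "of_real (N v) *s u = v"
    using N_eq_0[of v] by (auto simp: u_def vector_smult_assoc)
  then have "cmod (of_real (N v)) \<in> S"
    unfolding S_def using affine_disc[OF disc] by (intro CollectI exI[of _ "of_real (N v)"] exI[of _ "\<lambda>\<zeta>. z0 + \<zeta> *s u"]) simp
  then have "N v \<in> S" using N_nonneg[of v] by simp
  moreover have "bdd_below S" by (rule bdd_belowI[of _ 0]) (auto simp: S_def)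
  ultimately have "Inf S \<le> N v" by (intro cInf_lower)
  then show ?thesis by (simp add: kobayashi_metric_def S_def)
qed

text \<open>Each coordinate of a disc followed by the Cayley transform is a self-map of the unit
  disc fixing 0, so Schwarz's lemma bounds its derivative. Summing over coordinates costs the factor
  \<open>CARD('n)\<close>.\<close>

lemma N_le_kobayashi: "N v \<le> 2 * real CARD('n) * kobayashi_metric \<Omega> z0 v"
proof -
  define S where "S = {cmod \<xi> | \<xi> f. f \<in> analytic_discs \<Omega> \<and> f 0 = z0 \<and>
                       \<xi> *s (\<chi> i. deriv (\<lambda>\<zeta>. f \<zeta> $ i) 0) = v}"
  \<comment> \<open>The lower bound for the infimum requires a nonempty set. The summand 1 in
    \<open>r\<close> makes the affine disc admissible even for \<open>N v = 0\<close>.\<close>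
  have ne: "S \<noteq> {}"
  proof -
    define r where "r = 1 / (N v + 1)"
    have n: "0 < N v + 1" using N_nonneg[of v] by simp
    have disc: "z0 + \<zeta> *s (of_real r *s v) \<in> \<Omega>" if "cmod \<zeta> < 1" for \<zeta>
    proof -
      have "0 < r" using n by (simp add: r_def)
      then have "N (of_real r *s v) = r * N v" unfolding N_scale by simp
      also have "\<dots> \<le> 1" using n N_nonneg[of v] by (simp add: r_def)
      finally have "N (of_real r *s v) \<le> 1" .
      then have "cmod \<zeta> * N (of_real r *s v) \<le> cmod \<zeta>" by (simp add: mult_left_le N_nonneg)
      then have "N (\<zeta> *s (of_real r *s v)) < 1" using that unfolding N_scale[of \<zeta>] by linarith
      then show ?thesis by (intro inner_frame) (simp only: N_def)
    qed
    have "0 < r" using n by (simp add: r_def)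
    then have "complex_of_real (1 / r) * of_real r = 1" by (simp flip: of_real_mult)
    then have "of_real (1 / r) *s (of_real r *s v) = v" unfolding vector_smult_assoc by simp
    then have "cmod (of_real (1 / r)) \<in> S"
      unfolding S_def using affine_disc[OF disc] by (intro CollectI exI[of _ "of_real (1 / r)"] exI[of _ "\<lambda>\<zeta>. z0 + \<zeta> *s (of_real r *s v)"]) simp
    then show ?thesis by blast
  qed
  have "N v / (2 * real CARD('n)) \<le> x" if "x \<in> S" for x
  proof -
    obtain \<xi> f where x: "x = cmod \<xi>" and f: "f \<in> analytic_discs \<Omega>" "f 0 = z0"
      and v: "\<xi> *s (\<chi> i. deriv (\<lambda>\<zeta>. f \<zeta> $ i) 0) = v" using \<open>x \<in> S\<close> by (auto simp: S_def)
    have "cmod ((A *v v) $ j) \<le> 2 * cmod \<xi>" for j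
    proof -
      define \<psi> where "\<psi> = (\<lambda>\<zeta>. (A *v (f \<zeta> - z0)) $ j)"
      have \<psi>: "(\<psi> has_field_derivative deriv \<psi> 0) (at 0)"
        unfolding \<psi>_def by (rule holomorphic_derivI[OF analytic_disc_component(1)[OF f(1)]]) auto
      have p0: "\<psi> 0 = 0" by (simp add: \<psi>_def f(2))
      \<comment> \<open>The Cayley transform has derivative 1/2 at the origin, whence the factor
        2.\<close>
      have "((\<lambda>\<zeta>. \<psi> \<zeta> / (2 - \<psi> \<zeta>)) has_field_derivative deriv \<psi> 0 / 2) (at 0)"
        by (rule derivative_eq_intros \<psi> | simp add: p0)+
      then have d: "deriv (\<lambda>\<zeta>. cayley j (f \<zeta>)) 0 = deriv \<psi> 0 / 2"
        by (simp add: cayley_def \<psi>_def DERIV_imp_deriv)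
      have "cmod (deriv (\<lambda>\<zeta>. cayley j (f \<zeta>)) 0) \<le> 1"
      proof (rule Schwarz_Lemma(2)[OF cayley_disc[OF f(1)]])
        show "cayley j (f 0) = 0" by (simp add: f(2) cayley_def)
        show "\<And>z. cmod z < 1 \<Longrightarrow> cmod (cayley j (f z)) < 1"
          by (rule cayley_lt_1) (use f in \<open>auto simp: analytic_discs_def\<close>)
      qed (rule norm_zero[THEN ord_eq_less_trans, OF zero_less_one])
      then have "cmod (deriv \<psi> 0) \<le> 2" unfolding d by (simp add: norm_divide)
      moreover have "(A *v v) $ j = \<xi> * deriv \<psi> 0"
        unfolding \<psi>_def analytic_disc_component(2)[OF f] by (simp add: v[symmetric] matrix_vector_dotc dotc_linear)
      ultimately show ?thesis
        using mult_left_mono[of "cmod (deriv \<psi> 0)" 2 "cmod \<xi>"] by (simp add: norm_mult)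
    qed
    then have "N v \<le> (\<Sum>j\<in>(UNIV::'n set). 2 * cmod \<xi>)" unfolding N_def by (intro sum_mono)
    then show ?thesis by (simp add: x field_simps)
  qed
  then have "N v / (2 * real CARD('n)) \<le> Inf S" using ne by (intro cInf_greatest)
  then show ?thesis by (simp add: kobayashi_metric_def S_def field_simps)
qed

lemma kobayashi_nonneg: "0 \<le> kobayashi_metric \<Omega> z0 v"
proof -
  have "0 \<le> 2 * real CARD('n) * kobayashi_metric \<Omega> z0 v"
    using N_le_kobayashi[of v] N_nonneg[of v] by linarith
  then show ?thesis by (simp add: zero_le_mult_iff)
qed

lemma cayley_le_kobayashi_dist:
  assumes q: "q \<in> \<Omega>" shows "cmod (cayley j q) \<le> kobayashi_dist \<Omega> z0 q"
proof -
  have "cmod (cayley j q) \<le> L" if "disc_chain \<Omega> z0 q L" for L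
    using disc_chain_bound[where \<psi>="cayley j", OF cayley_disc cayley_lt_1 that] by (simp add: cayley_def)
  moreover have "{L. disc_chain \<Omega> z0 q L} \<noteq> {}"
    using disc_chain_exists[OF dom_open dom_convex z0 q] by blast
  ultimately show ?thesis unfolding kobayashi_dist_def by (intro cInf_greatest) auto
qed

text \<open>Inverting the Cayley transform gives
  \<open>cmod w \<le> \<kappa> * (2 + cmod w)\<close>; a distance of at most 1/2 allows the term in
  \<open>cmod w\<close> to be absorbed on the left.\<close>

lemma N_le_kobayashi_dist:
  assumes q: "q \<in> \<Omega>" and K: "kobayashi_dist \<Omega> z0 q \<le> 1/2"
  shows "N (q - z0) \<le> 4 * real CARD('n) * kobayashi_dist \<Omega> z0 q"
proof -
  define \<kappa> where "\<kappa> = kobayashi_dist \<Omega> z0 q"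
  have "cmod ((A *v (q - z0)) $ j) \<le> 4 * \<kappa>" for j
  proof -
    define w where "w = (A *v (q - z0)) $ j"
    have c: "cmod (cayley j q) \<le> \<kappa>" unfolding \<kappa>_def by (rule cayley_le_kobayashi_dist[OF q])
    then have k: "0 \<le> \<kappa>" "\<kappa> \<le> 1/2" using norm_ge_zero[of "cayley j q"] K by (linarith, simp add: \<kappa>_def)
    have "w = cayley j q * (2 - w)" using two_minus_nonzero[OF q, of j] by (simp add: cayley_def w_def)
    then have "cmod w = cmod (cayley j q) * cmod (2 - w)" by (metis norm_mult)
    also have "\<dots> \<le> \<kappa> * (2 + cmod w)"
      using c k norm_triangle_ineq4[of 2 w] by (intro mult_mono) auto
    also have "\<dots> \<le> 2 * \<kappa> + 1/2 * cmod w" using k mult_right_mono[OF k(2) norm_ge_zero[of w]] by (simp add: algebra_simps)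
    finally show ?thesis by (simp add: w_def)
  qed
  then have "N (q - z0) \<le> (\<Sum>j\<in>(UNIV::'n set). 4 * \<kappa>)" unfolding N_def by (intro sum_mono)
  then show ?thesis by (simp add: \<kappa>_def)
qed

lemma kobayashi_dist_nonneg: "q \<in> \<Omega> \<Longrightarrow> 0 \<le> kobayashi_dist \<Omega> z0 q"
  using cayley_le_kobayashi_dist norm_ge_zero order_trans by blast

subsection \<open>Bounds for the Bergman kernel\<close>

text \<open>Extended by zero, since elements of \<open>bergman_space\<close> vanish off the domain
  by convention.\<close>

definition weight :: "complex^'n \<Rightarrow> complex" where
  "weight z = (if z \<in> \<Omega> then halfplane_weight (A *v (z - z0)) else 0)"

definition linear_weight :: "'n \<Rightarrow> complex^'n \<Rightarrow> complex" where
  "linear_weight j z = (if z \<in> \<Omega> then (A *v (z - z0)) $ j * halfplane_weight (A *v (z - z0)) else 0)"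

lemma weight_holomorphic: "holomorphic_several (\<lambda>z. halfplane_weight (A *v (z - z0))) \<Omega>"
  unfolding halfplane_weight_def
  by (intro holomorphic_several_power holomorphic_several_prod holomorphic_several_inverse
    holomorphic_several_diff holomorphic_several_const holomorphic_several_matrix two_minus_nonzero finite)

text \<open>The Jacobian of the inverse of \<open>A\<close>.\<close>

definition \<kappa> :: real where
  "\<kappa> = (SOME c. 0 < c \<and> (\<forall>F\<in>borel_measurable borel.
     (\<integral>\<^sup>+x. F (A *v x) \<partial>lborel) = ennreal c * (\<integral>\<^sup>+x. F x \<partial>lborel)))"

lemma \<kappa>: "0 < \<kappa>" "F \<in> borel_measurable borel \<Longrightarrow> (\<integral>\<^sup>+x. F (A *v x) \<partial>lborel) = ennreal \<kappa> * (\<integral>\<^sup>+x. F x \<partial>lborel)"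
proof -
  obtain c where "0 < c" "\<And>F. F \<in> borel_measurable borel \<Longrightarrow>
      (\<integral>\<^sup>+x. F (A *v x) \<partial>lborel) = ennreal c * (\<integral>\<^sup>+x. F x \<partial>lborel)"
    by (rule nn_integral_linear_image[OF linear_A bij_A]) (rule that)
  then have "\<exists>c. 0 < c \<and> (\<forall>F\<in>borel_measurable borel.
     (\<integral>\<^sup>+x. F (A *v x) \<partial>lborel) = ennreal c * (\<integral>\<^sup>+x. F x \<partial>lborel))" by blast
  from someI_ex[OF this] show "0 < \<kappa>"
    "F \<in> borel_measurable borel \<Longrightarrow> (\<integral>\<^sup>+x. F (A *v x) \<partial>lborel) = ennreal \<kappa> * (\<integral>\<^sup>+x. F x \<partial>lborel)"
    unfolding \<kappa>_def[symmetric] by blast+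
qed

lemma frame_decay:
  assumes "\<And>z. z \<in> \<Omega> \<Longrightarrow> (cmod (f z))^2 \<le> decay (A *v (z - z0))"
  shows "(\<integral>\<^sup>+z. indicator \<Omega> z * ennreal ((cmod (f z))^2) \<partial>lborel) \<le> ennreal (\<kappa> * decay_mass TYPE('n))"
proof -
  have m: "(\<lambda>w. ennreal (decay (w::complex^'n))) \<in> borel_measurable borel" unfolding decay_def by measurable
  have mA: "(\<lambda>w. ennreal (decay (A *v w))) \<in> borel_measurable borel"
    by (rule measurable_compose[OF _ m])
      (intro borel_measurable_continuous_onI linear_continuous_on, use linear_A in \<open>simp add: linear_conv_bounded_linear\<close>)
  have "(\<integral>\<^sup>+z. indicator \<Omega> z * ennreal ((cmod (f z))^2) \<partial>lborel) \<le> (\<integral>\<^sup>+z. ennreal (decay (A *v (- z0 + z))) \<partial>lborel)"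
    using assms by (intro nn_integral_mono) (auto simp: indicator_def ennreal_leI)
  also have "\<dots> = (\<integral>\<^sup>+z. ennreal (decay (A *v z)) \<partial>lborel)"
    by (rule nn_integral_lborel_translate[OF mA])
  also have "\<dots> = ennreal \<kappa> * ennreal (decay_mass TYPE('n))"
    using \<kappa>(2)[OF m] by (simp add: decay_mass)
  also have "\<dots> = ennreal (\<kappa> * decay_mass TYPE('n))"
    using \<kappa>(1) by (intro ennreal_mult[symmetric]) (auto simp: decay_mass_def)
  finally show ?thesis .
qed

lemma decay_mass_nonneg: "0 \<le> decay_mass TYPE('n)" by (simp add: decay_mass_def)

sublocale open_domain \<Omega> by unfold_locales (rule dom_open)

lemma weight_space: "weight \<in> bergman_space \<Omega>" "l2_norm2 \<Omega> weight \<le> \<kappa> * decay_mass TYPE('n)"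
  and linear_weight_space: "linear_weight j \<in> bergman_space \<Omega>"
    "l2_norm2 \<Omega> (linear_weight j) \<le> \<kappa> * decay_mass TYPE('n)"
proof -
  have gen: "f \<in> bergman_space \<Omega> \<and> l2_norm2 \<Omega> f \<le> \<kappa> * decay_mass TYPE('n)"
    if hol: "holomorphic_several f \<Omega>" and off: "\<And>z. z \<notin> \<Omega> \<Longrightarrow> f z = 0"
      and le: "\<And>z. z \<in> \<Omega> \<Longrightarrow> (cmod (f z))^2 \<le> decay (A *v (z - z0))" for f
  proof -
    have fin: "(\<integral>\<^sup>+z. indicator \<Omega> z * ennreal ((cmod (f z))^2) \<partial>lborel) \<le> ennreal (\<kappa> * decay_mass TYPE('n))"
      by (rule frame_decay[OF le])
    then have int: "set_integrable lborel \<Omega> (\<lambda>z. (cmod (f z))\<^sup>2)"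
      by (intro l2_integrableI[OF hol] le_less_trans[OF fin]) simp
    have "ennreal (l2_norm2 \<Omega> f) \<le> ennreal (\<kappa> * decay_mass TYPE('n))"
      using fin unfolding nn_l2[OF int] .
    then have "l2_norm2 \<Omega> f \<le> \<kappa> * decay_mass TYPE('n)"
      using \<kappa>(1) decay_mass_nonneg by (subst (asm) ennreal_le_iff) auto
    then show ?thesis using hol off int by (simp add: bergman_space_iff)
  qed
  have outer: "\<And>i. z \<in> \<Omega> \<Longrightarrow> Re ((A *v (z - z0)) $ i) \<le> 1" for z using outer_frame less_imp_le by blast
  have "holomorphic_several weight \<Omega>"
    by (rule holomorphic_several_cong[OF weight_holomorphic dom_open]) (simp add: weight_def)
  moreover have "(cmod (weight z))^2 \<le> decay (A *v (z - z0))" if "z \<in> \<Omega>" for z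
    using halfplane_weight_bound(1)[OF outer[OF that]] that by (simp add: weight_def decay_def)
  ultimately show "weight \<in> bergman_space \<Omega>" "l2_norm2 \<Omega> weight \<le> \<kappa> * decay_mass TYPE('n)"
    using gen[of weight] by (auto simp: weight_def)
  have "holomorphic_several (linear_weight j) \<Omega>"
    by (rule holomorphic_several_cong[OF holomorphic_several_mult[OF holomorphic_several_matrix[of A z0 j] weight_holomorphic] dom_open])
      (simp add: linear_weight_def)
  moreover have "(cmod (linear_weight j z))^2 \<le> decay (A *v (z - z0))" if "z \<in> \<Omega>" for z
    using halfplane_weight_bound(2)[OF outer[OF that]] that by (simp add: linear_weight_def decay_def)
  ultimately show "linear_weight j \<in> bergman_space \<Omega>"
    "l2_norm2 \<Omega> (linear_weight j) \<le> \<kappa> * decay_mass TYPE('n)"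
    using gen[of "linear_weight j"] by (auto simp: linear_weight_def)
qed

lemma weight_z0: "weight z0 = of_real (weight_at_zero TYPE('n))"
  using z0 by (simp add: weight_def halfplane_weight_zero)

lemma linear_weight_z0: "linear_weight j z0 = 0"
  "dir_deriv X (linear_weight j) z0 = (A *v X) $ j * of_real (weight_at_zero TYPE('n))"
proof -
  show "linear_weight j z0 = 0" by (simp add: linear_weight_def)
  have "dir_deriv X (linear_weight j) z0 =
      dir_deriv X (\<lambda>z. (A *v (z - z0)) $ j * halfplane_weight (A *v (z - z0))) z0"
    by (rule dir_deriv_cong[OF dom_open z0]) (simp add: linear_weight_def)
  also have "\<dots> = dir_deriv X (\<lambda>z. (A *v (z - z0)) $ j) z0 * halfplane_weight (A *v (z0 - z0))"
    by (rule dir_deriv_mult_zero[OF holomorphic_several_matrix weight_holomorphic z0]) simp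
  finally show "dir_deriv X (linear_weight j) z0 = (A *v X) $ j * of_real (weight_at_zero TYPE('n))"
    by (simp add: dir_deriv_matrix halfplane_weight_zero)
qed

lemma frame_volume: "measure lborel {v. N v < 1/2} = \<kappa> * l1_volume TYPE('n)"
  "emeasure lborel {v. N v < 1/2} < \<infinity>"
proof -
  have "emeasure lborel {v. N v < 1/2} = (\<integral>\<^sup>+v. indicator {v. N v < 1/2} v \<partial>lborel)"
    by (intro nn_integral_indicator[symmetric]) (simp, intro borel_open open_Collect_less continuous_intros)
  also have "\<dots> = (\<integral>\<^sup>+v. indicator (l1_ball (1/2)) (A *v v) \<partial>lborel)"
    by (intro nn_integral_cong) (simp add: indicator_def l1_ball_def N_def)
  also have "\<dots> = ennreal \<kappa> * (\<integral>\<^sup>+v. indicator (l1_ball (1/2) :: (complex^'n) set) v \<partial>lborel)"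
    by (rule \<kappa>(2)) (intro borel_measurable_indicator borel_open open_l1_ball)
  also have "(\<integral>\<^sup>+v. indicator (l1_ball (1/2) :: (complex^'n) set) v \<partial>lborel) = ennreal (l1_volume TYPE('n))"
    unfolding emeasure_l1_ball[symmetric] by (intro nn_integral_indicator) (simp add: borel_open open_l1_ball)
  finally have "emeasure lborel {v. N v < 1/2} = ennreal (\<kappa> * l1_volume TYPE('n))"
    using \<kappa>(1) l1_volume_pos[where 'n='n] by (simp add: ennreal_mult)
  then show "measure lborel {v. N v < 1/2} = \<kappa> * l1_volume TYPE('n)" "emeasure lborel {v. N v < 1/2} < \<infinity>"
    using \<kappa>(1) l1_volume_pos[where 'n='n] by (auto simp: measure_def)
qed

end

lemma exists_adapted_frame:
  assumes "\<Omega> \<in> convex_domains_no_line" "z0 \<in> \<Omega>"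
  shows "\<exists>A. adapted_frame \<Omega> z0 A"
proof -
  obtain A where "det A \<noteq> 0"
    "\<And>y. (\<Sum>j\<in>UNIV. cmod ((A *v y) $ j)) < 1 \<Longrightarrow> z0 + y \<in> \<Omega>"
    "\<And>z j. z \<in> \<Omega> \<Longrightarrow> Re ((A *v (z - z0)) $ j) < 1"
    by (rule exists_frame[OF assms]) (rule that)
  then have "adapted_frame \<Omega> z0 A" using assms by unfold_locales
  then show ?thesis by blast
qed

text \<open>Every point is the base point of a frame of its own, and the \<open>weight\<close>
  belonging to that frame does not vanish there.\<close>

lemma bergman_domain_convex:
  assumes "\<Omega> \<in> convex_domains_no_line"
  shows "bergman_domain \<Omega>"
proof
  show "open \<Omega>" using assms by (simp add: convex_domains_no_line_def)
  fix w assume "w \<in> \<Omega>"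
  then obtain A where "adapted_frame \<Omega> w A" using exists_adapted_frame[OF assms] by blast
  then interpret adapted_frame \<Omega> w A .
  show "\<exists>f\<in>bergman_space \<Omega>. f w \<noteq> 0"
    using weight_space(1) weight_z0 weight_at_zero_pos[of "TYPE('a)"] by (intro bexI[of _ weight]) auto
qed

context adapted_frame
begin

sublocale bergman_domain \<Omega> by (rule bergman_domain_convex[OF dom])

abbreviation "K0 \<equiv> Re (k z0 z0)"

lemma K0_pos: "0 < K0" by (rule kernel_pos[OF z0])

lemma kernel_le_volume:
  assumes w: "N (w - z0) < 1/2"
  shows "Re (k w w) * (\<kappa> * l1_volume TYPE('n)) \<le> 1"
  unfolding frame_volume(1)[symmetric]
proof (rule kernel_upper_bound)
  show "w \<in> \<Omega>" using w by (intro in_dom) simp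
  show "open {v. N v < 1/2}" by (intro open_Collect_less continuous_intros)
  show "{v. N v < 1/2} \<noteq> {}" by (auto intro!: exI[of _ 0])
  show "emeasure lborel {v. N v < 1/2} < \<infinity>" by (rule frame_volume(2))
  fix c x assume "cmod c \<le> 1" "x \<in> {v. N v < 1/2}"
  moreover have "cmod c * N x \<le> 1 * N x" if "cmod c \<le> 1" using that N_nonneg by (intro mult_right_mono)
  ultimately show "c *s x \<in> {v. N v < 1/2}" by (simp add: N_scale)
next
  fix x assume "x \<in> {v. N v < 1/2}"
  then have "N ((w - z0) + x) < 1" using N_triangle[of "w - z0" x] w by simp
  then show "w + x \<in> \<Omega>" by (intro in_dom) (simp add: algebra_simps)
qed

lemma kernel_z0_ge: "(weight_at_zero TYPE('n))^2 \<le> K0 * (\<kappa> * decay_mass TYPE('n))"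
proof -
  have "(cmod (weight z0))^2 \<le> K0 * l2_norm2 \<Omega> weight" by (rule evaluation_le_kernel[OF z0 weight_space(1)])
  also have "\<dots> \<le> K0 * (\<kappa> * decay_mass TYPE('n))"
    using K0_pos weight_space(2) by (intro mult_left_mono) auto
  finally show ?thesis unfolding weight_z0 by simp
qed

lemma decay_mass_pos: "0 < decay_mass TYPE('n)"
proof -
  have "0 < (weight_at_zero TYPE('n))^2" using weight_at_zero_pos[of "TYPE('n)"] by simp
  then have "0 < K0 * (\<kappa> * decay_mass TYPE('n))" using kernel_z0_ge by linarith
  then show ?thesis using K0_pos \<kappa>(1) by (simp add: zero_less_mult_iff)
qed

lemma kernel_le_K0:
  assumes w: "N (w - z0) < 1/2"
  shows "Re (k w w) \<le> kernel_ratio TYPE('n) * K0"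
proof -
  define V C c where "V = l1_volume TYPE('n)" and "C = decay_mass TYPE('n)" and "c = (weight_at_zero TYPE('n))^2"
  have pos: "0 < V" "0 < C" "0 < c" "0 < \<kappa>"
    using l1_volume_pos[where 'n='n] decay_mass_pos weight_at_zero_pos[of "TYPE('n)"] \<kappa>(1) by (simp_all add: V_def C_def c_def)
  have "Re (k w w) * (\<kappa> * V) * c \<le> 1 * (K0 * (\<kappa> * C))"
    using kernel_le_volume[OF w] kernel_z0_ge pos K0_pos
    by (intro mult_mono) (auto simp: V_def C_def c_def)
  \<comment> \<open>The Jacobian occurs once on each side and is divided out, leaving constants of
    the dimension.\<close>
  then have "(Re (k w w) * (V * c)) * \<kappa> \<le> (K0 * C) * \<kappa>" by (simp add: mult_ac)
  then have "Re (k w w) * (V * c) \<le> K0 * C" using pos by (simp only: mult_le_cancel_right_pos)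
  then have "Re (k w w) \<le> K0 * C / (V * c)" using pos by (simp add: pos_le_divide_eq)
  also have "\<dots> = kernel_ratio TYPE('n) * K0" by (simp add: kernel_ratio_def V_def C_def c_def mult_ac)
  finally show ?thesis .
qed

lemma kernel_ratio_ge_1: "1 \<le> kernel_ratio TYPE('n)"
  using kernel_le_K0[of z0] K0_pos by simp

lemma kernel_bound:
  assumes z: "N (z - z0) < 1/2" and w: "N (w - z0) < 1/2"
  shows "cmod (k z w) \<le> kernel_ratio TYPE('n) * K0"
proof (rule power2_le_imp_le)
  have in\<Omega>: "z \<in> \<Omega>" "w \<in> \<Omega>" using z w by (auto intro: in_dom)
  have "(cmod (k z w))^2 \<le> Re (k z z) * Re (k w w)" by (rule kernel_cauchy_schwarz[OF in\<Omega>])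
  also have "\<dots> \<le> (kernel_ratio TYPE('n) * K0) * (kernel_ratio TYPE('n) * K0)"
    using kernel_le_K0[OF z] kernel_le_K0[OF w] kernel_pos[OF in\<Omega>(2)] K0_pos kernel_ratio_ge_1 by (intro mult_mono) auto
  finally show "(cmod (k z w))^2 \<le> (kernel_ratio TYPE('n) * K0)^2" by (simp only: power2_eq_square)
qed (use K0_pos kernel_ratio_ge_1 in simp)

end

subsection \<open>The logarithm of the kernel\<close>

lemma bounded_linear_cfst: "bounded_linear cfst" and bounded_linear_csnd: "bounded_linear csnd"
  and bounded_linear_cnjv: "bounded_linear cnjv"
  by (simp_all add: linear_conv_bounded_linear[symmetric] linear_iff cfst_csnd_linear scaleR_eq_smult cnjv_linear)

lemma cpair_zero [simp]: "cpair 0 0 = 0" "cnjv 0 = 0"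
  by (auto simp: cpair_def vec_eq_iff split: sum.split)

lemma dir_deriv_cmult:
  assumes "holomorphic_several f U" "z \<in> U"
  shows "dir_deriv X (\<lambda>z. c * f z) z = c * dir_deriv X f z"
  using dir_deriv_eqI[OF has_derivative_mult_right[OF holomorphic_several_derivative(1)[OF assms]]] .

lemma holomorphic_several_cnj:
  assumes "holomorphic_several g U"
  shows "holomorphic_several (\<lambda>w. cnj (g (cnjv w))) {w. cnjv w \<in> U}"
proof (rule holomorphic_several_intro[where D="\<lambda>w X. cnj (dir_deriv (cnjv X) g (cnjv w))"])
  fix w assume w: "w \<in> {w. cnjv w \<in> U}"
  then have w': "cnjv w \<in> U" by simp
  show "((\<lambda>w. cnj (g (cnjv w))) has_derivative (\<lambda>X. cnj (dir_deriv (cnjv X) g (cnjv w)))) (at w)"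
    by (rule has_derivative_cnj[OF has_derivative_compose[OF bounded_linear_imp_has_derivative[OF bounded_linear_cnjv]
      holomorphic_several_derivative(1)[OF assms w']]])
  show "\<And>c v. cnj (dir_deriv (cnjv (c *s v)) g (cnjv w)) = c * cnj (dir_deriv (cnjv v) g (cnjv w))"
    by (simp add: cnjv_linear holomorphic_several_derivative(2)[OF assms w'])
qed

lemma antidiag_decompose: "antidiag z = cpair z 0 + cpair 0 (cnjv z)"
  by (simp add: antidiag_def cpair_linear)

lemma cpair_smult: "cpair (c *s v) 0 = c *s cpair v 0" "cpair 0 (c *s v) = c *s cpair 0 v"
  by (simp_all add: cpair_linear)

text \<open>\<open>antidiag\<close> of a direction splits into its two blocks, and multiplication by
  \<open>\<i>\<close> acts on them as \<open>\<i>\<close> and \<open>-\<i>\<close>. The Wirtinger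
  combinations therefore isolate one block each.\<close>

lemma wirtinger_pullback:
  assumes G: "holomorphic_several G U" and V: "open V" "z \<in> V"
    and sub: "\<And>z. z \<in> V \<Longrightarrow> antidiag z \<in> U" and f: "\<And>z. z \<in> V \<Longrightarrow> f z = G (antidiag z)"
  shows "wirtinger j f z = dir_deriv (cpair (axis j 1) 0) G (antidiag z)"
    and "wirtinger_bar j f z = dir_deriv (cpair 0 (axis j 1)) G (antidiag z)"
proof -
  let ?p = "antidiag z" and ?e = "axis j (1::complex)"
  have p: "?p \<in> U" by (rule sub[OF V(2)])
  note lin = dir_deriv_linear[OF G p] holomorphic_several_derivative(2)[OF G p]
  have pull: "dir_deriv X f z = dir_deriv (antidiag X) G ?p" for X
    by (rule dir_deriv_pullback[OF G V sub f])
  have i: "axis j \<i> = \<i> *s ?e" by (simp add: vec_eq_iff axis_def)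
  have d1: "dir_deriv ?e f z = dir_deriv (cpair ?e 0) G ?p + dir_deriv (cpair 0 ?e) G ?p"
    unfolding pull antidiag_decompose[of ?e] lin by simp
  have d2: "dir_deriv (axis j \<i>) f z = \<i> * dir_deriv (cpair ?e 0) G ?p - \<i> * dir_deriv (cpair 0 ?e) G ?p"
    unfolding pull i antidiag_decompose[of "\<i> *s ?e"] cnjv_linear cpair_smult lin by simp
  show "wirtinger j f z = dir_deriv (cpair ?e 0) G ?p"
    unfolding wirtinger_def d1 d2 by (simp add: algebra_simps)
  show "wirtinger_bar j f z = dir_deriv (cpair 0 ?e) G ?p"
    unfolding wirtinger_bar_def d1 d2 by (simp add: algebra_simps)
qed

lemma cpair_axis_sum:
  "cpair v 0 = (\<Sum>i\<in>UNIV. v $ i *s cpair (axis i 1) 0)"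
  "cpair 0 w = (\<Sum>i\<in>UNIV. w $ i *s cpair 0 (axis i 1))"
proof -
  show "cpair v 0 = (\<Sum>i\<in>UNIV. v $ i *s cpair (axis i 1) 0)"
    by (simp add: vec_eq_iff cpair_def axis_def if_distrib cong: if_cong split: sum.split)
  show "cpair 0 w = (\<Sum>i\<in>UNIV. w $ i *s cpair 0 (axis i 1))"
    by (simp add: vec_eq_iff cpair_def axis_def if_distrib cong: if_cong split: sum.split)
qed

lemma dir_deriv_bilinear:
  assumes f: "holomorphic_several f U" and U: "open U" and p: "p \<in> U"
  shows "dir_deriv (a + b) (dir_deriv c f) p = dir_deriv a (dir_deriv c f) p + dir_deriv b (dir_deriv c f) p"
    and "dir_deriv c (dir_deriv (a + b) f) p = dir_deriv c (dir_deriv a f) p + dir_deriv c (dir_deriv b f) p"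
    and "dir_deriv (t *s a) (dir_deriv c f) p = t * dir_deriv a (dir_deriv c f) p"
    and "dir_deriv c (dir_deriv (t *s a) f) p = t * dir_deriv c (dir_deriv a f) p"
    and "dir_deriv (sum g I) (dir_deriv c f) p = (\<Sum>i\<in>I. dir_deriv (g i) (dir_deriv c f) p)"
    and "dir_deriv c (dir_deriv (sum g I) f) p = (\<Sum>i\<in>I. dir_deriv c (dir_deriv (g i) f) p)"
proof -
  note h = holomorphic_several_dir_deriv[OF f U]
  note com = dir_deriv_commute[OF f U p, of c]
  show "dir_deriv (a + b) (dir_deriv c f) p = dir_deriv a (dir_deriv c f) p + dir_deriv b (dir_deriv c f) p"
    by (rule dir_deriv_linear(1)[OF h p])
  then show "dir_deriv c (dir_deriv (a + b) f) p = dir_deriv c (dir_deriv a f) p + dir_deriv c (dir_deriv b f) p"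
    unfolding com .
  show "dir_deriv (t *s a) (dir_deriv c f) p = t * dir_deriv a (dir_deriv c f) p"
    by (rule holomorphic_several_derivative(2)[OF h p])
  then show "dir_deriv c (dir_deriv (t *s a) f) p = t * dir_deriv c (dir_deriv a f) p"
    unfolding com .
  show "dir_deriv (sum g I) (dir_deriv c f) p = (\<Sum>i\<in>I. dir_deriv (g i) (dir_deriv c f) p)"
    by (rule dir_deriv_linear(4)[OF h p])
  then show "dir_deriv c (dir_deriv (sum g I) f) p = (\<Sum>i\<in>I. dir_deriv c (dir_deriv (g i) f) p)"
    unfolding com .
qed

section \<open>The complexified neighbourhood of the base point\<close>

text \<open>Small enough that the kernel varies over this radius by less than half of its value at
  the base point, which keeps the principal logarithm off its cut.\<close>

definition frame_radius :: "'n::finite itself \<Rightarrow> real" where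
  "frame_radius T = 1 / (8 * kernel_ratio T)"

context adapted_frame
begin

text \<open>The second block carries the conjugate of the kernel's second argument, and
  \<open>N\<close> need not be invariant under conjugation; hence the \<open>cnjv\<close>. The sum
  is still a complex norm.\<close>

definition N2 :: "complex^('n + 'n) \<Rightarrow> real" where "N2 p = N (cfst p) + N (cnjv (csnd p))"

lemma N2_triangle: "N2 (p + q) \<le> N2 p + N2 q"
  unfolding N2_def cfst_csnd_linear cnjv_linear using N_triangle[of "cfst p" "cfst q"]
    N_triangle[of "cnjv (csnd p)" "cnjv (csnd q)"] by linarith

lemma N2_scale: "N2 (c *s p) = cmod c * N2 p"
  unfolding N2_def cfst_csnd_linear cnjv_linear N_scale by (simp add: algebra_simps)

lemma N2_nonneg: "0 \<le> N2 p" unfolding N2_def using N_nonneg by (simp add: add_nonneg_nonneg)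

lemma N2_eq_0: "N2 p = 0 \<Longrightarrow> p = 0"
proof -
  assume "N2 p = 0"
  then have "N (cfst p) = 0" "N (cnjv (csnd p)) = 0"
    using N_nonneg[of "cfst p"] N_nonneg[of "cnjv (csnd p)"] unfolding N2_def by linarith+
  then have "cfst p = 0" "cnjv (cnjv (csnd p)) = cnjv 0" using N_eq_0 by (blast, metis)
  then have "cpair (cfst p) (csnd p) = 0" by (simp only: cnjv_simps cpair_zero)
  then show "p = 0" by simp
qed

lemma N2_cpair [simp]: "N2 (cpair v 0) = N v" "N2 (cpair 0 v) = N (cnjv v)" "N2 (antidiag v) = 2 * N v"
  by (simp_all add: N2_def antidiag_def)

definition p0 :: "complex^('n + 'n)" where "p0 = antidiag z0"

definition near :: "real \<Rightarrow> (complex^('n + 'n)) set" where "near r = {p. N2 (p - p0) < r}"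

lemma open_near: "open (near r)"
  unfolding near_def N2_def
  by (intro open_Collect_less continuous_intros
    continuous_on_compose2[OF linear_continuous_on[OF bounded_linear_cfst, of UNIV]]
    continuous_on_compose2[OF linear_continuous_on[OF bounded_linear_csnd, of UNIV]]
    continuous_on_compose2[OF linear_continuous_on[OF bounded_linear_cnjv, of UNIV]]) auto

lemma near_mono: "r \<le> s \<Longrightarrow> near r \<subseteq> near s" by (auto simp: near_def)

lemma p0_near: "0 < r \<Longrightarrow> p0 \<in> near r" using N2_scale[of 0 0] by (simp add: near_def)

lemma antidiag_near: "antidiag z \<in> near r \<longleftrightarrow> N (z - z0) < r / 2"
  using N2_cpair(3)[of "z - z0"] by (auto simp: near_def p0_def antidiag_linear)

lemma near_components:
  assumes "p \<in> near r"
  shows "N (cfst p - z0) < r" "N (cnjv (csnd p) - z0) < r"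
  using assms N_nonneg[of "cfst p - z0"] N_nonneg[of "cnjv (csnd p) - z0"]
  by (auto simp: near_def N2_def p0_def antidiag_def cfst_csnd_linear cnjv_linear)

lemma near_dom: "p \<in> near (1/2) \<Longrightarrow> cfst p \<in> \<Omega> \<and> cnjv (csnd p) \<in> \<Omega>"
  using near_components[of p "1/2"] by (auto intro!: in_dom)

text \<open>The kernel is antiholomorphic in its second argument; conjugating that argument makes
  both blocks holomorphic.\<close>

definition F :: "complex^('n + 'n) \<Rightarrow> complex" where "F p = k (cfst p) (cnjv (csnd p))"

lemma F_bound: "p \<in> near (1/2) \<Longrightarrow> cmod (F p) \<le> kernel_ratio TYPE('n) * K0"
  unfolding F_def by (intro kernel_bound near_components)

text \<open>Only separate holomorphy is known directly: in the first block from the Bergman space,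
  in the second from Hermitian symmetry. Cauchy-Schwarz for the kernel supplies the bound that
  Osgood's lemma asks for. Slices whose frozen variable lies off the domain are empty.\<close>

lemma F_holomorphic: "holomorphic_several F (near (1/2))"
proof (rule osgood)
  fix p assume "p \<in> near (1/2)"
  then obtain r where "0 < r" "ball p r \<subseteq> near (1/2)" using open_near open_contains_ball by blast
  then show "\<exists>r>0. \<exists>M. ball p r \<subseteq> near (1/2) \<and> (\<forall>q\<in>ball p r. cmod (F q) \<le> M)"
    using F_bound by blast
next
  fix w
  show "holomorphic_several (\<lambda>z. F (cpair z w)) {z. cpair z w \<in> near (1/2)}"
  proof (cases "cnjv w \<in> \<Omega>")
    case True
    have "{z. cpair z w \<in> near (1/2)} \<subseteq> \<Omega>" using near_dom by force
    with kernel_holomorphic[OF True] show ?thesis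
      unfolding F_def cpair_simps by (rule holomorphic_several_subset)
  next
    case False
    then have "{z. cpair z w \<in> near (1/2)} = {}" using near_dom by force
    then show ?thesis by (simp add: holomorphic_several_def)
  qed
next
  fix z
  show "holomorphic_several (\<lambda>w. F (cpair z w)) {w. cpair z w \<in> near (1/2)}"
  proof (cases "z \<in> \<Omega>")
    case True
    have hol: "holomorphic_several (\<lambda>w. cnj (k (cnjv w) z)) {w. cnjv w \<in> \<Omega>}"
      by (rule holomorphic_several_cnj[OF kernel_holomorphic[OF True]])
    have op: "open {w. cnjv w \<in> \<Omega>}"
      using open_vimage[OF dom_open linear_continuous_on[OF bounded_linear_cnjv]] by (simp add: vimage_def)
    have "holomorphic_several (\<lambda>w. F (cpair z w)) {w. cnjv w \<in> \<Omega>}"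
      by (rule holomorphic_several_cong[OF hol op]) (simp add: F_def kernel_cnj[OF True])
    moreover have "{w. cpair z w \<in> near (1/2)} \<subseteq> {w. cnjv w \<in> \<Omega>}" using near_dom by force
    ultimately show ?thesis by (rule holomorphic_several_subset)
  next
    case False
    then have "{w. cpair z w \<in> near (1/2)} = {}" using near_dom by force
    then show ?thesis by (simp add: holomorphic_several_def)
  qed
qed

lemma near_derivative_bound:
  assumes f: "holomorphic_several f (near R)" and M: "\<And>q. q \<in> near R \<Longrightarrow> cmod (f q) \<le> M"
    and s: "0 < s" and p: "p \<in> near (R - s)"
  shows "cmod (dir_deriv X f p) \<le> M * N2 X / s"
  by (rule dir_deriv_cauchy_norm[where N=N2 and ?p0.0=p0 and R=R, OF f N2_triangle N2_scale N2_eq_0 _ _ s])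
    (use M p in \<open>auto simp: near_def\<close>)

lemma segment_near:
  assumes "0 \<le> u" "u \<le> 1" "q \<in> near r" shows "p0 + u *\<^sub>R (q - p0) \<in> near r"
proof -
  have "N2 (u *\<^sub>R (q - p0)) = u * N2 (q - p0)"
    unfolding scaleR_eq_smult N2_scale using assms by simp
  also have "\<dots> \<le> N2 (q - p0)" using assms N2_nonneg by (simp add: mult_left_le_one_le)
  finally show ?thesis using assms by (simp add: near_def)
qed

lemma near_lipschitz:
  assumes f: "holomorphic_several f (near R)" and B: "\<And>p X. p \<in> near R \<Longrightarrow> cmod (dir_deriv X f p) \<le> B * N2 X"
    and q: "q \<in> near R"
  shows "cmod (f q - f p0) \<le> B * N2 (q - p0)"
  by (rule segment_bound[OF f]) (auto intro!: segment_near q B)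

definition \<rho> :: real where "\<rho> = frame_radius TYPE('n)"

lemma \<rho>: "0 < \<rho>" "\<rho> \<le> 1/8" "8 * kernel_ratio TYPE('n) * \<rho> = 1"
  using kernel_ratio_ge_1 by (auto simp: \<rho>_def frame_radius_def field_simps)

lemma F_p0: "F p0 = of_real K0"
  by (simp add: F_def p0_def antidiag_def kernel_diagonal[OF z0])

text \<open>A Cauchy estimate with loss 1/4 gives the Lipschitz constant
  \<open>4 * kernel_ratio TYPE('n) * K0\<close> on the quarter neighbourhood, which over a distance
  below \<open>\<rho>\<close> amounts to less than \<open>K0 / 2\<close>.\<close>

lemma F_close:
  assumes p: "p \<in> near \<rho>"
  shows "cmod (F p / of_real K0 - 1) < 1/2"
proof -
  let ?B = "kernel_ratio TYPE('n) * K0"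
  have sub: "near (1/4) \<subseteq> near (1/2)" by (rule near_mono) simp
  have p4: "p \<in> near (1/4)" using p near_mono[of \<rho> "1/4"] \<rho>(2) by auto
  have "cmod (dir_deriv X F q) \<le> 4 * ?B * N2 X" if "q \<in> near (1/4)" for q X
    using near_derivative_bound[OF F_holomorphic F_bound, of "1/4" q X] that by simp
  from near_lipschitz[OF holomorphic_several_subset[OF F_holomorphic sub] this p4]
  have "cmod (F p - of_real K0) \<le> 4 * ?B * N2 (p - p0)" unfolding F_p0 .
  also have "\<dots> < 4 * ?B * \<rho>"
    using p K0_pos kernel_ratio_ge_1 by (intro mult_strict_left_mono) (auto simp: near_def)
  also have "\<dots> = K0 / 2" using \<rho>(3) by (simp add: field_simps)
  finally have "cmod (F p - of_real K0) < K0 / 2" .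
  moreover have "F p / of_real K0 - 1 = (F p - of_real K0) / of_real K0" using K0_pos by (simp add: field_simps)
  ultimately show ?thesis using K0_pos by (simp only: norm_divide norm_of_real) (simp add: field_simps)
qed

lemma F_Re_pos:
  assumes "p \<in> near \<rho>" shows "1/2 < Re (F p / of_real K0)" "F p / of_real K0 \<notin> \<real>\<^sub>\<le>\<^sub>0" "F p \<noteq> 0"
proof -
  have "\<bar>Re (F p / of_real K0 - 1)\<bar> < 1/2"
    using abs_Re_le_cmod[of "F p / of_real K0 - 1"] F_close[OF assms] by linarith
  then show re: "1/2 < Re (F p / of_real K0)" unfolding minus_complex.simps(1) one_complex.simps by linarith
  show "F p / of_real K0 \<notin> \<real>\<^sub>\<le>\<^sub>0"
  proof
    assume "F p / of_real K0 \<in> \<real>\<^sub>\<le>\<^sub>0"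
    then show False using re unfolding complex_nonpos_Reals_iff by linarith
  qed
  then show "F p \<noteq> 0" by auto
qed

text \<open>Dividing by \<open>K0\<close> before taking the logarithm places its argument near 1,
  where the principal branch is holomorphic; the constant is then restored so that the diagonal
  values are exactly log K(z,z).\<close>

definition \<Phi> :: "complex^('n + 'n) \<Rightarrow> complex" where
  "\<Phi> p = Ln (F p / of_real K0) + of_real (ln K0)"

lemma near_\<rho>_sub: "near \<rho> \<subseteq> near (1/2)" using near_mono[of \<rho> "1/2"] \<rho>(2) by auto

lemma \<Phi>_holomorphic: "holomorphic_several \<Phi> (near \<rho>)"
proof -
  have 1: "holomorphic_several (\<lambda>p. (1 / of_real K0) * F p) (near \<rho>)"
    by (intro holomorphic_several_cmult holomorphic_several_subset[OF F_holomorphic near_\<rho>_sub])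
  have "holomorphic_several (\<lambda>p. Ln ((1 / of_real K0) * F p)) (near \<rho>)"
  proof (rule holomorphic_several_chain[OF 1])
    fix p assume "p \<in> near \<rho>"
    then show "(Ln has_field_derivative inverse ((1 / of_real K0) * F p)) (at ((1 / of_real K0) * F p))"
      using has_field_derivative_Ln[OF F_Re_pos(2)] by simp
  qed
  from holomorphic_several_add[OF this holomorphic_several_const]
  show ?thesis unfolding \<Phi>_def[abs_def] by simp
qed

text \<open>The argument of the logarithm has modulus between 1/2 and 2, so the real part is at most
  \<open>ln 2\<close>, below 1, while the principal branch bounds the imaginary part by
  \<open>pi\<close>.\<close>

lemma \<Phi>_bound:
  assumes "p \<in> near \<rho>" shows "cmod (\<Phi> p - of_real (ln K0)) \<le> 1 + pi"
proof -
  let ?u = "F p / of_real K0"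
  have u0: "?u \<noteq> 0" using F_Re_pos[OF assms] K0_pos by simp
  have cl: "cmod (?u - 1) < 1/2" by (rule F_close[OF assms])
  have lo: "1/2 \<le> cmod ?u" using norm_triangle_ineq2[of 1 "1 - ?u"] cl by (simp add: norm_minus_commute)
  have hi: "cmod ?u \<le> 2" using norm_triangle_ineq[of "?u - 1" 1] cl by simp
  have "ln (cmod ?u) \<le> ln 2" using hi u0 by (subst ln_le_cancel_iff) auto
  moreover have "ln (1/2) \<le> ln (cmod ?u)" using lo u0 by (subst ln_le_cancel_iff) auto
  moreover have "ln (1/2::real) = - ln 2" by (simp add: ln_div)
  moreover have "ln 2 \<le> (1::real)" using ln_le_minus_one[of 2] by simp
  ultimately have "\<bar>ln (cmod ?u)\<bar> \<le> 1" by linarith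
  moreover have "\<bar>Im (Ln ?u)\<bar> \<le> pi" using mpi_less_Im_Ln[OF u0] Im_Ln_le_pi[OF u0] by linarith
  ultimately show ?thesis using cmod_le[of "Ln ?u"] u0 by (simp add: \<Phi>_def Re_Ln)
qed

lemma \<Phi>_antidiag:
  assumes "N (z - z0) < \<rho> / 2" shows "\<Phi> (antidiag z) = of_real (ln (Re (k z z)))"
proof -
  have z: "z \<in> \<Omega>" using assms \<rho> by (intro in_dom) linarith
  have "F (antidiag z) = of_real (Re (k z z))" by (simp add: F_def antidiag_def kernel_diagonal[OF z])
  then have "\<Phi> (antidiag z) = Ln (of_real (Re (k z z) / K0)) + of_real (ln K0)" by (simp add: \<Phi>_def)
  also have "\<dots> = of_real (ln (Re (k z z) / K0) + ln K0)"
    using kernel_pos[OF z] K0_pos by (subst Ln_of_real) auto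
  also have "ln (Re (k z z) / K0) + ln K0 = ln (Re (k z z))"
    using kernel_pos[OF z] K0_pos by (simp add: ln_div)
  finally show ?thesis .
qed

lemma cswap_near: "p \<in> near r \<Longrightarrow> cswap p \<in> near r"
proof -
  assume p: "p \<in> near r"
  have "cswap p - p0 = cswap (p - p0)"
    by (simp add: p0_def cswap_def antidiag_def cpair_linear cfst_csnd_linear cnjv_linear)
  moreover have "N2 (cswap (p - p0)) = N2 (p - p0)" by (simp add: N2_def cswap_def)
  ultimately show ?thesis using p by (simp add: near_def)
qed

text \<open>Hermitian symmetry of the kernel survives the logarithm, because the principal branch
  commutes with conjugation off the cut.\<close>

lemma \<Phi>_cswap:
  assumes "p \<in> near \<rho>" shows "\<Phi> p = cnj (\<Phi> (cswap p))"
proof -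
  have "cfst p \<in> \<Omega>" "cnjv (csnd p) \<in> \<Omega>" using near_dom assms near_\<rho>_sub by auto
  then have "F (cswap p) = cnj (F p)" by (simp add: F_def cswap_def kernel_cnj[of "cnjv (csnd p)"])
  moreover have "Ln (cnj (F p) / of_real K0) = cnj (Ln (F p / of_real K0))"
    using cnj_Ln[OF F_Re_pos(2)[OF assms]] by simp
  ultimately show ?thesis by (simp add: \<Phi>_def)
qed

text \<open>The holomorphic extension of the metric coefficient: \<open>v\<close> differentiates in
  the holomorphic block, \<open>w\<close> in the conjugate block, as in the complex Hessian of log
  K.\<close>

definition G :: "complex^'n \<Rightarrow> complex^'n \<Rightarrow> complex^('n + 'n) \<Rightarrow> complex" where
  "G v w = dir_deriv (cpair v 0) (dir_deriv (cpair 0 (cnjv w)) \<Phi>)"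

lemmas near_dir_deriv = holomorphic_several_dir_deriv[OF _ open_near]

lemma G_holomorphic: "holomorphic_several (G v w) (near \<rho>)"
  unfolding G_def by (intro near_dir_deriv \<Phi>_holomorphic)

text \<open>The halved radius compensates \<open>N2 (antidiag v) = 2 * N v\<close>.\<close>

definition V :: "(complex^'n) set" where "V = {z. N (z - z0) < \<rho> / 2}"

lemma V: "open V" "z0 \<in> V" "z \<in> V \<Longrightarrow> antidiag z \<in> near \<rho>" "z \<in> V \<Longrightarrow> z \<in> \<Omega>"
proof -
  show "open V" unfolding V_def by (intro open_Collect_less continuous_intros)
  show "z0 \<in> V" using \<rho> by (simp add: V_def)
  show "z \<in> V \<Longrightarrow> antidiag z \<in> near \<rho>" by (simp add: antidiag_near V_def)
  show "z \<in> V \<Longrightarrow> z \<in> \<Omega>" using \<rho> by (intro in_dom) (simp add: V_def)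
qed

text \<open>The two Wirtinger operators become derivatives along the coordinate axes of the two
  blocks, and bilinearity assembles the double sum into one mixed derivative.\<close>

lemma bergman_form_eq:
  assumes z: "z \<in> V" shows "bergman_form \<Omega> z v w = G v w (antidiag z)"
proof -
  let ?u = "\<lambda>\<zeta>. complex_of_real (ln (Re (k \<zeta> \<zeta>)))" and ?p = "antidiag z"
  have p: "?p \<in> near \<rho>" by (rule V(3)[OF z])
  have u: "?u \<zeta> = \<Phi> (antidiag \<zeta>)" if "\<zeta> \<in> V" for \<zeta>
    using \<Phi>_antidiag[of \<zeta>] that by (simp add: V_def)
  have bar: "wirtinger_bar j ?u \<zeta> = dir_deriv (cpair 0 (axis j 1)) \<Phi> (antidiag \<zeta>)" if "\<zeta> \<in> V" for j \<zeta>
    by (rule wirtinger_pullback(2)[OF \<Phi>_holomorphic V(1) that V(3) u])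
  have "wirtinger i (wirtinger_bar j ?u) z = dir_deriv (cpair (axis i 1) 0) (dir_deriv (cpair 0 (axis j 1)) \<Phi>) ?p" for i j
    by (rule wirtinger_pullback(1)[OF near_dir_deriv[OF \<Phi>_holomorphic] V(1) z V(3) bar])
  then have "bergman_form \<Omega> z v w = (\<Sum>i\<in>UNIV. \<Sum>j\<in>UNIV. v $ i *
      dir_deriv (cpair (axis i 1) 0) (dir_deriv (cpair 0 (axis j 1)) \<Phi>) ?p * cnj (w $ j))"
    by (simp add: bergman_form_def)
  also have "\<dots> = (\<Sum>i\<in>UNIV. v $ i * (\<Sum>j\<in>UNIV. cnjv w $ j *
      dir_deriv (cpair (axis i 1) 0) (dir_deriv (cpair 0 (axis j 1)) \<Phi>) ?p))"
    by (simp add: sum_distrib_left mult_ac)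
  also have "\<dots> = (\<Sum>i\<in>UNIV. v $ i * dir_deriv (cpair (axis i 1) 0) (dir_deriv (cpair 0 (cnjv w)) \<Phi>) ?p)"
    unfolding cpair_axis_sum(2)[of "cnjv w"] dir_deriv_bilinear(4,6)[OF \<Phi>_holomorphic open_near p] ..
  also have "\<dots> = G v w ?p"
    unfolding G_def cpair_axis_sum(1)[of v] dir_deriv_bilinear(3,5)[OF \<Phi>_holomorphic open_near p] ..
  finally show ?thesis .
qed

lemma metric_eq: "z \<in> V \<Longrightarrow> bergman_metric \<Omega> z v w = Re (G v w (antidiag z))"
  by (simp add: bergman_metric_def bergman_form_eq)

lemma metric_deriv:
  assumes "z \<in> V"
  shows "dir_deriv X (\<lambda>z. bergman_metric \<Omega> z v w) z = Re (dir_deriv (antidiag X) (G v w) (antidiag z))"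
  by (rule pullback_Re_derivative(2)[OF G_holomorphic V(1) assms V(3) metric_eq])

lemma metric_deriv2:
  assumes "z \<in> V"
  shows "dir_deriv Y (dir_deriv X (\<lambda>z. bergman_metric \<Omega> z v w)) z =
     Re (dir_deriv (antidiag Y) (dir_deriv (antidiag X) (G v w)) (antidiag z))"
  by (rule pullback_Re_derivative(2)[OF near_dir_deriv[OF G_holomorphic] V(1) assms V(3) metric_deriv])

subsection \<open>Upper bounds\<close>

text \<open>The cost of one derivative when the radius shrinks by \<open>\<rho> / 8\<close>.\<close>

definition \<sigma> :: real where "\<sigma> = 8 / \<rho>"

lemma bound_step:
  assumes f: "holomorphic_several f (near \<rho>)" and R: "R \<le> \<rho>" and M: "\<And>q. q \<in> near R \<Longrightarrow> cmod (f q) \<le> M"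
    and p: "p \<in> near (R - \<rho>/8)"
  shows "cmod (dir_deriv X f p) \<le> M * \<sigma> * N2 X"
  using near_derivative_bound[OF holomorphic_several_subset[OF f near_mono[OF R]] M _ p, of X] \<rho>(1)
  by (simp add: \<sigma>_def mult_ac)

text \<open>\<open>\<Phi>\<close> itself has no bound uniform over domains, because of the summand
  \<open>ln K0\<close>. The Cauchy estimate is applied after subtracting that constant, which
  differentiation does not see.\<close>

lemma \<Phi>_deriv_bound: 
  assumes "p \<in> near (7/8 * \<rho>)" shows "cmod (dir_deriv X \<Phi> p) \<le> (1 + pi) * \<sigma> * N2 X"
proof -
  have h: "holomorphic_several (\<lambda>p. \<Phi> p - of_real (ln K0)) (near \<rho>)"
    by (intro holomorphic_several_diff \<Phi>_holomorphic holomorphic_several_const)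
  have p: "p \<in> near \<rho>" using assms near_mono[of "7/8 * \<rho>" \<rho>] \<rho>(1) by auto
  have "dir_deriv X (\<lambda>p. of_real (ln K0)) p = (0::complex)" by (rule dir_deriv_eqI[OF has_derivative_const])
  then have "dir_deriv X (\<lambda>p. \<Phi> p - of_real (ln K0)) p = dir_deriv X \<Phi> p"
    using dir_deriv_diff[OF \<Phi>_holomorphic holomorphic_several_const p] by simp
  then show ?thesis
    using bound_step[OF h order_refl \<Phi>_bound, of p X] assms by (simp add: algebra_simps)
qed

text \<open>Each derivative gives up another eighth of the radius and contributes a factor
  \<open>\<sigma>\<close>. What remains for the third derivative of \<open>G\<close> is 3/8 of the
  radius, enough for the Lipschitz estimate.\<close>

lemma G_bounds:
  shows "p \<in> near (6/8 * \<rho>) \<Longrightarrow> cmod (G v w p) \<le> (1 + pi) * \<sigma>^2 * N v * N w"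
    and "p \<in> near (5/8 * \<rho>) \<Longrightarrow> cmod (dir_deriv X (G v w) p) \<le> (1 + pi) * \<sigma>^3 * N v * N w * N2 X"
    and "p \<in> near (4/8 * \<rho>) \<Longrightarrow> cmod (dir_deriv Y (dir_deriv X (G v w)) p) \<le> (1 + pi) * \<sigma>^4 * N v * N w * N2 X * N2 Y"
    and "p \<in> near (3/8 * \<rho>) \<Longrightarrow> cmod (dir_deriv Z (dir_deriv Y (dir_deriv X (G v w))) p) \<le> (1 + pi) * \<sigma>^5 * N v * N w * N2 X * N2 Y * N2 Z"
proof -
  have 1: "cmod (dir_deriv (cpair 0 (cnjv w)) \<Phi> p) \<le> (1 + pi) * \<sigma> * N w" if "p \<in> near (7/8 * \<rho>)" for p
    using \<Phi>_deriv_bound[OF that, of "cpair 0 (cnjv w)"] by simp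
  have R: "7/8 * \<rho> - \<rho>/8 = 6/8 * \<rho>" "6/8 * \<rho> - \<rho>/8 = 5/8 * \<rho>" "5/8 * \<rho> - \<rho>/8 = 4/8 * \<rho>"
    "4/8 * \<rho> - \<rho>/8 = 3/8 * \<rho>" "7/8 * \<rho> \<le> \<rho>" "6/8 * \<rho> \<le> \<rho>" "5/8 * \<rho> \<le> \<rho>" "4/8 * \<rho> \<le> \<rho>"
    using \<rho>(1) by simp_all
  have 2: "cmod (G v w p) \<le> (1 + pi) * \<sigma>^2 * N v * N w" if "p \<in> near (6/8 * \<rho>)" for p
  proof -
    have "cmod (G v w p) \<le> ((1 + pi) * \<sigma> * N w) * \<sigma> * N2 (cpair v 0)"
      unfolding G_def by (rule bound_step[OF near_dir_deriv[OF \<Phi>_holomorphic] R(5)]) (use 1 that R in auto)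
    then show ?thesis by (simp add: power2_eq_square mult_ac)
  qed
  have 3: "cmod (dir_deriv X (G v w) p) \<le> (1 + pi) * \<sigma>^3 * N v * N w * N2 X" if "p \<in> near (5/8 * \<rho>)" for p
  proof -
    have "cmod (dir_deriv X (G v w) p) \<le> ((1 + pi) * \<sigma>^2 * N v * N w) * \<sigma> * N2 X"
      by (rule bound_step[OF G_holomorphic R(6)]) (use 2 that R in auto)
    then show ?thesis by (simp add: eval_nat_numeral mult_ac)
  qed
  have 4: "cmod (dir_deriv Y (dir_deriv X (G v w)) p) \<le> (1 + pi) * \<sigma>^4 * N v * N w * N2 X * N2 Y" if "p \<in> near (4/8 * \<rho>)" for p
  proof -
    have "cmod (dir_deriv Y (dir_deriv X (G v w)) p) \<le> ((1 + pi) * \<sigma>^3 * N v * N w * N2 X) * \<sigma> * N2 Y"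
      by (rule bound_step[OF near_dir_deriv[OF G_holomorphic] R(7)]) (use 3 that R in auto)
    then show ?thesis by (simp add: eval_nat_numeral mult_ac)
  qed
  have 5: "cmod (dir_deriv Z (dir_deriv Y (dir_deriv X (G v w))) p) \<le> (1 + pi) * \<sigma>^5 * N v * N w * N2 X * N2 Y * N2 Z"
    if "p \<in> near (3/8 * \<rho>)" for p
  proof -
    have "cmod (dir_deriv Z (dir_deriv Y (dir_deriv X (G v w))) p) \<le> ((1 + pi) * \<sigma>^4 * N v * N w * N2 X * N2 Y) * \<sigma> * N2 Z"
      by (rule bound_step[OF near_dir_deriv[OF near_dir_deriv[OF G_holomorphic]] R(8)]) (use 4 that R in auto)
    then show ?thesis by (simp add: eval_nat_numeral mult_ac)
  qed
  show "p \<in> near (6/8 * \<rho>) \<Longrightarrow> cmod (G v w p) \<le> (1 + pi) * \<sigma>^2 * N v * N w" by (rule 2)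
  show "p \<in> near (5/8 * \<rho>) \<Longrightarrow> cmod (dir_deriv X (G v w) p) \<le> (1 + pi) * \<sigma>^3 * N v * N w * N2 X" by (rule 3)
  show "p \<in> near (4/8 * \<rho>) \<Longrightarrow> cmod (dir_deriv Y (dir_deriv X (G v w)) p) \<le> (1 + pi) * \<sigma>^4 * N v * N w * N2 X * N2 Y" by (rule 4)
  show "p \<in> near (3/8 * \<rho>) \<Longrightarrow> cmod (dir_deriv Z (dir_deriv Y (dir_deriv X (G v w))) p) \<le> (1 + pi) * \<sigma>^5 * N v * N w * N2 X * N2 Y * N2 Z"
    by (rule 5)
qed

end

subsection \<open>The Kaehler property\<close>

lemma bergman_form_linear:
  "bergman_form \<Omega> z (v + v') w = bergman_form \<Omega> z v w + bergman_form \<Omega> z v' w"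
  "bergman_form \<Omega> z v (w + w') = bergman_form \<Omega> z v w + bergman_form \<Omega> z v w'"
  "bergman_form \<Omega> z (c *s v) w = c * bergman_form \<Omega> z v w"
  "bergman_form \<Omega> z v (c *s w) = cnj c * bergman_form \<Omega> z v w"
  unfolding bergman_form_def
  by (simp_all add: algebra_simps sum.distrib sum_distrib_left)

lemma bilinear_bergman_metric: "bilinear (bergman_metric \<Omega> z)"
  unfolding bilinear_def linear_iff bergman_metric_def scaleR_eq_smult bergman_form_linear by simp

lemma bergman_metric_J: "bergman_metric \<Omega> z (\<i> *s v) (\<i> *s w) = bergman_metric \<Omega> z v w"
  unfolding bergman_metric_def bergman_form_linear by simp

lemma ln_one_plus_ge:
  assumes "0 \<le> (s::real)" shows "s / (1 + s) \<le> ln (1 + s)"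
proof -
  have "ln (1 / (1 + s)) \<le> 1 / (1 + s) - 1" using assms by (intro ln_le_minus_one) simp
  moreover have "ln (1 / (1 + s)) = - ln (1 + s)" using assms by (simp add: ln_div)
  moreover have "1 / (1 + s) - 1 = - (s / (1 + s))" using assms by (simp add: field_simps)
  ultimately show ?thesis by linarith
qed

context adapted_frame
begin

lemma z0_antidiag: "antidiag z0 = p0" by (simp add: p0_def)

lemma p0_in: "p0 \<in> near \<rho>" by (rule p0_near[OF \<rho>(1)])

lemma cswap_p0: "cswap p0 = p0" by (simp add: p0_def)

lemma metric_z0: "bergman_metric \<Omega> z0 v w = Re (G v w p0)"
  using metric_eq[OF V(2)] by (simp add: z0_antidiag)

lemma \<Phi>_conj1: "q \<in> near \<rho> \<Longrightarrow> dir_deriv b \<Phi> q = cnj (dir_deriv (cswap b) \<Phi> (cswap q))"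
  by (rule dir_deriv_cswap[OF \<Phi>_holomorphic open_near _ cswap_near \<Phi>_cswap])

lemma \<Phi>_conj2: "q \<in> near \<rho> \<Longrightarrow>
   dir_deriv a (dir_deriv b \<Phi>) q = cnj (dir_deriv (cswap a) (dir_deriv (cswap b) \<Phi>) (cswap q))"
  by (rule dir_deriv_cswap[OF near_dir_deriv[OF \<Phi>_holomorphic] open_near _ cswap_near \<Phi>_conj1])

lemma \<Phi>_conj3: "q \<in> near \<rho> \<Longrightarrow> dir_deriv c (dir_deriv a (dir_deriv b \<Phi>)) q =
   cnj (dir_deriv (cswap c) (dir_deriv (cswap a) (dir_deriv (cswap b) \<Phi>)) (cswap q))"
  by (rule dir_deriv_cswap[OF near_dir_deriv[OF near_dir_deriv[OF \<Phi>_holomorphic]] open_near _ cswap_near \<Phi>_conj2])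

text \<open>Hermitian symmetry of \<open>\<Phi>\<close> exchanges the two blocks under conjugation,
  and commuting the derivatives restores their order; real parts agree.\<close>

lemma metric_symmetric: "bergman_metric \<Omega> z0 v w = bergman_metric \<Omega> z0 w v"
proof -
  have "G v w p0 = cnj (dir_deriv (cpair 0 (cnjv v)) (dir_deriv (cpair w 0) \<Phi>) p0)"
    using \<Phi>_conj2[OF p0_in, of "cpair v 0" "cpair 0 (cnjv w)"] by (simp add: G_def cswap_p0)
  also have "\<dots> = cnj (G w v p0)"
    unfolding G_def dir_deriv_commute[OF \<Phi>_holomorphic open_near p0_in, of "cpair 0 (cnjv v)"] ..
  finally show ?thesis by (simp add: metric_z0)
qed

definition T where "T a b c = dir_deriv a (dir_deriv b (dir_deriv c \<Phi>)) p0"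

lemma T_symmetric: "T a b c = T b a c" "T a b c = T a c b"
proof -
  show "T a b c = T b a c"
    unfolding T_def by (rule dir_deriv_commute[OF near_dir_deriv[OF \<Phi>_holomorphic] open_near p0_in])
  show "T a b c = T a c b"
    unfolding T_def
    by (rule dir_deriv_cong[OF open_near p0_in]) (rule dir_deriv_commute[OF \<Phi>_holomorphic open_near])
qed

lemma T_conj: "T a b c = cnj (T (cswap a) (cswap b) (cswap c))"
  unfolding T_def by (rule \<Phi>_conj3[OF p0_in, unfolded cswap_p0])

lemma G_smult: "q \<in> near \<rho> \<Longrightarrow> G (c *s Y) Z q = c * G Y Z q"
  unfolding G_def cpair_smult by (rule dir_deriv_bilinear(3)[OF \<Phi>_holomorphic open_near])

text \<open>The metric has a potential. Each of the three derivatives is a sum of two third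
  derivatives of \<open>\<Phi>\<close> multiplied by \<open>\<i>\<close>; by symmetry of
  \<open>T\<close> and the reality of the potential the six terms form three conjugate pairs, each
  of which has zero real part after multiplication by \<open>\<i>\<close>.\<close>

lemma metric_closed:
  "dir_deriv X (\<lambda>z. bergman_metric \<Omega> z (\<i> *s Y) Z) z0
    + dir_deriv Y (\<lambda>z. bergman_metric \<Omega> z (\<i> *s Z) X) z0
    + dir_deriv Z (\<lambda>z. bergman_metric \<Omega> z (\<i> *s X) Y) z0 = 0"
proof -
  define h where "h v = cpair v (0::complex^'n)" for v :: "complex^'n"
  define b where "b v = cpair (0::complex^'n) (cnjv v)" for v :: "complex^'n"
  have sw: "cswap (h v) = b v" "cswap (b v) = h v" for v by (simp_all add: h_def b_def)
  have D: "dir_deriv X (\<lambda>z. bergman_metric \<Omega> z (\<i> *s Y) Z) z0 = Re (\<i> * (T (h X) (h Y) (b Z) + T (b X) (h Y) (b Z)))" for X Y Z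
  proof -
    have "dir_deriv (antidiag X) (G (\<i> *s Y) Z) p0 = dir_deriv (antidiag X) (\<lambda>q. \<i> * G Y Z q) p0"
      by (rule dir_deriv_cong[OF open_near p0_in G_smult])
    also have "\<dots> = \<i> * dir_deriv (antidiag X) (G Y Z) p0"
      by (rule dir_deriv_cmult[OF G_holomorphic p0_in])
    also have "dir_deriv (antidiag X) (G Y Z) p0 = T (h X) (h Y) (b Z) + T (b X) (h Y) (b Z)"
      using dir_deriv_linear(1)[OF G_holomorphic p0_in, of "h X" "b X"]
      by (simp only: antidiag_decompose T_def G_def h_def b_def)
    finally show ?thesis
      unfolding metric_deriv[OF V(2), of X "\<i> *s Y" Z, unfolded z0_antidiag] by (rule arg_cong)
  qed
  have c1: "T (b Y) (h Z) (b X) = cnj (T (h X) (h Y) (b Z))"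
  proof -
    have "cnj (T (h X) (h Y) (b Z)) = T (b X) (b Y) (h Z)"
      using T_conj[of "h X" "h Y" "b Z"] by (simp add: sw)
    also have "\<dots> = T (b Y) (b X) (h Z)" by (rule T_symmetric(1))
    also have "\<dots> = T (b Y) (h Z) (b X)" by (rule T_symmetric(2))
    finally show ?thesis by (rule sym)
  qed
  have c2: "T (h Z) (h X) (b Y) = cnj (T (b X) (h Y) (b Z))"
  proof -
    have "cnj (T (b X) (h Y) (b Z)) = T (h X) (b Y) (h Z)"
      using T_conj[of "b X" "h Y" "b Z"] by (simp add: sw)
    also have "\<dots> = T (h X) (h Z) (b Y)" by (rule T_symmetric(2))
    also have "\<dots> = T (h Z) (h X) (b Y)" by (rule T_symmetric(1))
    finally show ?thesis by (rule sym)
  qed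
  have c3: "T (b Z) (h X) (b Y) = cnj (T (h Y) (h Z) (b X))"
  proof -
    have "cnj (T (h Y) (h Z) (b X)) = T (b Y) (b Z) (h X)"
      using T_conj[of "h Y" "h Z" "b X"] by (simp add: sw)
    also have "\<dots> = T (b Z) (b Y) (h X)" by (rule T_symmetric(1))
    also have "\<dots> = T (b Z) (h X) (b Y)" by (rule T_symmetric(2))
    finally show ?thesis by (rule sym)
  qed
  have "Re (\<i> * (a + d)) + Re (\<i> * (c + cnj a)) + Re (\<i> * (cnj d + cnj c)) = 0" for a c d :: complex by simp
  then show ?thesis unfolding D c1 c2 c3 .
qed

lemma metric_local_pullback:
  "\<exists>U V H. open U \<and> open V \<and> z0 \<in> V \<and> holomorphic_several H U \<and>
     (\<forall>z\<in>V. antidiag z \<in> U \<and> bergman_metric \<Omega> z v w = Re (H (antidiag z)))"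
  by (intro exI[of _ "near \<rho>"] exI[of _ V] exI[of _ "G v w"] conjI ballI open_near G_holomorphic V metric_eq)

subsection \<open>Positivity\<close>

lemma Re_\<Phi>:
  assumes "q \<in> near \<rho>" shows "Re (\<Phi> q) = ln (cmod (F q))"
proof -
  have "F q \<noteq> 0" by (rule F_Re_pos(3)[OF assms])
  then show ?thesis using K0_pos by (simp add: \<Phi>_def Re_Ln norm_divide ln_div)
qed

text \<open>With \<open>D(z) = log K(z,z) + log K(z0,z0) - 2 log |K(z,z0)|\<close> (Calabi's diastasis), Bessel's
  inequality bounds \<open>D\<close> from below, while \<open>D(z0 + t v) = t\<^sup>2 g(v,v) + o(t\<^sup>2)\<close> because \<open>D\<close> is a mixed
  difference of \<open>\<Phi>\<close>.\<close>

lemma metric_ge_derivative: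
  assumes f: "f \<in> bergman_space \<Omega>" "f z0 = 0" "0 < l2_norm2 \<Omega> f"
  shows "(cmod (dir_deriv v f z0))^2 \<le> l2_norm2 \<Omega> f * K0 * bergman_metric \<Omega> z0 v v"
proof -
  define Fn where "Fn = l2_norm2 \<Omega> f"
  have Fn: "0 < Fn" using f(3) by (simp add: Fn_def)
  define a b where "a = cpair v (0::complex^'n)" and "b = cpair (0::complex^'n) (cnjv v)"
  define d where "d = dir_deriv v f z0"
  define \<Delta> where "\<Delta> t = (\<Phi> (p0 + t *\<^sub>R (a + b)) - \<Phi> (p0 + t *\<^sub>R a) - \<Phi> (p0 + t *\<^sub>R b) + \<Phi> p0) / of_real (t^2)" for t :: real
  have "(\<Delta> \<longlongrightarrow> dir_deriv a (dir_deriv b \<Phi>) p0) (at 0)"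
    unfolding \<Delta>_def by (rule mixed_difference_limit[OF \<Phi>_holomorphic open_near p0_in])
  then have lim\<Delta>: "((\<lambda>t. Re (\<Delta> t)) \<longlongrightarrow> Re (G v v p0)) (at 0)"
    unfolding G_def a_def b_def by (rule tendsto_Re)
  have fh: "holomorphic_several f \<Omega>" using f by (simp add: bergman_space_iff)
  have "((\<lambda>\<zeta>. f (z0 + \<zeta> *s v)) has_field_derivative d) (at 0)"
    using holomorphic_several_line[OF fh, of z0 0 v] z0 by (simp add: d_def)
  then have "((\<lambda>\<zeta>. f (z0 + \<zeta> *s v) / \<zeta>) \<longlongrightarrow> d) (at 0)"
    by (simp add: has_field_derivative_iff f(2))
  moreover have "filterlim (\<lambda>t::real. complex_of_real t) (at 0) (at 0)"
    unfolding filterlim_at by (auto intro!: tendsto_eq_intros simp: eventually_at_filter)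
  ultimately have "((\<lambda>t::real. f (z0 + of_real t *s v) / of_real t) \<longlongrightarrow> d) (at 0)"
    by (rule filterlim_compose)
  then have limf: "((\<lambda>t::real. f (z0 + t *\<^sub>R v) / of_real t) \<longlongrightarrow> d) (at 0)" by (simp only: scaleR_eq_smult)
  have line: "((\<lambda>t::real. z0 + t *\<^sub>R v) \<longlongrightarrow> z0) (at 0)" by (auto intro!: tendsto_eq_intros)
  have "isCont (\<lambda>z. k z z0) z0"
    by (rule has_derivative_continuous[OF holomorphic_several_derivative(1)[OF kernel_holomorphic[OF z0] z0]])
  then have limk: "((\<lambda>t::real. k (z0 + t *\<^sub>R v) z0) \<longlongrightarrow> of_real K0) (at 0)"
    unfolding kernel_diagonal[OF z0] using line by (rule isCont_tendsto_compose)
  \<comment> \<open>The relative size of the second Bessel term, divided by \<open>t^2\<close>.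
    Grouping the division with \<open>f\<close> exposes the difference quotient, since
    \<open>f\<close> vanishes at \<open>z0\<close>.\<close>
  define r where "r t = (cmod (f (z0 + t *\<^sub>R v) / of_real t))^2 * K0 / (Fn * (cmod (k (z0 + t *\<^sub>R v) z0))^2)" for t :: real
  have "(r \<longlongrightarrow> (cmod d)^2 * K0 / (Fn * (cmod (of_real K0))^2)) (at 0)"
    unfolding r_def using K0_pos Fn by (intro tendsto_intros limf limk) auto
  then have limr: "(r \<longlongrightarrow> (cmod d)^2 / (Fn * K0)) (at 0)" using K0_pos by (simp add: power2_eq_square)
  have "((\<lambda>t. r t / (1 + r t * t^2)) \<longlongrightarrow> ((cmod d)^2 / (Fn * K0)) / (1 + ((cmod d)^2 / (Fn * K0)) * 0^2)) (at 0)"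
    by (intro tendsto_intros limr) simp
  then have lim2: "((\<lambda>t. r t / (1 + r t * t^2)) \<longlongrightarrow> (cmod d)^2 / (Fn * K0)) (at 0)" by simp
  have "\<forall>\<^sub>F t in at (0::real). z0 + t *\<^sub>R v \<in> V" using line V(1,2) by (rule topological_tendstoD)
  moreover have "\<forall>\<^sub>F t in at (0::real). t \<noteq> 0" by (simp add: eventually_at_filter)
  ultimately have "\<forall>\<^sub>F t in at 0. r t / (1 + r t * t^2) \<le> Re (\<Delta> t)"
  proof eventually_elim
    case (elim t)
    define z where "z = z0 + t *\<^sub>R v"
    have z: "z \<in> V" "z \<in> \<Omega>" using elim V(4) by (auto simp: z_def)
    have Nz: "N (t *\<^sub>R v) < \<rho> / 2" using z(1) by (simp add: V_def z_def)
    have pa: "p0 + t *\<^sub>R a = cpair z (cnjv z0)" and pb: "p0 + t *\<^sub>R b = cpair z0 (cnjv z)"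
      and pab: "p0 + t *\<^sub>R (a + b) = antidiag z"
      by (simp_all add: p0_def a_def b_def z_def antidiag_def cpair_linear cnjv_linear)
    have qa: "p0 + t *\<^sub>R a \<in> near \<rho>" "p0 + t *\<^sub>R b \<in> near \<rho>"
      using Nz \<rho>(1) by (simp_all add: near_def a_def b_def cpair_linear cnjv_linear[symmetric])
    have kne: "k z z0 \<noteq> 0" using F_Re_pos(3)[OF qa(1)] unfolding pa by (simp add: F_def)
    have kz: "0 < cmod (k z z0)" using kne by simp
    have K: "0 < Re (k z z)" by (rule kernel_pos[OF z(2)])
    have sw: "cmod (k z0 z) = cmod (k z z0)" unfolding kernel_cnj[OF z0 z(2)] by simp
    define s where "s = (cmod (f z))^2 * K0 / (Fn * (cmod (k z z0))^2)"
    have s0: "0 \<le> s" using Fn K0_pos by (simp add: s_def)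
    have rt: "r t * t^2 = s"
      using elim by (simp add: r_def s_def z_def norm_divide power_divide)
    \<comment> \<open>Bessel's inequality multiplied by \<open>K0 / (cmod (k z z0))^2\<close>, which
      turns the contribution of the kernel function into 1.\<close>
    have "1 + s \<le> Re (k z z) * K0 / (cmod (k z z0))^2"
    proof -
      have "1 + s = ((cmod (k z z0))^2 / K0 + (cmod (f z))^2 / Fn) * (K0 / (cmod (k z z0))^2)"
        using K0_pos kz Fn by (simp add: s_def field_simps)
      also have "\<dots> \<le> Re (k z z) * (K0 / (cmod (k z z0))^2)"
        using kernel_bessel[OF z(2) z0 f] K0_pos by (intro mult_right_mono) (auto simp: Fn_def)
      finally show ?thesis by simp
    qed
    then have "ln (1 + s) \<le> ln (Re (k z z) * K0 / (cmod (k z z0))^2)"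
      using s0 by (subst ln_le_cancel_iff) auto
    also have "\<dots> = ln (Re (k z z)) + ln K0 - 2 * ln (cmod (k z z0))"
      using K K0_pos kz by (simp add: ln_div ln_mult ln_realpow)
    \<comment> \<open>The logarithms are the real parts of \<open>\<Phi>\<close> at the four corners
      of the mixed difference; the two off-diagonal corners agree by Hermitian symmetry.\<close>
    also have "\<dots> = Re (\<Phi> (p0 + t *\<^sub>R (a + b)) - \<Phi> (p0 + t *\<^sub>R a) - \<Phi> (p0 + t *\<^sub>R b) + \<Phi> p0)"
    proof -
      have "Re (\<Phi> (p0 + t *\<^sub>R (a + b))) = ln (Re (k z z))"
        unfolding pab using \<Phi>_antidiag[of z] z(1) by (simp add: V_def)
      moreover have "Re (\<Phi> (p0 + t *\<^sub>R a)) = ln (cmod (k z z0))"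
        unfolding Re_\<Phi>[OF qa(1)] by (simp add: pa F_def)
      moreover have "Re (\<Phi> (p0 + t *\<^sub>R b)) = ln (cmod (k z z0))"
        unfolding Re_\<Phi>[OF qa(2)] by (simp add: pb F_def sw)
      moreover have "Re (\<Phi> p0) = ln K0" unfolding Re_\<Phi>[OF p0_in] F_p0 using K0_pos by simp
      ultimately show ?thesis by simp
    qed
    finally have "s / (1 + s) \<le> Re (\<Phi> (p0 + t *\<^sub>R (a + b)) - \<Phi> (p0 + t *\<^sub>R a) - \<Phi> (p0 + t *\<^sub>R b) + \<Phi> p0)"
      using ln_one_plus_ge[OF s0] by linarith
    then have "s / (1 + s) / t^2 \<le> Re (\<Delta> t)"
      unfolding \<Delta>_def Re_divide_of_real by (intro divide_right_mono) auto
    moreover have "s / (1 + s) / t^2 = r t / (1 + r t * t^2)"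
      unfolding rt unfolding rt[symmetric] using elim by simp
    ultimately show ?case by simp
  qed
  then have "(cmod d)^2 / (Fn * K0) \<le> Re (G v v p0)"
    by (rule tendsto_le[OF trivial_limit_at lim\<Delta> lim2])
  then show ?thesis using Fn K0_pos by (simp add: metric_z0 d_def Fn_def divide_le_eq mult_ac)
qed

text \<open>The comparison is made with \<open>linear_weight j\<close> for a coordinate
  \<open>j\<close> carrying at least the average share of \<open>N v\<close>; that average gives the
  factor \<open>(real CARD('n))^2\<close>. The Jacobian in the norm of the test function cancels
  against the one in the upper bound for \<open>K0\<close>.\<close>

lemma metric_lower: "(N v)^2 \<le> (real CARD('n))^2 * kernel_ratio TYPE('n) * bergman_metric \<Omega> z0 v v"
proof (cases "v = 0")
  case True
  then show ?thesis using bergman_form_linear(3)[of \<Omega> z0 0 0 0] by (simp add: bergman_metric_def)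
next
  case False
  define n where "n = real CARD('n)"
  have "\<exists>j. N v \<le> n * cmod ((A *v v) $ j)"
  proof (rule ccontr)
    assume "\<not> (\<exists>j. N v \<le> n * cmod ((A *v v) $ j))"
    then have "(\<Sum>j\<in>(UNIV::'n set). n * cmod ((A *v v) $ j)) < (\<Sum>j\<in>(UNIV::'n set). N v)"
      by (intro sum_strict_mono) (auto simp: not_le)
    then show False by (simp add: n_def N_def sum_distrib_left)
  qed
  then obtain j where j: "N v \<le> n * cmod ((A *v v) $ j)" by blast
  define w C L where "w = weight_at_zero TYPE('n)" and "C = decay_mass TYPE('n)" and "L = l1_volume TYPE('n)"
  have pos: "0 < w" "0 < C" "0 < L" "0 < \<kappa>"
    using l1_volume_pos[where 'n='n] decay_mass_pos weight_at_zero_pos[of "TYPE('n)"] \<kappa>(1)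
    by (simp_all add: w_def C_def L_def)
  let ?f = "linear_weight j" and ?g = "bergman_metric \<Omega> z0 v v"
  have "0 < N v" using False N_eq_0[of v] N_nonneg[of v] by linarith
  then have "(A *v v) $ j \<noteq> 0" using j by auto
  then have "dir_deriv v ?f z0 \<noteq> 0" unfolding linear_weight_z0(2) using pos by (simp add: w_def)
  moreover have "dir_deriv v (\<lambda>_. 0::complex) z0 = 0" by (rule dir_deriv_eqI[OF has_derivative_const])
  ultimately have "?f \<noteq> (\<lambda>_. 0)" by metis
  \<comment> \<open>A nonzero derivative shows that the test function is not identically zero, so
    its norm is positive and Bessel's inequality can be used.\<close>
  then have F: "0 < l2_norm2 \<Omega> ?f"
    using l2_zero_imp_zero[OF linear_weight_space(1)] l2_norm2_nonneg[of ?f] unfolding less_le by force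
  have le: "(cmod ((A *v v) $ j))^2 * w^2 \<le> l2_norm2 \<Omega> ?f * K0 * ?g"
    using metric_ge_derivative[OF linear_weight_space(1) linear_weight_z0(1) F, of v]
    unfolding linear_weight_z0(2) by (simp add: norm_mult power_mult_distrib w_def)
  have g0: "0 \<le> ?g"
  proof -
    have "0 \<le> (l2_norm2 \<Omega> ?f * K0) * ?g" using le by (rule order_trans[rotated]) simp
    then show ?thesis
      using mult_le_cancel_left_pos[OF mult_pos_pos[OF F K0_pos], of 0 ?g] by simp
  qed
  have "l2_norm2 \<Omega> ?f * K0 \<le> C / L"
  proof -
    have "l2_norm2 \<Omega> ?f * (K0 * (\<kappa> * L)) \<le> (\<kappa> * C) * 1"
      using linear_weight_space(2)[of j] kernel_le_volume[of z0] F K0_pos pos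
      by (intro mult_mono) (auto simp: C_def L_def)
    then have "(l2_norm2 \<Omega> ?f * K0 * L) * \<kappa> \<le> C * \<kappa>" by (simp add: mult_ac)
    then have "l2_norm2 \<Omega> ?f * K0 * L \<le> C" using pos by (simp only: mult_le_cancel_right_pos)
    then show ?thesis using pos by (simp add: pos_le_divide_eq)
  qed
  from order_trans[OF le mult_right_mono[OF this g0]]
  have "(cmod ((A *v v) $ j))^2 * w^2 \<le> C / L * ?g" .
  then have comp: "(cmod ((A *v v) $ j))^2 \<le> kernel_ratio TYPE('n) * ?g"
    using pos by (simp add: kernel_ratio_def C_def[symmetric] L_def[symmetric] w_def[symmetric] field_simps)
  have "(N v)^2 \<le> (n * cmod ((A *v v) $ j))^2" using j N_nonneg by (rule power_mono)
  also have "\<dots> \<le> n^2 * (kernel_ratio TYPE('n) * ?g)"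
    unfolding power_mult_distrib using comp by (intro mult_left_mono) auto
  finally show ?thesis by (simp add: n_def mult_ac)
qed

lemma metric_pos: "v \<noteq> 0 \<Longrightarrow> 0 < bergman_metric \<Omega> z0 v v"
proof -
  assume "v \<noteq> 0"
  then have "0 < N v" using N_eq_0[of v] N_nonneg[of v] by (cases "N v = 0") auto
  then have "0 < (N v)^2" by simp
  then have "0 < ((real CARD('n))^2 * kernel_ratio TYPE('n)) * bergman_metric \<Omega> z0 v v"
    using metric_lower[of v] by linarith
  moreover have "0 < (real CARD('n))^2 * kernel_ratio TYPE('n)" using kernel_ratio_ge_1 by simp
  ultimately show "0 < bergman_metric \<Omega> z0 v v" by (simp only: zero_less_mult_pos)
qed

end

subsection \<open>Comparison of the Bergman metric with the Kobayashi metric\<close>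

text \<open>The value of \<open>\<sigma>\<close> as a function of the index type, so that the final
  constant can be fixed before any domain is given.\<close>

definition frame_scale :: "'n::finite itself \<Rightarrow> real" where
  "frame_scale T = 8 / frame_radius T"

context adapted_frame
begin

abbreviation "kob v \<equiv> kobayashi_metric \<Omega> z0 v"

lemma \<sigma>_eq: "\<sigma> = frame_scale TYPE('n)" by (simp add: \<sigma>_def frame_scale_def \<rho>_def)

lemma \<sigma>_pos: "0 < \<sigma>" using \<rho>(1) by (simp add: \<sigma>_def)

lemma N_le_kob: "N v \<le> (2 * real CARD('n)) * kob v" using N_le_kobayashi[of v] by simp

lemma sqrt_metric_le: "sqrt (bergman_metric \<Omega> z0 v v) \<le> sqrt (1 + pi) * \<sigma> * (2 * real CARD('n)) * kob v"
proof -
  have "bergman_metric \<Omega> z0 v v \<le> cmod (G v v p0)" unfolding metric_z0 by (rule complex_Re_le_cmod)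
  also have "\<dots> \<le> (1 + pi) * \<sigma>^2 * N v * N v" by (rule G_bounds(1)[OF p0_near]) (use \<rho>(1) in simp)
  also have "\<dots> = (1 + pi) * (\<sigma> * N v)^2" by (simp add: power2_eq_square mult_ac)
  finally have "sqrt (bergman_metric \<Omega> z0 v v) \<le> sqrt ((1 + pi) * (\<sigma> * N v)^2)" by (rule real_sqrt_le_mono)
  also have "\<dots> = sqrt (1 + pi) * \<sigma> * N v"
    using \<sigma>_pos N_nonneg[of v] by (simp add: real_sqrt_mult)
  also have "\<dots> \<le> sqrt (1 + pi) * \<sigma> * ((2 * real CARD('n)) * kob v)"
    using \<sigma>_pos N_le_kob pi_ge_zero by (intro mult_left_mono) auto
  finally show ?thesis by (simp add: mult.assoc)
qed

lemma kob_le_sqrt_metric: "kob v \<le> real CARD('n) * sqrt (kernel_ratio TYPE('n)) * sqrt (bergman_metric \<Omega> z0 v v)"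
proof -
  have "N v \<le> sqrt ((real CARD('n))^2 * kernel_ratio TYPE('n) * bergman_metric \<Omega> z0 v v)"
    by (rule real_le_rsqrt[OF metric_lower])
  then show ?thesis using kobayashi_le[of v] by (simp add: real_sqrt_mult)
qed

lemma N_product3: "N v * N w * N X \<le> (2 * real CARD('n))^3 * (kob X * kob v * kob w)"
proof -
  have "N v * N w * N X \<le> ((2 * real CARD('n)) * kob v) * ((2 * real CARD('n)) * kob w) * ((2 * real CARD('n)) * kob X)"
    by (intro mult_mono N_le_kob mult_nonneg_nonneg N_nonneg kobayashi_nonneg) simp_all
  then show ?thesis by (simp add: power3_eq_cube mult_ac)
qed

lemma N_product4: "N v * N w * N X * N Y \<le> (2 * real CARD('n))^4 * (kob Y * kob X * kob v * kob w)"
proof -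
  have "N v * N w * N X * N Y \<le> ((2 * real CARD('n)) * kob v) * ((2 * real CARD('n)) * kob w) * ((2 * real CARD('n)) * kob X) * ((2 * real CARD('n)) * kob Y)"
    by (intro mult_mono N_le_kob mult_nonneg_nonneg N_nonneg kobayashi_nonneg) simp_all
  also have "\<dots> = (2 * real CARD('n))^4 * (kob Y * kob X * kob v * kob w)" by (simp add: eval_nat_numeral mult_ac)
  finally show ?thesis .
qed

lemma metric_deriv_bound:
  "\<bar>dir_deriv X (\<lambda>z. bergman_metric \<Omega> z v w) z0\<bar> \<le> (1 + pi) * \<sigma>^3 * 2 * (2 * real CARD('n))^3 * (kob X * kob v * kob w)"
proof -
  have "\<bar>dir_deriv X (\<lambda>z. bergman_metric \<Omega> z v w) z0\<bar> \<le> cmod (dir_deriv (antidiag X) (G v w) p0)"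
    unfolding metric_deriv[OF V(2)] z0_antidiag by (rule abs_Re_le_cmod)
  also have "\<dots> \<le> (1 + pi) * \<sigma>^3 * N v * N w * N2 (antidiag X)"
    by (rule G_bounds(2)[OF p0_near]) (use \<rho>(1) in simp)
  also have "\<dots> = ((1 + pi) * \<sigma>^3 * 2) * (N v * N w * N X)" by simp
  also have "\<dots> \<le> ((1 + pi) * \<sigma>^3 * 2) * ((2 * real CARD('n))^3 * (kob X * kob v * kob w))"
    using \<sigma>_pos pi_ge_zero by (intro mult_left_mono N_product3) auto
  finally show ?thesis by (simp only: mult.assoc)
qed

lemma metric_deriv2_bound:
  "\<bar>dir_deriv Y (dir_deriv X (\<lambda>z. bergman_metric \<Omega> z v w)) z0\<bar>
    \<le> (1 + pi) * \<sigma>^4 * 4 * (2 * real CARD('n))^4 * (kob Y * kob X * kob v * kob w)"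
proof -
  have "\<bar>dir_deriv Y (dir_deriv X (\<lambda>z. bergman_metric \<Omega> z v w)) z0\<bar>
      \<le> cmod (dir_deriv (antidiag Y) (dir_deriv (antidiag X) (G v w)) p0)"
    unfolding metric_deriv2[OF V(2)] z0_antidiag by (rule abs_Re_le_cmod)
  also have "\<dots> \<le> (1 + pi) * \<sigma>^4 * N v * N w * N2 (antidiag X) * N2 (antidiag Y)"
    by (rule G_bounds(3)[OF p0_near]) (use \<rho>(1) in simp)
  also have "\<dots> = ((1 + pi) * \<sigma>^4 * 4) * (N v * N w * N X * N Y)" by simp
  also have "\<dots> \<le> ((1 + pi) * \<sigma>^4 * 4) * ((2 * real CARD('n))^4 * (kob Y * kob X * kob v * kob w))"
    using \<sigma>_pos pi_ge_zero by (intro mult_left_mono N_product4) auto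
  finally show ?thesis by (simp only: mult.assoc)
qed

text \<open>The smallness hypothesis on the Kobayashi distance says that \<open>q\<close> lies
  within frame distance \<open>\<rho> / 8\<close> of \<open>z0\<close>, inside the region of the
  third-derivative bound. Both points are then treated in the frame of \<open>z0\<close>, and the
  Kobayashi factors are those at \<open>z0\<close> only.\<close>

lemma metric_deriv2_lipschitz:
  assumes q: "q \<in> \<Omega>" and K: "kobayashi_dist \<Omega> z0 q * (2 * (2 * real CARD('n)) * \<sigma>) \<le> 1"
  shows "\<bar>dir_deriv Y (dir_deriv X (\<lambda>z. bergman_metric \<Omega> z v w)) z0
      - dir_deriv Y (dir_deriv X (\<lambda>z. bergman_metric \<Omega> z v w)) q\<bar>
    \<le> (1 + pi) * \<sigma>^5 * 16 * (2 * real CARD('n))^5 * (kob Y * kob X * kob v * kob w) * kobayashi_dist \<Omega> z0 q"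
proof -
  let ?\<kappa> = "kobayashi_dist \<Omega> z0 q"
  let ?f = "dir_deriv (antidiag Y) (dir_deriv (antidiag X) (G v w))"
  have k0: "0 \<le> ?\<kappa>" by (rule kobayashi_dist_nonneg[OF q])
  have c2: "2 \<le> (2 * real CARD('n))" by (simp add: Suc_le_eq)
  \<comment> \<open>From \<open>\<rho> \<le> 1/8\<close>. It makes the hypothesis strong enough to
    force the distance below 1/2, as the comparison of \<open>N\<close> with the Kobayashi distance
    demands.\<close>
  have "64 \<le> \<sigma>" using \<rho>(1,2) by (simp add: \<sigma>_def field_simps)
  then have "2 * 2 * 64 \<le> 2 * (2 * real CARD('n)) * \<sigma>" using c2 by (intro mult_mono) auto
  then have "?\<kappa> * 2 \<le> ?\<kappa> * (2 * (2 * real CARD('n)) * \<sigma>)" using k0 by (intro mult_left_mono) auto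
  then have "?\<kappa> \<le> 1/2" using K by linarith
  then have Nq: "N (q - z0) \<le> 2 * (2 * real CARD('n)) * ?\<kappa>" using N_le_kobayashi_dist[OF q] by simp
  have "N (q - z0) * \<sigma> \<le> (2 * (2 * real CARD('n)) * ?\<kappa>) * \<sigma>" using Nq \<sigma>_pos by (intro mult_right_mono) auto
  also have "\<dots> \<le> 1" using K by (simp add: mult_ac)
  finally have "N (q - z0) \<le> \<rho> / 8" using \<rho>(1) by (simp add: \<sigma>_def field_simps)
  then have qn: "q \<in> V" "antidiag q \<in> near (3/8 * \<rho>)" using \<rho>(1) by (simp_all add: V_def antidiag_near)
  have sub: "near (3/8 * \<rho>) \<subseteq> near \<rho>" using \<rho>(1) by (intro near_mono) simp
  have "cmod (?f (antidiag q) - ?f p0) \<le> ((1 + pi) * \<sigma>^5 * N v * N w * N2 (antidiag X) * N2 (antidiag Y)) * N2 (antidiag q - p0)"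
    by (rule near_lipschitz[OF holomorphic_several_subset[OF near_dir_deriv[OF near_dir_deriv[OF G_holomorphic]] sub] G_bounds(4) qn(2)])
  also have "antidiag q - p0 = antidiag (q - z0)" by (simp add: p0_def antidiag_linear)
  \<comment> \<open>The 8 comes from three applications of \<open>antidiag\<close>, each doubling
    \<open>N\<close>; the bound for \<open>N (q - z0)\<close> later adds the remaining factor
    2.\<close>
  also have "((1 + pi) * \<sigma>^5 * N v * N w * N2 (antidiag X) * N2 (antidiag Y)) * N2 (antidiag (q - z0))
      = ((1 + pi) * \<sigma>^5 * 8) * (N v * N w * N X * N Y) * N (q - z0)" by simp
  also have "\<dots> \<le> ((1 + pi) * \<sigma>^5 * 8) * ((2 * real CARD('n))^4 * (kob Y * kob X * kob v * kob w)) * (2 * (2 * real CARD('n)) * ?\<kappa>)"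
    using \<sigma>_pos pi_ge_zero
    by (intro mult_mono[OF mult_left_mono[OF N_product4] Nq] N_nonneg mult_nonneg_nonneg kobayashi_nonneg) auto
  also have "\<dots> = (1 + pi) * \<sigma>^5 * 16 * (2 * real CARD('n))^5 * (kob Y * kob X * kob v * kob w) * ?\<kappa>"
    by (simp add: eval_nat_numeral mult_ac)
  finally have "cmod (?f p0 - ?f (antidiag q)) \<le> (1 + pi) * \<sigma>^5 * 16 * (2 * real CARD('n))^5 * (kob Y * kob X * kob v * kob w) * ?\<kappa>"
    by (simp only: norm_minus_commute)
  then show ?thesis
    unfolding metric_deriv2[OF V(2)] metric_deriv2[OF qn(1)] z0_antidiag minus_complex.sel(1)[symmetric]
    using abs_Re_le_cmod order_trans by blast
qed

end

section \<open>Verification of the defining conditions\<close>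

lemma kahler_bergman_metric:
  assumes \<Omega>: "\<Omega> \<in> convex_domains_no_line"
  shows "Ck_on m \<Omega> (\<lambda>z. bergman_metric \<Omega> z v w)" and "kahler_metric \<Omega> (bergman_metric \<Omega>)"
proof -
  have fr: "\<exists>A. adapted_frame \<Omega> z A" if "z \<in> \<Omega>" for z by (rule exists_adapted_frame[OF \<Omega> that])
  show Ck: "Ck_on m \<Omega> (\<lambda>z. bergman_metric \<Omega> z v w)" for m v w
  proof (rule Ck_on_pullback)
    fix z0 assume "z0 \<in> \<Omega>"
    then obtain A where "adapted_frame \<Omega> z0 A" using fr by blast
    then interpret adapted_frame \<Omega> z0 A .
    show "\<exists>U V G. open U \<and> open V \<and> z0 \<in> V \<and> holomorphic_several G U \<and>
     (\<forall>z\<in>V. antidiag z \<in> U \<and> bergman_metric \<Omega> z v w = Re (G (antidiag z)))"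
      by (rule metric_local_pullback)
  qed
  have sym: "bergman_metric \<Omega> z v w = bergman_metric \<Omega> z w v" if "z \<in> \<Omega>" for z v w
    using adapted_frame.metric_symmetric fr[OF that] by blast
  have pos: "0 < bergman_metric \<Omega> z v v" if "z \<in> \<Omega>" "v \<noteq> 0" for z v
    using adapted_frame.metric_pos fr[OF that(1)] that(2) by blast
  have closed: "dir_deriv X (\<lambda>z. bergman_metric \<Omega> z (\<i> *s Y) Z) z
                  + dir_deriv Y (\<lambda>z. bergman_metric \<Omega> z (\<i> *s Z) X) z
                  + dir_deriv Z (\<lambda>z. bergman_metric \<Omega> z (\<i> *s X) Y) z = 0" if z: "z \<in> \<Omega>" for X Y Z z
  proof -
    obtain A where "adapted_frame \<Omega> z A" using fr[OF z] by blast
    then interpret adapted_frame \<Omega> z A .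
    show ?thesis by (rule metric_closed)
  qed
  show "kahler_metric \<Omega> (bergman_metric \<Omega>)"
    unfolding kahler_metric_def
    by (intro conjI ballI allI impI bilinear_bergman_metric sym pos bergman_metric_J Ck closed)
qed

theorem proposition9p1:
  shows "\<exists>M::real. M > 1 \<and>
    (\<forall>\<Omega>::(complex ^ 'n) set. \<Omega> \<in> convex_domains_no_line \<longrightarrow>
       bergman_metric \<Omega> \<in> kobayashi_bounded_metrics M \<Omega>)"
proof -
  \<comment> \<open>\<open>c\<close> is the loss in replacing the frame norm by the Kobayashi metric
    and \<open>s\<close> the cost of one Cauchy step.\<close>
  define c s where "c = 2 * real CARD('n)" and "s = frame_scale TYPE('n)"
  define m1 where "m1 = sqrt (1 + pi) * s * c"
  define m2 where "m2 = real CARD('n) * sqrt (kernel_ratio TYPE('n))"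
  define m3 where "m3 = (1 + pi) * s^3 * 2 * c^3"
  define m4 where "m4 = (1 + pi) * s^4 * 4 * c^4"
  define m5 where "m5 = (1 + pi) * s^5 * 16 * c^5"
  \<comment> \<open>Serves pairs of points that are far apart: twice the second-derivative bound,
    multiplied by the reciprocal of the distance threshold.\<close>
  define m6 where "m6 = 2 * m4 * (2 * c * s)"
  define M where "M = 2 + \<bar>m1\<bar> + \<bar>m2\<bar> + \<bar>m3\<bar> + \<bar>m4\<bar> + \<bar>m5\<bar> + \<bar>m6\<bar>"
  have M: "1 < M" "0 < M" "m1 \<le> M" "m2 \<le> M" "m3 \<le> M" "m4 \<le> M" "m5 \<le> M" "m6 \<le> M" unfolding M_def by linarith+
  have "bergman_metric \<Omega> \<in> kobayashi_bounded_metrics M \<Omega>"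
    if \<Omega>: "\<Omega> \<in> convex_domains_no_line" for \<Omega> :: "(complex ^ 'n) set"
  proof -
    let ?k = "kobayashi_metric \<Omega>" and ?g = "bergman_metric \<Omega>"
    have fr: "\<exists>A. adapted_frame \<Omega> z A" if "z \<in> \<Omega>" for z by (rule exists_adapted_frame[OF \<Omega> that])
    have k0: "0 \<le> ?k z v" if "z \<in> \<Omega>" for z v
      using adapted_frame.kobayashi_nonneg fr[OF that] by blast
    have b1: "1 / M * sqrt (?g z v v) \<le> ?k z v" if z: "z \<in> \<Omega>" for z v
    proof -
      obtain A where "adapted_frame \<Omega> z A" using fr[OF z] by blast
      then interpret adapted_frame \<Omega> z A .
      have "sqrt (?g z v v) \<le> m1 * ?k z v"
        using sqrt_metric_le[of v] unfolding \<sigma>_eq m1_def c_def s_def .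
      also have "\<dots> \<le> M * ?k z v" using M(3) k0[OF z] by (intro mult_right_mono)
      finally show ?thesis using M(2) by (simp add: divide_le_eq mult.commute)
    qed
    have b2: "?k z v \<le> M * sqrt (?g z v v)" if z: "z \<in> \<Omega>" for z v
    proof -
      obtain A where "adapted_frame \<Omega> z A" using fr[OF z] by blast
      then interpret adapted_frame \<Omega> z A .
      have g0: "0 \<le> ?g z v v"
        using metric_pos[of v] bergman_form_linear(3)[of \<Omega> z 0 0 0] by (cases "v = 0") (auto simp: bergman_metric_def)
      have "?k z v \<le> m2 * sqrt (?g z v v)" unfolding m2_def by (rule kob_le_sqrt_metric)
      also have "\<dots> \<le> M * sqrt (?g z v v)" using M(4) g0 by (intro mult_right_mono) auto
      finally show ?thesis .
    qed
    have b3: "\<bar>dir_deriv X (\<lambda>z. ?g z v w) z\<bar> \<le> M * ?k z X * ?k z v * ?k z w" if z: "z \<in> \<Omega>" for z X v w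
    proof -
      obtain A where "adapted_frame \<Omega> z A" using fr[OF z] by blast
      then interpret adapted_frame \<Omega> z A .
      have "\<bar>dir_deriv X (\<lambda>z. ?g z v w) z\<bar> \<le> m3 * (?k z X * ?k z v * ?k z w)"
        using metric_deriv_bound[of X v w] unfolding \<sigma>_eq m3_def c_def s_def .
      also have "\<dots> \<le> M * (?k z X * ?k z v * ?k z w)"
        using M(5) k0[OF z] by (intro mult_right_mono mult_nonneg_nonneg)
      finally show ?thesis by (simp only: mult.assoc)
    qed
    \<comment> \<open>Kept with the constant \<open>m4\<close> instead of \<open>M\<close>, because
      \<open>M\<close> itself is built from \<open>m6\<close>, a multiple of
      \<open>m4\<close>.\<close>
    have b4': "\<bar>dir_deriv Y (dir_deriv X (\<lambda>z. ?g z v w)) z\<bar> \<le> m4 * (?k z Y * ?k z X * ?k z v * ?k z w)" if z: "z \<in> \<Omega>" for z X Y v w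
    proof -
      obtain A where "adapted_frame \<Omega> z A" using fr[OF z] by blast
      then interpret adapted_frame \<Omega> z A .
      show ?thesis using metric_deriv2_bound[of Y X v w] unfolding \<sigma>_eq m4_def c_def s_def .
    qed
    have b4: "\<bar>dir_deriv Y (dir_deriv X (\<lambda>z. ?g z v w)) z\<bar> \<le> M * ?k z Y * ?k z X * ?k z v * ?k z w" if z: "z \<in> \<Omega>" for z X Y v w
    proof -
      have "m4 * (?k z Y * ?k z X * ?k z v * ?k z w) \<le> M * (?k z Y * ?k z X * ?k z v * ?k z w)"
        using M(6) k0[OF z] by (intro mult_right_mono mult_nonneg_nonneg)
      then show ?thesis using b4'[OF z, of Y X v w] by (simp only: mult.assoc)
    qed
    have b5: "\<bar>dir_deriv Y (dir_deriv X (\<lambda>z. ?g z v w)) z1 - dir_deriv Y (dir_deriv X (\<lambda>z. ?g z v w)) z2\<bar>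
         \<le> M * max (?k z1 Y * ?k z1 X * ?k z1 v * ?k z1 w) (?k z2 Y * ?k z2 X * ?k z2 v * ?k z2 w)
             * kobayashi_dist \<Omega> z1 z2" if z: "z1 \<in> \<Omega>" "z2 \<in> \<Omega>" for X Y v w z1 z2
    proof -
      obtain A where "adapted_frame \<Omega> z1 A" using fr[OF z(1)] by blast
      then interpret adapted_frame \<Omega> z1 A .
      define Q where "Q z = ?k z Y * ?k z X * ?k z v * ?k z w" for z
      define mx where "mx = max (Q z1) (Q z2)"
      define \<kappa>' where "\<kappa>' = kobayashi_dist \<Omega> z1 z2"
      let ?D = "dir_deriv Y (dir_deriv X (\<lambda>z. ?g z v w))"
      have Q0: "0 \<le> Q z1" "0 \<le> Q z2" unfolding Q_def by (intro mult_nonneg_nonneg k0 z)+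
      have mx: "0 \<le> mx" "Q z1 \<le> mx" "Q z2 \<le> mx" using Q0 by (auto simp: mx_def)
      have \<kappa>0: "0 \<le> \<kappa>'" unfolding \<kappa>'_def by (rule kobayashi_dist_nonneg[OF z(2)])
      have s0: "0 < s" using \<sigma>_pos by (simp add: \<sigma>_eq s_def)
      have c0: "0 < c" by (simp add: c_def)
      have "\<bar>?D z1 - ?D z2\<bar> \<le> M * mx * \<kappa>'"
      \<comment> \<open>Nearby points are handled in the frame at \<open>z1\<close>. For distant
        ones the triangle inequality with the bounds at both points suffices, since the distance
        times \<open>2 * c * s\<close> exceeds 1; the maximum over the two points is needed only
        there.\<close>
      proof (cases "\<kappa>' * (2 * c * s) \<le> 1")
        case True
        then have "\<bar>?D z1 - ?D z2\<bar> \<le> m5 * Q z1 * \<kappa>'"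
          using metric_deriv2_lipschitz[OF z(2), of Y X v w] unfolding \<sigma>_eq m5_def c_def s_def \<kappa>'_def Q_def by simp
        also have "\<dots> \<le> M * mx * \<kappa>'"
          using M mx Q0 \<kappa>0 by (intro mult_mono mult_nonneg_nonneg) auto
        finally show ?thesis .
      next
        case False
        have m4: "0 \<le> m4" using s0 c0 pi_ge_zero by (simp add: m4_def)
        have "\<bar>?D z1\<bar> \<le> m4 * Q z1" "\<bar>?D z2\<bar> \<le> m4 * Q z2" using b4' z unfolding Q_def by blast+
        moreover have "m4 * Q z1 \<le> m4 * mx" "m4 * Q z2 \<le> m4 * mx" using m4 mx by (auto intro: mult_left_mono)
        ultimately have "\<bar>?D z1 - ?D z2\<bar> \<le> 2 * m4 * mx * 1" by linarith
        also have "\<dots> \<le> 2 * m4 * mx * (\<kappa>' * (2 * c * s))"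
          using False m4 mx by (intro mult_left_mono) auto
        also have "\<dots> = m6 * mx * \<kappa>'" by (simp add: m6_def mult_ac)
        also have "\<dots> \<le> M * mx * \<kappa>'" using M(8) mx \<kappa>0 by (intro mult_right_mono) auto
        finally show ?thesis .
      qed
      then show ?thesis by (simp only: mx_def Q_def \<kappa>'_def)
    qed
    show ?thesis
      unfolding kobayashi_bounded_metrics_def Let_def mem_Collect_eq
      by (intro conjI ballI allI kahler_bergman_metric[OF \<Omega>] b1 b2 b3 b4 b5)
  qed
  then show ?thesis using M(1) by blast
qed

end
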